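(* Let $\Omega\subset\mathbb{R}^N$ ($N\ge 2$) be a domain and $1<p<\infty$. Suppose that $A$ is locally bounded and locally uniformly positive definite in $\Omega$, i.e. for every $\omega\Subset\Omega$ there is $\Lambda_\omega>0$ such that $\Lambda_\omega^{-1}|\xi|^2\le|\xi|_{A(x)}^2\le\Lambda_\omega|\xi|^2$ for all $x\in\omega$, $\xi\in\mathbb{R}^N$. If $p\ge 2$, suppose in addition that $V\in M^q_{\rm loc}(p;\Omega)$; if $1<p<2$, suppose in addition that $A\in C^{0,\gamma}_{\rm loc}(\Omega;\mathbb{R}^{N^2})$ (locally Hölder continuous) and $V\in M^q_{\rm loc}(\Omega)$ with $q>N$. Suppose further that $L(A,V)$ is critical in $\Omega$. Let $K\subset\Omega$ be a compact set of positive measure with smooth boundary, and let $\phi\in W^{1,p}_{\rm loc}(\Omega)$ be the ground state of $L(A,V)$ in $\Omega$ satisfying the normalization $\|\phi\|_{L^p(K)}=1$. Then for any nonnegative, not identically zero function $W$ on $\Omega\setminus K$ satisfying $$\int_{\Omega\setminus K}\big(|\nabla\varphi|_A^p+V|\varphi|^p\big)\,dx\ \ge\ \int_{\Omega\setminus K}W|\varphi|^p\,dx\qquad\text{for all }\varphi\in C_c^\infty(\Omega\setminus K),$$ and for any compact set $\mathcal{K}\subset\Omega$ with $K$ contained in the interior of $\mathcal{K}$, we have $W\in L^1(\Omega\setminus\mathcal{K},\phi^p\,dx)$, i.e. $\int_{\Omega\setminus\mathcal{K}}W\phi^p\,dx<\infty$.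
   Context: Notation: $\omega\Subset\Omega$ means that $\overline{\omega}$ is compact and contained in $\Omega$; $B_r(y)$ is the open ball of radius $r$ centered at $y$. Here $A$ is a symmetric $N\times N$ real matrix-valued function on $\Omega$, $V:\Omega\to\mathbb{R}$, $|\xi|_{A(x)}:=\langle\xi,A(x)\xi\rangle^{1/2}$, $$L(A,V)u:=-\nabla\cdot\big(|\nabla u|_A^{p-2}A\nabla u\big)+V|u|^{p-2}u,\qquad Q_{A,V}[\varphi]:=\int_\Omega\big(|\nabla\varphi|_A^p+V|\varphi|^p\big)\,dx\quad(\varphi\in C_c^\infty(\Omega)).$$ $A$ is called locally bounded and locally uniformly positive definite in $\Omega$ if for every $\omega\Subset\Omega$ there is $\Lambda_\omega>0$ such that $\Lambda_\omega^{-1}|\xi|^2\le|\xi|_{A(x)}^2\le\Lambda_\omega|\xi|^2$ for all $x\in\omega$, $\xi\in\mathbb{R}^N$. Local Morrey spaces: for $q\in[1,\infty]$, $f\in M^q_{\rm loc}(\Omega)$ means that for every $\omega\Subset\Omega$, $\sup_{y\in\omega}\sup_{r<\mathrm{diam}(\omega)}r^{-N(q-1)/q}\int_{B_r(y)\cap\omega}|f|\,dx<\infty$. The space $M^q_{\rm loc}(p;\Omega)$ is: $M^q_{\rm loc}(\Omega)$ with $q>N/p$ if $p<N$; $L^1_{\rm loc}(\Omega)$ if $p>N$; and if $p=N$, the set of $f$ such that for some $q>N$ and every $\omega\Subset\Omega$, $\sup_{y\in\omega}\sup_{r<\mathrm{diam}(\omega)}\log^{q(N-1)/N}\!\big(\mathrm{diam}(\omega)/r\big)\int_{B_r(y)\cap\omega}|f|\,dx<\infty$.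 A Hardy-weight for $Q_{A,V}$ (equivalently for $L(A,V)$) in $\Omega$ is a nonzero nonnegative $W\in M^q_{\rm loc}(p;\Omega)$ with $Q_{A,V}[\varphi]\ge\int_\Omega W|\varphi|^p\,dx$ for all $\varphi\in C_c^\infty(\Omega)$. $L(A,V)$ (or $Q_{A,V}$) is critical in $\Omega$ if $Q_{A,V}[\varphi]\ge0$ for all $\varphi\in C_c^\infty(\Omega)$ but no Hardy-weight exists in $\Omega$. A null-sequence for a nonnegative $Q_{A,V}$ is a sequence $\{\varphi_k\}\subset C_c^\infty(\Omega)$, $\varphi_k\ge0$, with $\|\varphi_k\|_{L^p(U)}=1$ for all $k$ for some fixed open $U\Subset\Omega$, and $Q_{A,V}[\varphi_k]\to0$. A ground state of $Q_{A,V}$ (or $L(A,V)$) in $\Omega$ is a positive $\phi\in W^{1,p}_{\rm loc}(\Omega)$ that is an $L^p_{\rm loc}(\Omega)$-limit of a null-sequence. It is known that if $A$ is locally bounded and locally uniformly positive definite in $\Omega$, and if moreover $V\in M^q_{\rm loc}(p;\Omega)$ in the case $p\ge2$, or $A\in C^{0,\gamma}_{\rm loc}(\Omega;\mathbb{R}^{N^2})$ and $V\in M^q_{\rm loc}(\Omega)$ with $q>N$ in the case $1<p<2$, then a critical $Q_{A,V}$ has a ground state, which is, up to a multiplicative constant, the unique positive (weak) supersolution of $L(A,V)u=0$ in $\Omega$. *)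

theory Defs
  imports "HOL-Analysis.Analysis"
begin

definition compactly_contained :: "'a::topological_space set \<Rightarrow> 'a set \<Rightarrow> bool"
    (infix "\<Subset>" 50)
  where "\<omega> \<Subset> \<Omega> \<longleftrightarrow> compact (closure \<omega>) \<and> closure \<omega> \<subseteq> \<Omega>"

text \<open>Meant for open \<open>S\<close>: the Frechet derivatives are taken in the full space. Since \<open>v\<close> ranges
  over all directions, the second clause says that all first partial derivatives are
  \<open>C\<^sup>k\<close>.\<close>

primrec Ck_on :: "nat \<Rightarrow> 'a::real_normed_vector set \<Rightarrow> ('a \<Rightarrow> 'b::real_normed_vector) \<Rightarrow> bool"
  where
    "Ck_on 0 S f \<longleftrightarrow> continuous_on S f"
  | "Ck_on (Suc k) S f \<longleftrightarrow> (\<forall>x\<in>S. f differentiable (at x)) \<and>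
       (\<forall>v. Ck_on k S (\<lambda>x. frechet_derivative f (at x) v))"

definition smooth_on :: "'a::real_normed_vector set \<Rightarrow> ('a \<Rightarrow> 'b::real_normed_vector) \<Rightarrow> bool"
  where "smooth_on S f \<longleftrightarrow> (\<forall>k. Ck_on k S f)"

text \<open>\<open>C\<^sub>c\<^sup>\<infinity>(\<Omega>)\<close> for open \<open>\<Omega>\<close>, its elements being extended by zero to the whole space.\<close>

definition test_fun :: "(real^'n) set \<Rightarrow> (real^'n \<Rightarrow> real) set"
  where "test_fun \<Omega> = {\<phi>. smooth_on UNIV \<phi> \<and> {x. \<phi> x \<noteq> 0} \<Subset> \<Omega>}"

definition grad :: "(real^'n \<Rightarrow> real) \<Rightarrow> real^'n \<Rightarrow> real^'n"
  where "grad f x = (\<chi> i. frechet_derivative f (at x) (axis i 1))"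

definition Lp_norm :: "real \<Rightarrow> (real^'n) set \<Rightarrow> (real^'n \<Rightarrow> 'b::real_normed_vector) \<Rightarrow> real"
  where "Lp_norm p S f = (LINT x:S|lebesgue. norm (f x) powr p) powr (1 / p)"

definition Lp_loc :: "real \<Rightarrow> (real^'n) set \<Rightarrow> (real^'n \<Rightarrow> 'b::real_normed_vector) set"
  where "Lp_loc p \<Omega> = {f. f \<in> borel_measurable (lebesgue_on \<Omega>) \<and>
     (\<forall>C. compact C \<and> C \<subseteq> \<Omega> \<longrightarrow> set_integrable lebesgue C (\<lambda>x. norm (f x) powr p))}"

definition weak_grad :: "(real^'n) set \<Rightarrow> (real^'n \<Rightarrow> real) \<Rightarrow> (real^'n \<Rightarrow> real^'n) \<Rightarrow> bool"
  where "weak_grad \<Omega> u G \<longleftrightarrow> u \<in> Lp_loc 1 \<Omega> \<and> G \<in> Lp_loc 1 \<Omega> \<and>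
     (\<forall>\<psi>\<in>test_fun \<Omega>. \<forall>i. (LINT x:\<Omega>|lebesgue. u x * grad \<psi> x $ i)
                          = - (LINT x:\<Omega>|lebesgue. G x $ i * \<psi> x))"

definition W1p_loc :: "real \<Rightarrow> (real^'n) set \<Rightarrow> (real^'n \<Rightarrow> real) set"
  where "W1p_loc p \<Omega> = {u \<in> Lp_loc p \<Omega>. \<exists>G\<in>Lp_loc p \<Omega>. weak_grad \<Omega> u G}"

text \<open>The exponent \<open>q\<close> ranges over the extended reals in \<open>[1,\<infinity>]\<close>. The exponent of \<open>r\<close> is written
  as \<open>-N (1 - 1/q)\<close>, which equals \<open>-N (q-1)/q\<close> for finite \<open>q\<close> and its limit \<open>-N\<close> for \<open>q = \<infinity>\<close>.
  The set \<open>\<omega>\<close> need not be measurable: it may always be replaced by a larger relatively compact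
  open set, and nonnegative integrals are monotone.\<close>

definition morrey_loc :: "ereal \<Rightarrow> (real^'n) set \<Rightarrow> (real^'n \<Rightarrow> real) set"
  where "morrey_loc q \<Omega> = {f. f \<in> borel_measurable (lebesgue_on \<Omega>) \<and>
     (\<forall>\<omega>. \<omega> \<Subset> \<Omega> \<longrightarrow>
       (SUP y\<in>\<omega>. SUP r\<in>{0<..<diameter \<omega>}.
          ennreal (r powr (- (real CARD('n) * real_of_ereal (1 - 1 / q)))) *
          (\<integral>\<^sup>+x\<in>ball y r \<inter> \<omega>. ennreal \<bar>f x\<bar> \<partial>lebesgue)) < \<infinity>)}"

definition morrey_log_loc :: "real \<Rightarrow> (real^'n) set \<Rightarrow> (real^'n \<Rightarrow> real) set"
  where "morrey_log_loc q \<Omega> = {f. f \<in> borel_measurable (lebesgue_on \<Omega>) \<and>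
     (\<forall>\<omega>. \<omega> \<Subset> \<Omega> \<longrightarrow>
       (SUP y\<in>\<omega>. SUP r\<in>{0<..<diameter \<omega>}.
          ennreal (ln (diameter \<omega> / r) powr (q * (real CARD('n) - 1) / real CARD('n))) *
          (\<integral>\<^sup>+x\<in>ball y r \<inter> \<omega>. ennreal \<bar>f x\<bar> \<partial>lebesgue)) < \<infinity>)}"

text \<open>The space \<open>M\<^sup>q\<^sub>l\<^sub>o\<^sub>c(p;\<Omega>)\<close>, with \<open>q\<close> existentially quantified in its admissible range.\<close>

definition morrey_p_loc :: "real \<Rightarrow> (real^'n) set \<Rightarrow> (real^'n \<Rightarrow> real) set"
  where "morrey_p_loc p \<Omega> =
     (if p < real CARD('n) then (\<Union>q\<in>{q. ereal (real CARD('n) / p) < q}. morrey_loc q \<Omega>)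
      else if p > real CARD('n) then Lp_loc 1 \<Omega>
      else (\<Union>q\<in>{q. real CARD('n) < q}. morrey_log_loc q \<Omega>))"

definition norm_mat :: "real^'n^'n \<Rightarrow> real^'n \<Rightarrow> real"
  where "norm_mat M \<xi> = sqrt (\<xi> \<bullet> (M *v \<xi>))"

text \<open>The ellipticity bounds are stated for the quadratic form itself rather than for
  \<open>(norm_mat (A x) \<xi>)\<^sup>2\<close>, because \<open>sqrt\<close> is an odd function on the reals and the latter would not
  exclude negative definite matrices.\<close>

definition locally_elliptic :: "(real^'n) set \<Rightarrow> (real^'n \<Rightarrow> real^'n^'n) \<Rightarrow> bool"
  where "locally_elliptic \<Omega> A \<longleftrightarrow>
     (\<forall>\<omega>. \<omega> \<Subset> \<Omega> \<longrightarrow> (\<exists>\<Lambda>>0. \<forall>x\<in>\<omega>. \<forall>\<xi>.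
        inverse \<Lambda> * (norm \<xi>)\<^sup>2 \<le> \<xi> \<bullet> (A x *v \<xi>) \<and> \<xi> \<bullet> (A x *v \<xi>) \<le> \<Lambda> * (norm \<xi>)\<^sup>2))"

definition hoelder_loc :: "real \<Rightarrow> 'a::metric_space set \<Rightarrow> ('a \<Rightarrow> 'b::metric_space) \<Rightarrow> bool"
  where "hoelder_loc \<gamma> \<Omega> f \<longleftrightarrow>
     (\<forall>\<omega>. \<omega> \<Subset> \<Omega> \<longrightarrow> (\<exists>C. \<forall>x\<in>\<omega>. \<forall>y\<in>\<omega>. dist (f x) (f y) \<le> C * dist x y powr \<gamma>))"

definition Q_form ::
    "(real^'n \<Rightarrow> real^'n^'n) \<Rightarrow> (real^'n \<Rightarrow> real) \<Rightarrow> real \<Rightarrow> (real^'n) set \<Rightarrow> (real^'n \<Rightarrow> real) \<Rightarrow> real"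
  where "Q_form A V p \<Omega> \<phi> =
     (LINT x:\<Omega>|lebesgue. norm_mat (A x) (grad \<phi> x) powr p + V x * \<bar>\<phi> x\<bar> powr p)"

text \<open>Functions are understood up to null sets, so \<open>nonzero\<close> means not almost everywhere zero.\<close>

definition nonneg_nonzero_on :: "(real^'n) set \<Rightarrow> (real^'n \<Rightarrow> real) \<Rightarrow> bool"
  where "nonneg_nonzero_on S W \<longleftrightarrow> W \<in> borel_measurable (lebesgue_on S) \<and>
     (AE x in lebesgue_on S. 0 \<le> W x) \<and> \<not> (AE x in lebesgue_on S. W x = 0)"

text \<open>Integrability is part of the inequality: the Bochner integral of a function that is not
  integrable is \<open>0\<close>, whereas \<open>\<integral> W |\<phi>|\<^sup>p\<close> is to be read as an element of \<open>[0,\<infinity>]\<close>.\<close>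

definition hardy_inequality ::
    "(real^'n \<Rightarrow> real^'n^'n) \<Rightarrow> (real^'n \<Rightarrow> real) \<Rightarrow> real \<Rightarrow> (real^'n) set \<Rightarrow> (real^'n \<Rightarrow> real) \<Rightarrow> bool"
  where "hardy_inequality A V p \<Omega> W \<longleftrightarrow>
     (\<forall>\<phi>\<in>test_fun \<Omega>. set_integrable lebesgue \<Omega> (\<lambda>x. W x * \<bar>\<phi> x\<bar> powr p) \<and>
        Q_form A V p \<Omega> \<phi> \<ge> (LINT x:\<Omega>|lebesgue. W x * \<bar>\<phi> x\<bar> powr p))"

definition hardy_weight ::
    "(real^'n \<Rightarrow> real^'n^'n) \<Rightarrow> (real^'n \<Rightarrow> real) \<Rightarrow> real \<Rightarrow> (real^'n) set \<Rightarrow> (real^'n \<Rightarrow> real) \<Rightarrow> bool"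
  where "hardy_weight A V p \<Omega> W \<longleftrightarrow>
     nonneg_nonzero_on \<Omega> W \<and> W \<in> morrey_p_loc p \<Omega> \<and> hardy_inequality A V p \<Omega> W"

definition critical ::
    "(real^'n \<Rightarrow> real^'n^'n) \<Rightarrow> (real^'n \<Rightarrow> real) \<Rightarrow> real \<Rightarrow> (real^'n) set \<Rightarrow> bool"
  where "critical A V p \<Omega> \<longleftrightarrow>
     (\<forall>\<phi>\<in>test_fun \<Omega>. Q_form A V p \<Omega> \<phi> \<ge> 0) \<and> \<not> (\<exists>W. hardy_weight A V p \<Omega> W)"

definition null_sequence ::
    "(real^'n \<Rightarrow> real^'n^'n) \<Rightarrow> (real^'n \<Rightarrow> real) \<Rightarrow> real \<Rightarrow> (real^'n) set \<Rightarrow> (nat \<Rightarrow> real^'n \<Rightarrow> real) \<Rightarrow> bool"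
  where "null_sequence A V p \<Omega> \<phi> \<longleftrightarrow>
     (\<forall>k. \<phi> k \<in> test_fun \<Omega> \<and> (\<forall>x. 0 \<le> \<phi> k x)) \<and>
     (\<exists>U. open U \<and> U \<Subset> \<Omega> \<and> (\<forall>k. Lp_norm p U (\<phi> k) = 1)) \<and>
     (\<lambda>k. Q_form A V p \<Omega> (\<phi> k)) \<longlonglongrightarrow> 0"

definition ground_state ::
    "(real^'n \<Rightarrow> real^'n^'n) \<Rightarrow> (real^'n \<Rightarrow> real) \<Rightarrow> real \<Rightarrow> (real^'n) set \<Rightarrow> (real^'n \<Rightarrow> real) \<Rightarrow> bool"
  where "ground_state A V p \<Omega> u \<longleftrightarrow>
     u \<in> W1p_loc p \<Omega> \<and> (AE x in lebesgue_on \<Omega>. 0 < u x) \<and>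
     (\<exists>\<phi>. null_sequence A V p \<Omega> \<phi> \<and>
        (\<forall>C. compact C \<and> C \<subseteq> \<Omega> \<longrightarrow> (\<lambda>k. Lp_norm p C (\<lambda>x. \<phi> k x - u x)) \<longlonglongrightarrow> 0))"

text \<open>Near each boundary point, after relabelling and reorienting the coordinate axes, \<open>K\<close> is the
  closed region on one side of the graph of a smooth function of the other \<open>N - 1\<close> coordinates.
  That function is represented by a smooth \<open>g\<close> on the full space, evaluated at the projection
  of \<open>x\<close> to the hyperplane where the \<open>i\<close>-th coordinate vanishes.\<close>

definition smooth_boundary :: "(real^'n) set \<Rightarrow> bool"
  where "smooth_boundary K \<longleftrightarrow>
     (\<forall>x0\<in>frontier K. \<exists>r>0. \<exists>i. \<exists>s\<in>{-1, 1}. \<exists>g :: real^'n \<Rightarrow> real. smooth_on UNIV g \<and>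
        (\<forall>x\<in>ball x0 r. x \<in> K \<longleftrightarrow> s * x $ i \<le> g (x - x $ i *\<^sub>R axis i 1)))"

end

theory Submission
  imports Defs
begin

text \<open>Let \<open>\<phi>\<^sub>k\<close> be a null-sequence converging to \<open>\<phi>\<close>, and let \<open>\<zeta>\<close> be a smooth cutoff with \<open>\<zeta> = 1\<close> near
  \<open>K\<close> and \<open>\<zeta> = 0\<close> off \<open>\<K>\<close>. Testing the Hardy inequality with \<open>(1 - \<zeta>) \<phi>\<^sub>k\<close> bounds
  \<open>\<integral> W \<phi>\<^sub>k\<^sup>p\<close> over \<open>\<Omega> - \<K>\<close> by \<open>Q[(1 - \<zeta>) \<phi>\<^sub>k]\<close>, and Fatou's lemma finishes the proof once these
  energies are bounded. If \<open>\<zeta>\<close> is a high power of a cutoff, then convexity of \<open>t \<mapsto> t\<^sup>p\<close> with weights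
  \<open>1 - \<zeta>\<close> and \<open>\<zeta>\<close> gives
  \<open>|\<nabla>((1 - \<zeta>) \<phi>\<^sub>k)|\<^sup>p \<le> (1 - \<zeta>) |\<nabla>\<phi>\<^sub>k|\<^sup>p + C \<phi>\<^sub>k\<^sup>p\<close>, where the last term lives on \<open>\<K>\<close>. Hence
  \<open>Q[(1 - \<zeta>) \<phi>\<^sub>k]\<close> is at most
  \<open>Q[\<phi>\<^sub>k] - \<integral> \<zeta> |\<nabla>\<phi>\<^sub>k|\<^sup>p + C \<integral> \<zeta> |V| \<phi>\<^sub>k\<^sup>p + C \<integral> \<phi>\<^sub>k\<^sup>p\<close>, and the negative gradient term absorbs the
  potential term by the Morrey--Adams inequality
  \<open>\<integral> |V| |u|\<^sup>p \<le> \<epsilon> \<integral> |\<nabla>u|\<^sup>p + C\<^sub>\<epsilon> \<integral> |u|\<^sup>p\<close> for \<open>u = \<zeta>\<^sup>1\<^sup>/\<^sup>p \<phi>\<^sub>k\<close>. The latter follows from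
  the representation of \<open>u\<close> by the Riesz potential of \<open>\<nabla>u\<close>, Hoelder's inequality with the weight
  \<open>|x - y|\<^sup>-\<^sup>s\<close> (or a power of \<open>log (1/|x - y|)\<close> if \<open>p = N\<close>), and Fubini.\<close>

section \<open>Smooth cutoff functions\<close>

text \<open>Since \<open>V\<close> may change sign, \<open>Q[\<phi>_k] \<rightarrow> 0\<close> alone
  gives no bound on the gradients of the null-sequence; only the L^p norms on compact sets are under
  control. Every gradient term must therefore cancel. A splitting such as
  \<open>(a + b)^p \<le> (1 + \<delta>) a^p + C b^p\<close> would leave a positive multiple of
  \<open>|\<nabla>\<phi>_k|^p\<close> where the cutoff is small, with no gain there to pay for it.
  The weights \<open>1 - \<zeta>\<close> and \<open>\<zeta>\<close> leave no such excess; their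
  price is the factor \<open>\<zeta>^(1-p) |\<nabla>\<zeta>|^p\<close>, and a bound
  \<open>|\<nabla>\<zeta>|^p \<le> C \<zeta>^(p-1)\<close> makes it harmless. This is what the high
  power of a cutoff provides. Off \<K> the functions \<open>(1 - \<zeta>) \<phi>_k\<close> and
  \<open>\<phi>_k\<close> agree, so the constants depend on \<open>A\<close> and \<open>V\<close>
  inside \<K> only, where both are controlled by compactness.\<close>

lemma frechet_derivative_eqI:
  "(f has_derivative D) (at x) \<Longrightarrow> frechet_derivative f (at x) = D"
  using frechet_derivative_at by metis

text \<open>The product rule leaves one factor undifferentiated, so induction on the order needs
  that factor one order lower as well.\<close>

lemma Ck_on_SucD: "Ck_on (Suc k) UNIV f \<Longrightarrow> Ck_on k UNIV f"
proof (induction k arbitrary: f)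
  case 0
  then show ?case
    by (auto simp: continuous_on_eq_continuous_within intro: differentiable_imp_continuous_within)
next
  case (Suc k)
  then show ?case by (metis Ck_on.simps(2))
qed

lemma Ck_on_const: "Ck_on k UNIV (\<lambda>x. c)"
  by (induction k arbitrary: c) auto

lemma Ck_on_add:
  "Ck_on k UNIV f \<Longrightarrow> Ck_on k UNIV g \<Longrightarrow> Ck_on k UNIV (\<lambda>x. f x + g x)"
proof (induction k arbitrary: f g)
  case (Suc k)
  have "frechet_derivative (\<lambda>x. f x + g x) (at x) v =
      frechet_derivative f (at x) v + frechet_derivative g (at x) v" for x v
    using Suc.prems
    by (subst frechet_derivative_eqI[OF has_derivative_add])
      (auto intro: frechet_derivative_works[THEN iffD1])
  then show ?case using Suc by auto
qed (auto intro: continuous_on_add continuous_on_mult)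

lemma Ck_on_mult:
  fixes f g :: "'a::real_normed_vector \<Rightarrow> real"
  shows "Ck_on k UNIV f \<Longrightarrow> Ck_on k UNIV g \<Longrightarrow> Ck_on k UNIV (\<lambda>x. f x * g x)"
proof (induction k arbitrary: f g)
  case (Suc k)
  have "frechet_derivative (\<lambda>x. f x * g x) (at x) v =
      f x * frechet_derivative g (at x) v + frechet_derivative f (at x) v * g x" for x v
    using Suc.prems
    by (subst frechet_derivative_eqI[OF has_derivative_mult])
      (auto intro: frechet_derivative_works[THEN iffD1])
  moreover have "Ck_on k UNIV f" "Ck_on k UNIV g"
    using Suc.prems Ck_on_SucD by blast+
  ultimately show ?case using Suc by (auto intro!: Ck_on_add)
qed (auto intro: continuous_on_add continuous_on_mult)

lemma Ck_on_linear:
  fixes f :: "'a::real_normed_vector \<Rightarrow> 'b::real_normed_vector"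
  assumes "bounded_linear f" shows "Ck_on k UNIV f"
proof (cases k)
  case 0
  then show ?thesis using assms by (simp add: linear_continuous_on)
next
  case (Suc k')
  have "frechet_derivative f (at x) = f" for x
    using assms by (intro frechet_derivative_eqI bounded_linear_imp_has_derivative)
  then show ?thesis
    using assms Suc by (auto intro: bounded_linear_imp_differentiable Ck_on_const)
qed

lemma smooth_on_const: "smooth_on UNIV (\<lambda>x. c)"
  by (simp add: smooth_on_def Ck_on_const)

lemma smooth_on_add: "smooth_on UNIV f \<Longrightarrow> smooth_on UNIV g \<Longrightarrow> smooth_on UNIV (\<lambda>x. f x + g x)"
  by (simp add: smooth_on_def Ck_on_add)

lemma smooth_on_mult:
  fixes f g :: "'a::real_normed_vector \<Rightarrow> real"
  shows "smooth_on UNIV f \<Longrightarrow> smooth_on UNIV g \<Longrightarrow> smooth_on UNIV (\<lambda>x. f x * g x)"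
  by (simp add: smooth_on_def Ck_on_mult)

lemma smooth_on_diff:
  fixes f g :: "'a::real_normed_vector \<Rightarrow> real"
  shows "smooth_on UNIV f \<Longrightarrow> smooth_on UNIV g \<Longrightarrow> smooth_on UNIV (\<lambda>x. f x - g x)"
  using smooth_on_add[of f "\<lambda>x. (-1) * g x"] smooth_on_mult[OF smooth_on_const, of g "-1"]
  by simp

lemma smooth_on_power:
  fixes f :: "'a::real_normed_vector \<Rightarrow> real"
  shows "smooth_on UNIV f \<Longrightarrow> smooth_on UNIV (\<lambda>x. f x ^ n)"
  by (induction n) (auto intro: smooth_on_const smooth_on_mult)

lemma smooth_on_sum:
  "finite I \<Longrightarrow> (\<And>i. i \<in> I \<Longrightarrow> smooth_on UNIV (f i)) \<Longrightarrow> smooth_on UNIV (\<lambda>x. \<Sum>i\<in>I. f i x)"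
  by (induction I rule: finite_induct) (auto intro: smooth_on_const smooth_on_add)

lemma smooth_on_linear: "bounded_linear f \<Longrightarrow> smooth_on UNIV f"
  by (simp add: smooth_on_def Ck_on_linear)

lemma smooth_on_continuous: "smooth_on UNIV f \<Longrightarrow> continuous_on UNIV f"
  unfolding smooth_on_def by (metis Ck_on.simps(1))

section \<open>Flat functions and cutoffs\<close>

text \<open>The functions \<open>q(1/t) exp(-1/t)\<close>, extended by 0, form a family closed under
  differentiation. With the polynomial as a parameter, smoothness follows by induction on the order
  for all \<open>q\<close> at once; \<open>q = 1\<close> is the standard flat function.\<close>

definition exp_inv_poly :: "real poly \<Rightarrow> real \<Rightarrow> real"
  where "exp_inv_poly q t = (if t > 0 then poly q (1 / t) * exp (- (1 / t)) else 0)"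

lemma poly_times_exp_minus_tendsto_0:
  "((\<lambda>s. poly q s * exp (- s)) \<longlongrightarrow> (0::real)) at_top"
proof -
  have "((\<lambda>s. \<Sum>i\<le>degree q. coeff q i * (s ^ i / exp s)) \<longlongrightarrow> (\<Sum>i\<le>degree q. coeff q i * 0)) at_top"
    by (intro tendsto_intros tendsto_power_div_exp_0)
  moreover have "(\<Sum>i\<le>degree q. coeff q i * (s ^ i / exp s)) = poly q s * exp (- s)" for s
    by (simp add: poly_altdef sum_distrib_right exp_minus divide_inverse mult.assoc)
  ultimately show ?thesis by simp
qed

text \<open>With \<open>s = 1/t\<close>, differentiation sends \<open>q(s) exp(-s)\<close> to
  \<open>s^2 (q - q')(s) exp(-s)\<close>, and \<open>[:0, 0, 1:]\<close> is
  \<open>s^2\<close>.\<close>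

lemma exp_inv_poly_has_derivative:
  "(exp_inv_poly q has_real_derivative exp_inv_poly ([:0, 0, 1:] * (q - pderiv q)) t) (at t)"
proof -
  consider "t > 0" | "t < 0" | "t = 0" by linarith
  then show ?thesis
  proof cases
    case 1
    have "((\<lambda>t. poly q (1 / t) * exp (- (1 / t))) has_real_derivative
        exp_inv_poly ([:0, 0, 1:] * (q - pderiv q)) t) (at t)"
      unfolding exp_inv_poly_def using 1
      by (auto intro!: derivative_eq_intros poly_DERIV[THEN DERIV_chain2] simp: field_simps power2_eq_square)
    then show ?thesis
      by (rule has_field_derivative_transform_within_open[of _ _ _ "{0<..}"])
        (use 1 in \<open>auto simp: exp_inv_poly_def\<close>)
  next
    case 2
    have "((\<lambda>t. 0) has_real_derivative exp_inv_poly ([:0, 0, 1:] * (q - pderiv q)) t) (at t)"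
      using 2 by (auto simp: exp_inv_poly_def)
    then show ?thesis
      by (rule has_field_derivative_transform_within_open[of _ _ _ "{..<0}"])
        (use 2 in \<open>auto simp: exp_inv_poly_def\<close>)
  next
    case 3
    have "((\<lambda>y. (exp_inv_poly q y - exp_inv_poly q 0) / (y - 0)) \<longlongrightarrow> 0) (at_right 0)"
    proof -
      \<comment> \<open>Dividing by \<open>y\<close> multiplies the polynomial in
        \<open>1 / y\<close> by its variable, hence \<open>pCons 0 q\<close>; the difference
        quotient is again a polynomial times a decaying exponential.\<close>
      have "((\<lambda>y. poly (pCons 0 q) (1 / y) * exp (- (1 / y))) \<longlongrightarrow> (0::real)) (at_right 0)"
        using filterlim_compose[OF poly_times_exp_minus_tendsto_0[of "pCons 0 q"] filterlim_inverse_at_top_right]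
        by (simp add: inverse_eq_divide)
      moreover have "\<forall>\<^sub>F y in at_right 0. poly (pCons 0 q) (1 / y) * exp (- (1 / y))
          = (exp_inv_poly q y - exp_inv_poly q 0) / (y - 0)"
        unfolding eventually_at_right_field exp_inv_poly_def
        by (auto intro!: exI[of _ 1])
      ultimately show ?thesis by (rule Lim_transform_eventually)
    qed
    moreover have "((\<lambda>y. (exp_inv_poly q y - exp_inv_poly q 0) / (y - 0)) \<longlongrightarrow> 0) (at_left 0)"
    proof -
      have "\<forall>\<^sub>F y in at_left 0. 0 = (exp_inv_poly q y - exp_inv_poly q 0) / (y - 0)"
        unfolding eventually_at_left_field exp_inv_poly_def
        by (auto intro!: exI[of _ "-1"])
      then show ?thesis by (rule Lim_transform_eventually[OF tendsto_const])
    qed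
    ultimately show ?thesis
      using 3 by (simp add: has_field_derivative_iff filterlim_split_at exp_inv_poly_def)
  qed
qed

lemma Ck_on_exp_inv_poly:
  assumes "smooth_on UNIV (F :: 'a::real_normed_vector \<Rightarrow> real)"
  shows "Ck_on k UNIV (\<lambda>x. exp_inv_poly q (F x))"
proof (induction k arbitrary: q)
  case 0
  have "continuous_on UNIV (exp_inv_poly q)"
    by (meson DERIV_continuous_on exp_inv_poly_has_derivative has_field_derivative_at_within)
  then show ?case
    using continuous_on_compose2[OF _ smooth_on_continuous[OF assms], of UNIV] by simp
next
  case (Suc k)
  let ?r = "[:0, 0, 1:] * (q - pderiv q)"
  have F: "\<And>x. F differentiable (at x)" "\<And>v. Ck_on k UNIV (\<lambda>x. frechet_derivative F (at x) v)"
    using assms unfolding smooth_on_def by (metis Ck_on.simps(2) UNIV_I)+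
  have d: "((\<lambda>x. exp_inv_poly q (F x)) has_derivative
      (\<lambda>v. exp_inv_poly ?r (F x) * frechet_derivative F (at x) v)) (at x)" for x
    using has_derivative_compose[OF frechet_derivative_works[THEN iffD1, OF F(1)]
        exp_inv_poly_has_derivative[unfolded has_field_derivative_def]] .
  have "frechet_derivative (\<lambda>x. exp_inv_poly q (F x)) (at x) v
      = exp_inv_poly ?r (F x) * frechet_derivative F (at x) v" for x v
    by (subst frechet_derivative_eqI[OF d]) simp
  moreover have "(\<lambda>x. exp_inv_poly q (F x)) differentiable (at x)" for x
    using d differentiableI by blast
  ultimately show ?case
    using Ck_on_mult[OF Suc.IH F(2)] by simp
qed

lemma smooth_on_exp_inv_poly:
  "smooth_on UNIV (F :: 'a::real_normed_vector \<Rightarrow> real) \<Longrightarrow> smooth_on UNIV (\<lambda>x. exp_inv_poly q (F x))"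
  by (simp add: Ck_on_exp_inv_poly smooth_on_def)

lemma smooth_on_norm_sq:
  fixes a :: "'a::euclidean_space"
  shows "smooth_on UNIV (\<lambda>x. (norm (x - a))\<^sup>2)"
proof -
  have "smooth_on UNIV (\<lambda>x. (x - a) \<bullet> b)" for b
    using smooth_on_diff[OF smooth_on_linear[OF bounded_linear_inner_left] smooth_on_const, of b "a \<bullet> b"]
    by (simp add: inner_diff_left)
  then have "smooth_on UNIV (\<lambda>x. \<Sum>b\<in>Basis. ((x - a) \<bullet> b) * ((x - a) \<bullet> b))"
    by (intro smooth_on_sum smooth_on_mult) auto
  then show ?thesis
    by (simp add: power2_norm_eq_inner euclidean_inner[of "_ - a" "_ - a"])
qed

text \<open>With \<open>h t = exp (-1/t)\<close> for \<open>t > 0\<close> and a sum \<open>F\<close> of bumps that is at least \<open>c\<close> near \<open>K\<close>,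
  the function \<open>1 - h (c - F) / h c\<close> is \<open>1\<close> where \<open>F \<ge> c\<close> and \<open>0\<close> where \<open>F = 0\<close>.\<close>

lemma smooth_cutoff:
  fixes K U :: "'a::euclidean_space set"
  assumes "compact K" "open U" "K \<subseteq> U"
  obtains \<xi> :: "'a \<Rightarrow> real" and N where "smooth_on UNIV \<xi>" "\<And>x. 0 \<le> \<xi> x" "\<And>x. \<xi> x \<le> 1"
    "open N" "K \<subseteq> N" "\<And>x. x \<in> N \<Longrightarrow> \<xi> x = 1" "{x. \<xi> x \<noteq> 0} \<Subset> U"
proof -
  have "\<forall>x\<in>K. \<exists>r>0. cball x r \<subseteq> U"
    using assms open_contains_cball by blast
  then obtain r where r: "\<And>x. x \<in> K \<Longrightarrow> r x > 0" "\<And>x. x \<in> K \<Longrightarrow> cball x (r x) \<subseteq> U"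
    by metis
  obtain T where T: "T \<subseteq> K" "finite T" "K \<subseteq> (\<Union>x\<in>T. ball x (r x))"
  proof (rule compactE_image[OF assms(1), of K "\<lambda>x. ball x (r x)"])
    show "K \<subseteq> (\<Union>x\<in>K. ball x (r x))" using r(1) by force
  qed auto
  define h where "h = exp_inv_poly 1"
  have h0: "h t = 0" if "t \<le> 0" for t using that by (simp add: h_def exp_inv_poly_def)
  have hpos: "h t > 0" if "t > 0" for t using that by (simp add: h_def exp_inv_poly_def)
  have hnn: "h t \<ge> 0" for t by (simp add: h_def exp_inv_poly_def)
  have hmono: "h s \<le> h t" if "s \<le> t" for s t
    using that by (auto simp: h_def exp_inv_poly_def field_simps)
  define f where "f i x = h ((r i)\<^sup>2 - (norm (x - i))\<^sup>2)" for i x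
  define F where "F x = (\<Sum>i\<in>T. f i x)" for x
  have Fs: "smooth_on UNIV F"
    unfolding F_def f_def h_def
    by (intro smooth_on_sum smooth_on_exp_inv_poly smooth_on_diff smooth_on_const smooth_on_norm_sq T)
  have fnn: "f i x \<ge> 0" for i x using hnn by (simp add: f_def)
  have Fnn: "F x \<ge> 0" for x by (simp add: F_def fnn sum_nonneg)
  have Fpos: "F x > 0" if xK: "x \<in> K" for x
  proof -
    obtain i where i: "i \<in> T" "x \<in> ball i (r i)" using T xK by auto
    then have "(norm (x - i))\<^sup>2 < (r i)\<^sup>2"
      by (intro power_strict_mono) (auto simp: dist_norm norm_minus_commute)
    then have "0 < f i x" by (auto simp: f_def intro: hpos)
    also have "\<dots> \<le> F x" unfolding F_def by (rule member_le_sum) (use i T fnn in auto)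
    finally show ?thesis .
  qed
  have Fcont: "continuous_on S F" for S
    using smooth_on_continuous[OF Fs] continuous_on_subset by blast
  \<comment> \<open>A level strictly below the minimum of \<open>F\<close> on the compact set
    \<open>K\<close> makes \<open>{x. F x > c}\<close> an open neighbourhood of
    \<open>K\<close>.\<close>
  obtain c where c: "c > 0" "\<And>x. x \<in> K \<Longrightarrow> F x > c"
  proof (cases "K = {}")
    case True
    then show ?thesis using that[of 1] by auto
  next
    case False
    obtain x0 where "x0 \<in> K" "\<And>x. x \<in> K \<Longrightarrow> F x0 \<le> F x"
      using continuous_attains_inf[OF assms(1) False Fcont] by auto
    then show ?thesis using that[of "F x0 / 2"] Fpos by (force)
  qed
  define \<xi> where "\<xi> x = 1 - (1 / h c) * h (c - F x)" for x
  have hc: "h c > 0" using hpos c by simp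
  show ?thesis
  proof (rule that)
    show "smooth_on UNIV \<xi>"
      unfolding \<xi>_def h_def
      by (intro smooth_on_diff smooth_on_mult smooth_on_const smooth_on_exp_inv_poly Fs)
    show "0 \<le> \<xi> x" for x
      using hmono[of "c - F x" c] Fnn[of x] hc by (simp add: \<xi>_def)
    show "\<xi> x \<le> 1" for x using hnn hc by (simp add: \<xi>_def)
    show "open {x. F x > c}" using Fcont[of UNIV] by (simp add: open_Collect_less)
    show "K \<subseteq> {x. F x > c}" using c by auto
    show "\<xi> x = 1" if "x \<in> {x. F x > c}" for x using that h0 by (simp add: \<xi>_def)
    let ?C = "\<Union>i\<in>T. cball i (r i)"
    have "{x. \<xi> x \<noteq> 0} \<subseteq> ?C"
    proof
      fix x assume "x \<in> {x. \<xi> x \<noteq> 0}"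
      then have "F x \<noteq> 0" using hc by (auto simp: \<xi>_def)
      then obtain i where i: "i \<in> T" "f i x \<noteq> 0" unfolding F_def by (meson sum.neutral)
      then have "(norm (x - i))\<^sup>2 \<le> (r i)\<^sup>2" unfolding f_def
        using h0[of "(r i)\<^sup>2 - (norm (x - i))\<^sup>2"] by linarith
      moreover have "0 \<le> r i" using r(1)[of i] i(1) T(1) by (simp add: subset_iff order.strict_implies_order)
      ultimately have "norm (x - i) \<le> r i" by (rule power2_le_imp_le)
      then show "x \<in> ?C" using i by (auto simp: dist_norm norm_minus_commute)
    qed
    moreover have C: "compact ?C" using T by (intro compact_UN) auto
    moreover have "?C \<subseteq> U" using r T by blast
    moreover have "closure {x. \<xi> x \<noteq> 0} \<subseteq> ?C"
      using calculation(1) compact_imp_closed[OF C] by (rule closure_minimal)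
    ultimately show "{x. \<xi> x \<noteq> 0} \<Subset> U"
      unfolding compactly_contained_def using bounded_subset[OF compact_imp_bounded[OF C]]
      by (auto simp: compact_closure)
  qed
qed

section \<open>A pointwise bound by the Riesz potential of the gradient\<close>

text \<open>The endpoint 0 is added to convexity on the open half-line: since
  \<open>0 powr p = 0\<close>, the claim there reduces to \<open>s powr p \<le> s\<close> on
  \<open>(0, 1)\<close>.\<close>

lemma powr_convex_nonneg:
  assumes "p \<ge> 1" shows "convex_on {0..} (\<lambda>x::real. x powr p)"
proof (rule convex_onI)
  fix t x y :: real assume t: "0 < t" "t < 1" and xy: "x \<in> {0..}" "y \<in> {0..}"
  show "((1 - t) *\<^sub>R x + t *\<^sub>R y) powr p \<le> (1 - t) * x powr p + t * y powr p"
  proof (cases "x = 0 \<or> y = 0")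
    case True
    have "s powr p \<le> s" if "0 < s" "s < 1" for s :: real
      using powr_mono'[of 1 p s] that assms by simp
    then have "s powr p * z \<le> s * z" if "0 < s" "s < 1" "z \<ge> 0" for s z :: real
      using that by (simp add: mult_right_mono)
    then show ?thesis using True t xy by (auto simp: powr_mult)
  next
    case False
    then show ?thesis
      using convex_onD[OF powr_convex[OF assms], of t x y] t xy by auto
  qed
qed (simp add: convex_real_interval)

lemma add_powr_le:
  fixes a b p :: real
  assumes "a \<ge> 0" "b \<ge> 0" "p \<ge> 1"
  shows "(a + b) powr p \<le> 2 powr (p - 1) * (a powr p + b powr p)"
proof -
  have "((a + b) / 2) powr p \<le> (a powr p + b powr p) / 2"
    using convex_onD[OF powr_convex_nonneg[OF assms(3)], of "1/2" a b] assms
    by (simp add: field_simps)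
  then show ?thesis
    using assms by (simp add: powr_divide powr_diff field_simps)
qed

text \<open>The integral of \<open>f h\<close> may be infinite, so the statement uses an arbitrary
  real \<open>c\<close> below it, and \<open>b\<close> only bounds the integral of the conjugate
  power. The proof is Young's inequality after both factors are scaled.\<close>

lemma nn_integral_Hoelder:
  fixes f h :: "'a \<Rightarrow> real" and p c b :: real
  assumes p: "1 < p"
    and [measurable]: "f \<in> borel_measurable M" "h \<in> borel_measurable M"
    and f: "\<And>x. f x \<ge> 0" and h: "\<And>x. h x \<ge> 0"
    and c: "0 \<le> c" "ennreal c \<le> (\<integral>\<^sup>+x. ennreal (f x * h x) \<partial>M)"
    and b: "b > 0" "(\<integral>\<^sup>+x. ennreal (h x powr (p / (p - 1))) \<partial>M) \<le> ennreal b"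
  shows "ennreal (c powr p) \<le> ennreal (b powr (p - 1)) * (\<integral>\<^sup>+x. ennreal (f x powr p) \<partial>M)"
proof (cases "(\<integral>\<^sup>+x. ennreal (f x powr p) \<partial>M) = \<infinity>")
  case True
  then show ?thesis using b by (simp add: ennreal_mult_top)
next
  case False
  then obtain a where a: "a \<ge> 0" "(\<integral>\<^sup>+x. ennreal (f x powr p) \<partial>M) = ennreal a"
    by (metis ennreal_cases infinity_ennreal_def)
  define q where "q = p / (p - 1)"
  have q: "q > 1" "1 / p + 1 / q = 1" using p by (auto simp: q_def field_simps)
  \<comment> \<open>The integral \<open>a\<close> may be 0 and then cannot serve as a scaling
    constant. Every \<open>a' > a\<close> can, and the limit \<open>a' \<rightarrow> a\<close> is
    taken at the end.\<close>
  have le: "c powr p \<le> a' * b powr (p - 1)" if a': "a' > a" for a'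
  proof -
    have a'0: "a' > 0" using a a' by linarith
    define \<alpha> \<beta> where "\<alpha> = a' powr (1 / p)" and "\<beta> = b powr (1 / q)"
    have ab0: "\<alpha> > 0" "\<beta> > 0" using a'0 b by (auto simp: \<alpha>_def \<beta>_def)
    have pw: "\<alpha> powr p = a'" "\<beta> powr q = b"
      using a'0 b p q by (auto simp: \<alpha>_def \<beta>_def powr_powr)
    have Y: "f x * h x \<le> \<alpha> * \<beta> * (f x powr p / (p * a') + h x powr q / (q * b))" for x
    proof -
      have "(f x / \<alpha>) * (h x / \<beta>) \<le> (f x / \<alpha>) powr p / p + (h x / \<beta>) powr q / q"
        by (rule Youngs_inequality) (use p q ab0 f h in auto)
      also have "\<dots> = f x powr p / (p * a') + h x powr q / (q * b)"
        using f h ab0 pw by (simp add: powr_divide mult.commute)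
      finally have "\<alpha> * \<beta> * ((f x / \<alpha>) * (h x / \<beta>)) \<le>
          \<alpha> * \<beta> * (f x powr p / (p * a') + h x powr q / (q * b))"
        using ab0 by (intro mult_left_mono) auto
      then show ?thesis using ab0 by simp
    qed
    have "ennreal c \<le> (\<integral>\<^sup>+x. ennreal (\<alpha> * \<beta> * (f x powr p / (p * a') + h x powr q / (q * b))) \<partial>M)"
      by (rule order_trans[OF c(2)]) (intro nn_integral_mono ennreal_leI Y)
    also have "\<dots> = (\<integral>\<^sup>+x. ennreal (\<alpha> * \<beta> / (p * a')) * ennreal (f x powr p)
        + ennreal (\<alpha> * \<beta> / (q * b)) * ennreal (h x powr q) \<partial>M)"
      using ab0 p q a'0 b
      by (intro nn_integral_cong)
        (simp add: ennreal_mult[symmetric] ennreal_plus[symmetric] distrib_left del: ennreal_plus)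
    also have "\<dots> = ennreal (\<alpha> * \<beta> / (p * a')) * ennreal a
        + ennreal (\<alpha> * \<beta> / (q * b)) * (\<integral>\<^sup>+x. ennreal (h x powr q) \<partial>M)"
      by (simp add: nn_integral_add nn_integral_cmult a(2))
    also have "\<dots> \<le> ennreal (\<alpha> * \<beta> / (p * a')) * ennreal a'
        + ennreal (\<alpha> * \<beta> / (q * b)) * ennreal b"
      using a' b by (intro add_mono mult_left_mono ennreal_leI) (auto simp: q_def)
    also have "\<dots> = ennreal (\<alpha> * \<beta> / (p * a') * a' + \<alpha> * \<beta> / (q * b) * b)"
      using ab0 p q a'0 b
      by (simp add: ennreal_mult[symmetric] ennreal_plus[symmetric] del: ennreal_plus)
    also have "\<alpha> * \<beta> / (p * a') * a' + \<alpha> * \<beta> / (q * b) * b = \<alpha> * \<beta> * (1 / p + 1 / q)"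
      using a'0 b by (simp add: distrib_left)
    finally have "c \<le> \<alpha> * \<beta>" using q ab0 by simp
    then have "c powr p \<le> (\<alpha> * \<beta>) powr p" using c p by (intro powr_mono2) auto
    also have "\<dots> = a' * b powr (p - 1)"
    proof -
      have "1 / q * p = p - 1" using p by (simp add: q_def)
      then show ?thesis using pw ab0 b by (simp add: powr_mult \<beta>_def powr_powr)
    qed
    finally show ?thesis .
  qed
  have "c powr p \<le> a * b powr (p - 1)"
  proof (rule tendsto_lowerbound)
    show "((\<lambda>a'. a' * b powr (p - 1)) \<longlongrightarrow> a * b powr (p - 1)) (at_right a)"
      by (intro tendsto_intros)
    show "\<forall>\<^sub>F a' in at_right a. c powr p \<le> a' * b powr (p - 1)"
      using le by (auto simp: eventually_at_right_field intro: exI[of _ "a + 1"])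
  qed simp
  then show ?thesis
    using a by (simp add: ennreal_mult[symmetric] mult.commute ennreal_leI)
qed

section \<open>Gradients and integration along rays\<close>

lemma has_derivative_grad:
  fixes u :: "real^'n \<Rightarrow> real"
  assumes "u differentiable (at x)"
  shows "(u has_derivative (\<lambda>v. grad u x \<bullet> v)) (at x)"
proof -
  let ?D = "frechet_derivative u (at x)"
  have D: "(u has_derivative ?D) (at x)" using assms frechet_derivative_works by blast
  then have lin: "linear ?D" by (simp add: has_derivative_linear)
  have "?D v = grad u x \<bullet> v" for v
  proof -
    have "?D v = ?D (\<Sum>i\<in>UNIV. v $ i *\<^sub>R axis i 1)"
      using basis_expansion[of v] by (simp add: scalar_mult_eq_scaleR)
    also have "\<dots> = (\<Sum>i\<in>UNIV. v $ i * ?D (axis i 1))"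
      by (simp add: linear_sum[OF lin] linear_cmul[OF lin])
    finally show ?thesis by (simp add: grad_def inner_vec_def mult.commute)
  qed
  then show ?thesis using D by (metis (no_types, lifting) ext)
qed

lemma grad_eqI:
  assumes "(u has_derivative (\<lambda>v. G \<bullet> v)) (at x)" shows "grad u x = G"
  unfolding grad_def frechet_derivative_eqI[OF assms]
  by (simp add: vec_eq_iff inner_axis)

text \<open>The fundamental theorem of calculus on the segment from \<open>x\<close> to
  \<open>x + z\<close>. The end point stays free because it will be averaged over a ball.\<close>

lemma abs_le_add_integral_grad:
  fixes u :: "real^'n \<Rightarrow> real"
  assumes u: "\<And>x. u differentiable (at x)" and g: "continuous_on UNIV (grad u)"
  shows "ennreal \<bar>u x\<bar> \<le> ennreal \<bar>u (x + z)\<bar>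
    + (\<integral>\<^sup>+t. ennreal (norm (grad u (x + t *\<^sub>R z)) * norm z) * indicator {0..1} t \<partial>lborel)"
proof -
  define f where "f t = grad u (x + t *\<^sub>R z) \<bullet> z" for t
  have fc: "continuous_on S f" for S
    unfolding f_def by (intro continuous_intros continuous_on_compose2[OF g]) auto
  have "(f has_integral u (x + 1 *\<^sub>R z) - u (x + 0 *\<^sub>R z)) {0..1}"
  proof (rule fundamental_theorem_of_calculus)
    show "((\<lambda>t. u (x + t *\<^sub>R z)) has_vector_derivative f t) (at t within {0..1})" for t
    proof -
      have "((\<lambda>t. u (x + t *\<^sub>R z)) has_derivative (\<lambda>s. grad u (x + t *\<^sub>R z) \<bullet> (s *\<^sub>R z))) (at t)"
        by (rule has_derivative_compose[OF _ has_derivative_grad[OF u], where f="\<lambda>t. x + t *\<^sub>R z"])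
          (auto intro!: derivative_eq_intros)
      then show ?thesis
        by (simp add: has_vector_derivative_def f_def has_derivative_at_withinI)
    qed
  qed simp
  then have int: "integral {0..1} f = u (x + z) - u x" by (simp add: integral_unique)
  define n where "n t = norm (grad u (x + t *\<^sub>R z)) * norm z" for t
  have nc: "continuous_on S n" for S
    unfolding n_def by (intro continuous_intros continuous_on_compose2[OF g]) auto
  have "\<bar>u (x + z) - u x\<bar> \<le> integral {0..1} n"
    unfolding int[symmetric] real_norm_def[symmetric]
    by (rule integral_norm_bound_integral)
      (auto intro!: integrable_continuous_real fc nc simp: f_def n_def Cauchy_Schwarz_ineq2)
  then have "\<bar>u x\<bar> \<le> \<bar>u (x + z)\<bar> + integral {0..1} n" by linarith
  moreover have "(\<integral>\<^sup>+t. ennreal (n t) * indicator {0..1} t \<partial>lborel) = ennreal (integral {0..1} n)"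
    by (rule nn_integral_has_integral_lebesgue')
      (auto intro!: integrable_integral integrable_continuous_real nc, simp add: n_def)
  moreover have "integral {0..1} n \<ge> 0"
    by (rule integral_nonneg) (auto intro!: integrable_continuous_real nc simp: n_def)
  ultimately show ?thesis
    by (simp add: n_def ennreal_plus[symmetric] ennreal_leI del: ennreal_plus)
qed

text \<open>This is the integral over the ray parameter that remains once \<open>y = t z\<close> is
  held fixed; with \<open>a = |y| / R\<close> and \<open>n = N\<close> its bound turns the factor
  \<open>|y|\<close> into the Riesz kernel \<open>|y|^(1-N)\<close>.\<close>

lemma nn_integral_inverse_power_le:
  fixes a :: real
  assumes "0 < a" "0 < n"
  shows "(\<integral>\<^sup>+t. ennreal ((1 / t) ^ Suc n) * indicator {a..1} t \<partial>lborel) \<le> ennreal ((1 / a) ^ n / n)"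
proof (cases "a \<le> 1")
  case True
  define F where "F t = - ((1 / t) ^ n / n)" for t :: real
  have "(\<integral>\<^sup>+t. ennreal ((1 / t) ^ Suc n) * indicator {a..1} t \<partial>lborel) = ennreal (F 1 - F a)"
  proof (rule nn_integral_FTC_Icc)
    show "(\<lambda>t::real. (1 / t) ^ Suc n) \<in> borel_measurable borel" by measurable
    fix t :: real assume "t \<in> {a..1}"
    then have t: "t > 0" using assms by auto
    have "(F has_real_derivative (- (real n * (1 / t) ^ (n - 1) * (- 1 / (t * t)) / n))) (at t)"
      unfolding F_def using t by (auto intro!: derivative_eq_intros)
    moreover have "- (real n * (1 / t) ^ (n - 1) * (- 1 / (t * t)) / n) = (1 / t) ^ Suc n"
    proof -
      obtain k where "n = Suc k" using assms by (cases n) auto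
      then show ?thesis using t by (simp add: power_divide)
    qed
    ultimately show "(F has_real_derivative (1 / t) ^ Suc n) (at t)"
      by simp
    show "0 \<le> (1 / t) ^ Suc n" using t by simp
  qed (use True in simp)
  also have "\<dots> \<le> ennreal ((1 / a) ^ n / n)"
    using assms by (intro ennreal_leI) (simp add: F_def)
  finally show ?thesis .
next
  case False
  then show ?thesis by simp
qed

text \<open>For fixed \<open>t\<close> substitute \<open>y = t z\<close>: the Jacobian contributes
  \<open>t^(-N)\<close> and \<open>|z| = |y| / t\<close> one more factor, hence the exponent
  \<open>Suc N\<close>. The ball becomes \<open>|y| < t R\<close>, so after Fubini \<open>t\<close>
  runs only over \<open>[|y| / R, 1]\<close>.\<close>

lemma nn_integral_rays_le:
  fixes g :: "'a::euclidean_space \<Rightarrow> real"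
  assumes [measurable]: "g \<in> borel_measurable borel" and g: "\<And>x. g x \<ge> 0" and R: "R > 0"
  shows "(\<integral>\<^sup>+z. (\<integral>\<^sup>+t. ennreal (g (t *\<^sub>R z) * norm z) * indicator {0..1} t \<partial>lborel) * indicator (ball 0 R) z \<partial>lborel)
    \<le> ennreal (R ^ DIM('a) / DIM('a)) *
      (\<integral>\<^sup>+y. ennreal (g y * norm y powr (1 - real DIM('a))) * indicator (ball 0 R) y \<partial>lborel)"
proof -
  let ?N = "DIM('a)"
  have [measurable]: "ball (0::'a) R \<in> sets borel" by simp
  have "(\<integral>\<^sup>+z. (\<integral>\<^sup>+t. ennreal (g (t *\<^sub>R z) * norm z) * indicator {0..1} t \<partial>lborel) * indicator (ball 0 R) z \<partial>lborel)
    = (\<integral>\<^sup>+z. (\<integral>\<^sup>+t. ennreal (g (t *\<^sub>R z) * norm z) * indicator {0..1} t * indicator (ball 0 R) z \<partial>lborel) \<partial>lborel)"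
    by (simp add: nn_integral_multc)
  also have "\<dots> = (\<integral>\<^sup>+t. (\<integral>\<^sup>+z. ennreal (g (t *\<^sub>R z) * norm z) * indicator {0..1} t * indicator (ball 0 R) z \<partial>lborel) \<partial>lborel)"
    by (rule lborel_pair.Fubini'[symmetric]) measurable
  also have "\<dots> = (\<integral>\<^sup>+t. (\<integral>\<^sup>+y. ennreal ((1 / t) ^ Suc ?N) * ennreal (g y * norm y) *
      indicator {0<..1} t * indicator (ball 0 (t * R)) y \<partial>lborel) \<partial>lborel)"
  proof (rule nn_integral_cong_AE)
    \<comment> \<open>The scaling degenerates at \<open>t = 0\<close>, which is a null set.\<close>
    have "AE t in lborel. t \<noteq> (0::real)" by (simp add: AE_lborel_singleton)
    then show "AE t in lborel. (\<integral>\<^sup>+z. ennreal (g (t *\<^sub>R z) * norm z) * indicator {0..1} t * indicator (ball 0 R) z \<partial>lborel)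
      = (\<integral>\<^sup>+y. ennreal ((1 / t) ^ Suc ?N) * ennreal (g y * norm y) *
      indicator {0<..1} t * indicator (ball 0 (t * R)) y \<partial>lborel)"
    proof eventually_elim
      case (elim t)
      show ?case
      proof (cases "t \<in> {0<..1}")
        case True
        then have t: "t > 0" by simp
        have "(\<integral>\<^sup>+z. ennreal (g (t *\<^sub>R z) * norm z) * indicator {0..1} t * indicator (ball 0 R) z \<partial>lborel)
          = (\<integral>\<^sup>+z. ennreal (g (t *\<^sub>R z) * norm z) * indicator {0..1} t * indicator (ball 0 R) z
              \<partial>density (distr lborel borel (\<lambda>y. 0 + (1 / t) *\<^sub>R y)) (\<lambda>_. \<bar>1 / t\<bar> ^ ?N))"
          using t by (subst lborel_affine[of "1 / t" 0]) auto
        also have "\<dots> = (\<integral>\<^sup>+y. ennreal (\<bar>1 / t\<bar> ^ ?N) * (ennreal (g (t *\<^sub>R (0 + (1 / t) *\<^sub>R y)) * norm (0 + (1 / t) *\<^sub>R y)) *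
            indicator {0..1} t * indicator (ball 0 R) (0 + (1 / t) *\<^sub>R y)) \<partial>lborel)"
          by (subst nn_integral_density, measurable) (subst nn_integral_distr, measurable)
        also have "\<dots> = (\<integral>\<^sup>+y. ennreal ((1 / t) ^ Suc ?N) * ennreal (g y * norm y) *
          indicator {0<..1} t * indicator (ball 0 (t * R)) y \<partial>lborel)"
        proof (rule nn_integral_cong)
          fix y :: 'a
          have "ennreal (\<bar>1 / t\<bar> ^ ?N) * ennreal (g y * ((1 / t) * norm y)) = ennreal ((1 / t) ^ Suc ?N) * ennreal (g y * norm y)"
            using t g[of y] by (simp add: ennreal_mult[symmetric] mult_ac)
          moreover have "indicator (ball 0 R) ((1 / t) *\<^sub>R y) = (indicator (ball 0 (t * R)) y :: ennreal)"
            using t by (auto simp: field_simps split: split_indicator)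
          ultimately show "ennreal (\<bar>1 / t\<bar> ^ ?N) * (ennreal (g (t *\<^sub>R (0 + (1 / t) *\<^sub>R y)) * norm (0 + (1 / t) *\<^sub>R y)) *
            indicator {0..1} t * indicator (ball 0 R) (0 + (1 / t) *\<^sub>R y))
            = ennreal ((1 / t) ^ Suc ?N) * ennreal (g y * norm y) * indicator {0<..1} t * indicator (ball 0 (t * R)) y"
            using True by (simp add: mult.assoc[symmetric])
        qed
        finally show ?thesis .
      next
        case False
        then show ?thesis using elim by simp
      qed
    qed
  qed
  also have "\<dots> = (\<integral>\<^sup>+y. (\<integral>\<^sup>+t. ennreal ((1 / t) ^ Suc ?N) * ennreal (g y * norm y) *
      indicator {0<..1} t * indicator (ball 0 (t * R)) y \<partial>lborel) \<partial>lborel)"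
  proof (rule lborel_pair.Fubini')
    \<comment> \<open>Joint measurability: the ball of moving radius is a section of this open set
      of pairs.\<close>
    let ?S = "{z :: 'a \<times> real. norm (fst z) < snd z * R}"
    have "open ?S" by (intro open_Collect_less continuous_intros)
    then have "?S \<in> sets (borel :: ('a \<times> real) measure)" by (rule borel_open)
    then have [measurable]: "?S \<in> sets (lborel \<Otimes>\<^sub>M lborel)"
      unfolding lborel_prod by simp
    have "(\<lambda>(y::'a, t). ennreal ((1 / t) ^ Suc ?N) * ennreal (g y * norm y) *
      indicator {0<..1} t * indicator (ball 0 (t * R)) y)
      = (\<lambda>z. ennreal ((1 / snd z) ^ Suc ?N) * ennreal (g (fst z) * norm (fst z)) *
      indicator {0<..1} (snd z) * indicator ?S z)"
      by (auto simp: fun_eq_iff indicator_def)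
    also have "\<dots> \<in> borel_measurable (lborel \<Otimes>\<^sub>M lborel)" by measurable
    finally show "(\<lambda>(y::'a, t). ennreal ((1 / t) ^ Suc ?N) * ennreal (g y * norm y) *
      indicator {0<..1} t * indicator (ball 0 (t * R)) y) \<in> borel_measurable (lborel \<Otimes>\<^sub>M lborel)" .
  qed
  also have "\<dots> \<le> (\<integral>\<^sup>+y. ennreal (R ^ ?N / ?N) * (ennreal (g y * norm y powr (1 - real ?N)) * indicator (ball 0 R) y) \<partial>lborel)"
  proof (rule nn_integral_mono)
    fix y :: 'a
    show "(\<integral>\<^sup>+t. ennreal ((1 / t) ^ Suc ?N) * ennreal (g y * norm y) *
      indicator {0<..1} t * indicator (ball 0 (t * R)) y \<partial>lborel)
      \<le> ennreal (R ^ ?N / ?N) * (ennreal (g y * norm y powr (1 - real ?N)) * indicator (ball 0 R) y)"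
    proof (cases "y = 0")
      case False
      define a where "a = norm y / R"
      have a: "a > 0" using False R by (simp add: a_def)
      have "(\<integral>\<^sup>+t. ennreal ((1 / t) ^ Suc ?N) * ennreal (g y * norm y) *
        indicator {0<..1} t * indicator (ball 0 (t * R)) y \<partial>lborel)
        \<le> (\<integral>\<^sup>+t. (ennreal (g y * norm y) * indicator (ball 0 R) y) *
          (ennreal ((1 / t) ^ Suc ?N) * indicator {a..1} t) \<partial>lborel)"
      proof (rule nn_integral_mono)
        fix t :: real
        have "y \<in> ball 0 R \<and> t \<in> {a..1}" if "t \<in> {0<..1}" "y \<in> ball 0 (t * R)"
        proof -
          have *: "norm y < t * R" using that by simp
          also have "t * R \<le> R" using that R by simp
          finally have "norm y < R" .
          then show ?thesis using that R * by (auto simp: a_def divide_le_eq)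
        qed
        then show "ennreal ((1 / t) ^ Suc ?N) * ennreal (g y * norm y) *
          indicator {0<..1} t * indicator (ball 0 (t * R)) y
          \<le> (ennreal (g y * norm y) * indicator (ball 0 R) y) *
          (ennreal ((1 / t) ^ Suc ?N) * indicator {a..1} t)"
          by (cases "t \<in> {0<..1} \<and> y \<in> ball 0 (t * R)") (auto simp: mult_ac)
      qed
      also have "\<dots> = (ennreal (g y * norm y) * indicator (ball 0 R) y) *
          (\<integral>\<^sup>+t. ennreal ((1 / t) ^ Suc ?N) * indicator {a..1} t \<partial>lborel)"
        by (rule nn_integral_cmult) measurable
      also have "\<dots> \<le> (ennreal (g y * norm y) * indicator (ball 0 R) y) * ennreal ((1 / a) ^ ?N / ?N)"
        by (intro mult_left_mono nn_integral_inverse_power_le a) auto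
      also have "\<dots> = ennreal (R ^ ?N / ?N) * (ennreal (g y * norm y powr (1 - real ?N)) * indicator (ball 0 R) y)"
      proof -
        have "norm y powr (1 - real ?N) = norm y / norm y ^ ?N"
          using False by (simp add: powr_diff powr_realpow)
        then have "g y * norm y * ((1 / a) ^ ?N / ?N) = R ^ ?N / ?N * (g y * norm y powr (1 - real ?N))"
          by (simp add: a_def power_divide mult_ac)
        then have "ennreal (g y * norm y) * ennreal ((1 / a) ^ ?N / ?N) = ennreal (R ^ ?N / ?N) * ennreal (g y * norm y powr (1 - real ?N))"
          using g[of y] R a by (simp add: ennreal_mult[symmetric])
        then show ?thesis by (metis (no_types) mult.commute mult.left_commute)
      qed
      finally show ?thesis .
    qed (simp add: power_0_left)
  qed
  also have "\<dots> = ennreal (R ^ ?N / ?N) * (\<integral>\<^sup>+y. ennreal (g y * norm y powr (1 - real ?N)) * indicator (ball 0 R) y \<partial>lborel)"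
    by (rule nn_integral_cmult) measurable
  finally show ?thesis .
qed

text \<open>The segment bound is averaged over \<open>z\<close> in a ball of radius
  \<open>R\<close>. The mean of \<open>|u|\<close> becomes the lower-order term, which stands in for
  a boundary condition on \<open>u\<close>.\<close>

lemma representation_bound:
  fixes u :: "real^'n \<Rightarrow> real"
  assumes u: "\<And>x. u differentiable (at x)" and g: "continuous_on UNIV (grad u)" and R: "R > 0"
  shows "ennreal \<bar>u x\<bar> * emeasure lborel (ball (0::real^'n) R)
    \<le> (\<integral>\<^sup>+z. ennreal \<bar>u (x + z)\<bar> * indicator (ball 0 R) z \<partial>lborel)
      + ennreal (R ^ CARD('n) / CARD('n)) *
      (\<integral>\<^sup>+y. ennreal (norm (grad u (x + y)) * norm y powr (1 - real CARD('n))) * indicator (ball 0 R) y \<partial>lborel)"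
proof -
  have [measurable]: "ball (0::real^'n) R \<in> sets borel" by simp
  have uc: "continuous_on UNIV u"
    using u by (simp add: continuous_at_imp_continuous_on differentiable_imp_continuous_within)
  have [measurable]: "u \<in> borel_measurable borel" "grad u \<in> borel_measurable borel"
    using uc g by (simp_all add: borel_measurable_continuous_onI)
  have "ennreal \<bar>u x\<bar> * emeasure lborel (ball (0::real^'n) R)
    = (\<integral>\<^sup>+z. ennreal \<bar>u x\<bar> * indicator (ball (0::real^'n) R) z \<partial>lborel)"
    by (rule nn_integral_cmult_indicator[symmetric]) simp
  also have "\<dots> \<le> (\<integral>\<^sup>+z. ennreal \<bar>u (x + z)\<bar> * indicator (ball 0 R) z
    + (\<integral>\<^sup>+t. ennreal (norm (grad u (x + t *\<^sub>R z)) * norm z) * indicator {0..1} t \<partial>lborel) * indicator (ball 0 R) z \<partial>lborel)"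
    by (intro nn_integral_mono)
      (auto intro!: abs_le_add_integral_grad[OF u g] split: split_indicator)
  also have "\<dots> = (\<integral>\<^sup>+z. ennreal \<bar>u (x + z)\<bar> * indicator (ball 0 R) z \<partial>lborel)
    + (\<integral>\<^sup>+z. (\<integral>\<^sup>+t. ennreal (norm (grad u (x + t *\<^sub>R z)) * norm z) * indicator {0..1} t \<partial>lborel) * indicator (ball 0 R) z \<partial>lborel)"
    by (rule nn_integral_add) measurable
  also have "\<dots> \<le> (\<integral>\<^sup>+z. ennreal \<bar>u (x + z)\<bar> * indicator (ball 0 R) z \<partial>lborel)
    + ennreal (R ^ CARD('n) / CARD('n)) *
      (\<integral>\<^sup>+y. ennreal (norm (grad u (x + y)) * norm y powr (1 - real CARD('n))) * indicator (ball 0 R) y \<partial>lborel)"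
    using nn_integral_rays_le[of "\<lambda>y. norm (grad u (x + y))" R] R by (intro add_left_mono) simp
  finally show ?thesis .
qed

section \<open>A trace inequality\<close>

text \<open>Hoelder's inequality for the splitting of \<open>|\<nabla>u| |y|^(1-N)\<close> into
  \<open>|\<nabla>u| w^(1/p)\<close> and \<open>|y|^(1-N) w^(-1/p)\<close>. The weight
  \<open>w\<close> is left open: it has to be large enough near 0 for the second factor to be
  integrable to the conjugate exponent, and small enough to be integrated against the given measure
  later.\<close>

lemma trace_pointwise:
  fixes u :: "real^'n \<Rightarrow> real" and w :: "real^'n \<Rightarrow> real"
  assumes p: "1 < p"
    and u: "\<And>x. u differentiable (at x)" and g: "continuous_on UNIV (grad u)" and R: "R > 0"
    and [measurable]: "w \<in> borel_measurable borel"
    and w: "\<And>y. y \<noteq> 0 \<Longrightarrow> norm y < R \<Longrightarrow> w y > 0"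
    and b: "b > 0" "(\<integral>\<^sup>+y. ennreal ((norm y powr (1 - real CARD('n)) * w y powr (- 1 / p)) powr (p / (p - 1)))
      * indicator (ball 0 R) y \<partial>lborel) \<le> ennreal b"
  defines "\<beta> \<equiv> measure lborel (ball (0::real^'n) R)" and "\<kappa> \<equiv> R ^ CARD('n) / CARD('n)"
  shows "ennreal (\<bar>u x\<bar> powr p) \<le>
    ennreal (2 powr (p - 1) / \<beta>) * (\<integral>\<^sup>+z. ennreal (\<bar>u (x + z)\<bar> powr p) * indicator (ball 0 R) z \<partial>lborel)
    + ennreal (2 powr (p - 1) * (\<kappa> / \<beta>) powr p * b powr (p - 1)) *
      (\<integral>\<^sup>+y. ennreal (norm (grad u (x + y)) powr p * w y) * indicator (ball 0 R) y \<partial>lborel)"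
proof -
  have [measurable]: "ball (0::real^'n) R \<in> sets borel" by simp
  have uc: "continuous_on UNIV u"
    using u by (simp add: continuous_at_imp_continuous_on differentiable_imp_continuous_within)
  have [measurable]: "u \<in> borel_measurable borel" "grad u \<in> borel_measurable borel"
    using uc g by (simp_all add: borel_measurable_continuous_onI)
  define X where "X = (\<integral>\<^sup>+z. ennreal \<bar>u (x + z)\<bar> * indicator (ball 0 R) z \<partial>lborel)"
  define Y where "Y = (\<integral>\<^sup>+y. ennreal (norm (grad u (x + y)) * norm y powr (1 - real CARD('n))) * indicator (ball 0 R) y \<partial>lborel)"
  define X' where "X' = (\<integral>\<^sup>+z. ennreal (\<bar>u (x + z)\<bar> powr p) * indicator (ball 0 R) z \<partial>lborel)"
  define Y' where "Y' = (\<integral>\<^sup>+y. ennreal (norm (grad u (x + y)) powr p * w y) * indicator (ball 0 R) y \<partial>lborel)"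
  have \<beta>: "\<beta> > 0" using content_ball_pos[OF R, of "0::real^'n"] by (simp add: \<beta>_def)
  have em: "emeasure lborel (ball (0::real^'n) R) = ennreal \<beta>"
    using emeasure_lborel_ball_finite[of "0::real^'n" R] by (simp add: \<beta>_def emeasure_eq_ennreal_measure)
  have \<kappa>: "\<kappa> > 0" using R by (simp add: \<kappa>_def)
  have rep: "ennreal (\<bar>u x\<bar> * \<beta>) \<le> X + ennreal \<kappa> * Y"
    using representation_bound[OF u g R, of x] \<beta> by (simp add: em X_def Y_def \<kappa>_def ennreal_mult)
  \<comment> \<open>Real lower bounds replace \<open>X\<close> and \<open>Y\<close>, as Hoelder's
    inequality asks. If one of the two is infinite, it can carry the whole left-hand side.\<close>
  obtain c1 c2 where c: "c1 \<ge> 0" "c2 \<ge> 0" "ennreal c1 \<le> X" "ennreal c2 \<le> Y" "\<bar>u x\<bar> * \<beta> \<le> c1 + \<kappa> * c2"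
  proof (cases "X = \<infinity>")
    case True
    then show ?thesis using that[of "\<bar>u x\<bar> * \<beta>" 0] \<beta> by simp
  next
    case X: False
    show ?thesis
    proof (cases "Y = \<infinity>")
      case True
      then show ?thesis using that[of 0 "\<bar>u x\<bar> * \<beta> / \<kappa>"] \<beta> \<kappa> by simp
    next
      case False
      obtain c1 c2 where "c1 \<ge> 0" "c2 \<ge> 0" "X = ennreal c1" "Y = ennreal c2"
        using X False by (metis ennreal_cases infinity_ennreal_def)
      then show ?thesis
        using that[of c1 c2] rep \<kappa> by (simp add: ennreal_mult[symmetric] ennreal_plus[symmetric] del: ennreal_plus)
    qed
  qed
  have 1: "ennreal (c1 powr p) \<le> ennreal (\<beta> powr (p - 1)) * X'"
  proof -
    have "ennreal (c1 powr p) \<le> ennreal (\<beta> powr (p - 1)) *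
      (\<integral>\<^sup>+z. ennreal ((\<bar>u (x + z)\<bar> * indicator (ball 0 R) z) powr p) \<partial>lborel)"
    proof (rule nn_integral_Hoelder[OF p, where h = "indicator (ball 0 R)"])
      have "X = (\<integral>\<^sup>+z. ennreal (\<bar>u (x + z)\<bar> * indicator (ball 0 R) z * indicator (ball 0 R) z) \<partial>lborel)"
        unfolding X_def by (intro nn_integral_cong) (simp split: split_indicator)
      then show "ennreal c1 \<le> \<dots>" using c by simp
      have "(\<integral>\<^sup>+z. ennreal ((indicator (ball (0::real^'n) R) z) powr (p / (p - 1))) \<partial>lborel)
        = (\<integral>\<^sup>+z. indicator (ball (0::real^'n) R) z \<partial>lborel)"
        by (intro nn_integral_cong) (simp split: split_indicator)
      then show "(\<integral>\<^sup>+z. ennreal ((indicator (ball (0::real^'n) R) z) powr (p / (p - 1))) \<partial>lborel) \<le> ennreal \<beta>"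
        by (simp add: em)
    qed (use c \<beta> in auto)
    also have "(\<integral>\<^sup>+z. ennreal ((\<bar>u (x + z)\<bar> * indicator (ball 0 R) z) powr p) \<partial>lborel) = X'"
      unfolding X'_def by (intro nn_integral_cong) (simp split: split_indicator)
    finally show ?thesis .
  qed
  have 2: "ennreal (c2 powr p) \<le> ennreal (b powr (p - 1)) * Y'"
  proof -
    \<comment> \<open>The origin is removed because \<open>w\<close> is known to be positive only
      away from it; one point does not change the integrals.\<close>
    define f where "f y = norm (grad u (x + y)) * w y powr (1 / p) * indicator (ball 0 R - {0}) y" for y
    define h where "h y = norm y powr (1 - real CARD('n)) * w y powr (- 1 / p) * indicator (ball 0 R) y" for y :: "real^'n"
    have [measurable]: "f \<in> borel_measurable borel" "h \<in> borel_measurable borel"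
      unfolding f_def[abs_def] h_def[abs_def] by measurable
    have "ennreal (c2 powr p) \<le> ennreal (b powr (p - 1)) * (\<integral>\<^sup>+y. ennreal (f y powr p) \<partial>lborel)"
    proof (rule nn_integral_Hoelder[OF p, where h = h])
      have "f y * h y = norm (grad u (x + y)) * norm y powr (1 - real CARD('n)) * indicator (ball 0 R) y" for y
      proof (cases "y \<in> ball 0 R - {0}")
        case True
        then have "w y powr (1 / p) * w y powr (- 1 / p) = 1"
          using w[of y] by (simp add: powr_add[symmetric])
        then show ?thesis using True by (simp add: f_def h_def)
      next
        case False
        then show ?thesis by (auto simp: f_def)
      qed
      then have "Y = (\<integral>\<^sup>+y. ennreal (f y * h y) \<partial>lborel)"
        unfolding Y_def by (intro nn_integral_cong) (simp split: split_indicator)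
      then show "ennreal c2 \<le> (\<integral>\<^sup>+y. ennreal (f y * h y) \<partial>lborel)" using c by simp
      have "(\<integral>\<^sup>+y. ennreal (h y powr (p / (p - 1))) \<partial>lborel) = (\<integral>\<^sup>+y. ennreal ((norm y powr (1 - real CARD('n)) * w y powr (- 1 / p)) powr (p / (p - 1)))
        * indicator (ball 0 R) y \<partial>lborel)"
        unfolding h_def by (intro nn_integral_cong) (simp split: split_indicator)
      then show "(\<integral>\<^sup>+y. ennreal (h y powr (p / (p - 1))) \<partial>lborel) \<le> ennreal b" using b by simp
    qed (use c b in \<open>auto simp: f_def h_def\<close>)
    also have "(\<integral>\<^sup>+y. ennreal (f y powr p) \<partial>lborel) = Y'"
      unfolding Y'_def
    proof (rule nn_integral_cong_AE)
      have "AE y in lborel. y \<noteq> (0::real^'n)" by (rule AE_lborel_singleton)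
      then show "AE y in lborel. ennreal (f y powr p) = ennreal (norm (grad u (x + y)) powr p * w y) * indicator (ball 0 R) y"
      proof eventually_elim
        case (elim y)
        then show ?case using w[of y] p
          by (auto simp: f_def powr_mult powr_powr split: split_indicator)
      qed
    qed
    finally show ?thesis .
  qed
  have "(\<bar>u x\<bar> * \<beta>) powr p \<le> (c1 + \<kappa> * c2) powr p"
    using c p \<beta> by (intro powr_mono2) auto
  also have "\<dots> \<le> 2 powr (p - 1) * (c1 powr p + (\<kappa> * c2) powr p)"
    using c p \<kappa> by (intro add_powr_le) auto
  finally have "\<bar>u x\<bar> powr p \<le> 2 powr (p - 1) * (c1 powr p + (\<kappa> * c2) powr p) / \<beta> powr p"
    using \<beta> by (simp add: powr_mult le_divide_eq)
  also have "\<dots> = 2 powr (p - 1) / \<beta> powr p * c1 powr p + 2 powr (p - 1) * (\<kappa> / \<beta>) powr p * c2 powr p"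
    using c \<kappa> \<beta> by (simp add: powr_mult powr_divide field_simps)
  finally have "ennreal (\<bar>u x\<bar> powr p) \<le> ennreal (2 powr (p - 1) / \<beta> powr p) * ennreal (c1 powr p)
      + ennreal (2 powr (p - 1) * (\<kappa> / \<beta>) powr p) * ennreal (c2 powr p)"
    using ennreal_leI by (simp add: ennreal_mult[symmetric] ennreal_plus[symmetric] del: ennreal_plus)
  also have "\<dots> \<le> ennreal (2 powr (p - 1) / \<beta> powr p) * (ennreal (\<beta> powr (p - 1)) * X')
      + ennreal (2 powr (p - 1) * (\<kappa> / \<beta>) powr p) * (ennreal (b powr (p - 1)) * Y')"
    by (intro add_mono mult_left_mono 1 2) auto
  also have "\<dots> = ennreal (2 powr (p - 1) / \<beta>) * X' + ennreal (2 powr (p - 1) * (\<kappa> / \<beta>) powr p * b powr (p - 1)) * Y'"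
  proof -
    have "2 powr (p - 1) / \<beta> powr p * \<beta> powr (p - 1) = 2 powr (p - 1) / \<beta>"
      using \<beta> by (simp add: powr_diff)
    then show ?thesis
      using \<beta> \<kappa> by (simp add: mult.assoc[symmetric] ennreal_mult[symmetric])
  qed
  finally show ?thesis by (simp add: X'_def Y'_def)
qed

lemma nn_integral_lborel_translate:
  fixes f :: "'a::euclidean_space \<Rightarrow> ennreal"
  assumes [measurable]: "f \<in> borel_measurable borel"
  shows "(\<integral>\<^sup>+z. f (x + z) \<partial>lborel) = (\<integral>\<^sup>+z. f z \<partial>lborel)"
proof -
  have "(\<integral>\<^sup>+z. f z \<partial>lborel) = (\<integral>\<^sup>+z. f z \<partial>distr lborel borel ((+) x))"
    by (simp add: lborel_distr_plus)
  also have "\<dots> = (\<integral>\<^sup>+z. f (x + z) \<partial>lborel)" by (rule nn_integral_distr) simp_all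
  finally show ?thesis by simp
qed

text \<open>Fubini moves \<mu> from \<open>u\<close> onto the kernel:
  \<open>|\<nabla>u(y)|^p\<close> is multiplied by the integral of \<open>w(y - x)\<close> against
  \<mu>. This matters only where the gradient does not vanish, so \<open>J\<close> is asked for
  \<open>y \<in> S\<close>, in accordance with Morrey conditions whose centres lie in the
  set.\<close>

lemma trace_inequality_explicit:
  fixes u :: "real^'n \<Rightarrow> real" and w :: "real^'n \<Rightarrow> real" and \<mu> :: "(real^'n) measure"
  assumes p: "1 < p"
    and u: "\<And>x. u differentiable (at x)" and g: "continuous_on UNIV (grad u)" and R: "R > 0"
    and [measurable]: "w \<in> borel_measurable borel"
    and w: "\<And>y. y \<noteq> 0 \<Longrightarrow> norm y < R \<Longrightarrow> w y > 0"
    and b: "b > 0" "(\<integral>\<^sup>+y. ennreal ((norm y powr (1 - real CARD('n)) * w y powr (- 1 / p)) powr (p / (p - 1)))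
      * indicator (ball 0 R) y \<partial>lborel) \<le> ennreal b"
    and \<mu>: "finite_measure \<mu>" and sets[measurable_cong, simp]: "sets \<mu> = sets borel"
    and S: "\<And>y. y \<notin> S \<Longrightarrow> grad u y = 0"
    and J: "\<And>y. y \<in> S \<Longrightarrow> (\<integral>\<^sup>+x. ennreal (w (y - x)) * indicator (ball 0 R) (y - x) \<partial>\<mu>) \<le> J"
  defines "\<beta> \<equiv> measure lborel (ball (0::real^'n) R)" and "\<kappa> \<equiv> R ^ CARD('n) / CARD('n)"
  shows "(\<integral>\<^sup>+x. ennreal (\<bar>u x\<bar> powr p) \<partial>\<mu>) \<le>
    ennreal (2 powr (p - 1) / \<beta>) * emeasure \<mu> UNIV * (\<integral>\<^sup>+x. ennreal (\<bar>u x\<bar> powr p) \<partial>lborel)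
    + ennreal (2 powr (p - 1) * (\<kappa> / \<beta>) powr p * b powr (p - 1)) * J *
      (\<integral>\<^sup>+y. ennreal (norm (grad u y) powr p) \<partial>lborel)"
proof -
  interpret \<mu>: finite_measure \<mu> by fact
  interpret P: pair_sigma_finite \<mu> lborel
    by (simp add: pair_sigma_finite_def \<mu>.sigma_finite_measure_axioms lborel.sigma_finite_measure_axioms)
  have [measurable]: "ball (0::real^'n) R \<in> sets borel" by simp
  have uc: "continuous_on UNIV u"
    using u by (simp add: continuous_at_imp_continuous_on differentiable_imp_continuous_within)
  have [measurable]: "u \<in> borel_measurable borel" "grad u \<in> borel_measurable borel"
    using uc g by (simp_all add: borel_measurable_continuous_onI)
  have sp: "space \<mu> = UNIV" using sets_eq_imp_space_eq[OF sets] by simp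
  let ?C1 = "ennreal (2 powr (p - 1) / \<beta>)" and ?C2 = "ennreal (2 powr (p - 1) * (\<kappa> / \<beta>) powr p * b powr (p - 1))"
  let ?X = "\<lambda>x. \<integral>\<^sup>+z. ennreal (\<bar>u (x + z)\<bar> powr p) * indicator (ball 0 R) z \<partial>lborel"
  let ?Y = "\<lambda>x. \<integral>\<^sup>+y. ennreal (norm (grad u (x + y)) powr p * w y) * indicator (ball 0 R) y \<partial>lborel"
  have "(\<integral>\<^sup>+x. ennreal (\<bar>u x\<bar> powr p) \<partial>\<mu>) \<le> (\<integral>\<^sup>+x. ?C1 * ?X x + ?C2 * ?Y x \<partial>\<mu>)"
    unfolding \<beta>_def \<kappa>_def by (intro nn_integral_mono trace_pointwise assms)
  also have "\<dots> = ?C1 * (\<integral>\<^sup>+x. ?X x \<partial>\<mu>) + ?C2 * (\<integral>\<^sup>+x. ?Y x \<partial>\<mu>)"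
    by (simp add: nn_integral_add nn_integral_cmult)
  also have "\<dots> \<le> ?C1 * (emeasure \<mu> UNIV * (\<integral>\<^sup>+x. ennreal (\<bar>u x\<bar> powr p) \<partial>lborel))
    + ?C2 * (J * (\<integral>\<^sup>+y. ennreal (norm (grad u y) powr p) \<partial>lborel))"
  proof (intro add_mono mult_left_mono)
    have "?X x \<le> (\<integral>\<^sup>+x. ennreal (\<bar>u x\<bar> powr p) \<partial>lborel)" for x
    proof -
      have "?X x \<le> (\<integral>\<^sup>+z. ennreal (\<bar>u (x + z)\<bar> powr p) \<partial>lborel)"
        by (intro nn_integral_mono) (simp split: split_indicator)
      then show ?thesis by (simp add: nn_integral_lborel_translate[of "\<lambda>z. ennreal (\<bar>u z\<bar> powr p)"])
    qed
    then have "(\<integral>\<^sup>+x. ?X x \<partial>\<mu>) \<le> (\<integral>\<^sup>+x'. (\<integral>\<^sup>+x. ennreal (\<bar>u x\<bar> powr p) \<partial>lborel) \<partial>\<mu>)"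
      by (rule nn_integral_mono)
    then show "(\<integral>\<^sup>+x. ?X x \<partial>\<mu>) \<le> emeasure \<mu> UNIV * (\<integral>\<^sup>+x. ennreal (\<bar>u x\<bar> powr p) \<partial>lborel)"
      by (simp add: sp mult.commute)
    have "(\<integral>\<^sup>+x. ?Y x \<partial>\<mu>) = (\<integral>\<^sup>+x. (\<integral>\<^sup>+y. ennreal (norm (grad u y) powr p * w (y - x)) * indicator (ball 0 R) (y - x) \<partial>lborel) \<partial>\<mu>)"
    proof (rule nn_integral_cong)
      fix x
      show "?Y x = (\<integral>\<^sup>+y. ennreal (norm (grad u y) powr p * w (y - x)) * indicator (ball 0 R) (y - x) \<partial>lborel)"
        using nn_integral_lborel_translate[of "\<lambda>y. ennreal (norm (grad u y) powr p * w (y - x)) * indicator (ball 0 R) (y - x)" x]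
        by simp
    qed
    also have "\<dots> = (\<integral>\<^sup>+y. (\<integral>\<^sup>+x. ennreal (norm (grad u y) powr p * w (y - x)) * indicator (ball 0 R) (y - x) \<partial>\<mu>) \<partial>lborel)"
      by (rule P.Fubini'[symmetric]) measurable
    also have "\<dots> \<le> (\<integral>\<^sup>+y. J * ennreal (norm (grad u y) powr p) \<partial>lborel)"
    proof (rule nn_integral_mono)
      fix y
      show "(\<integral>\<^sup>+x. ennreal (norm (grad u y) powr p * w (y - x)) * indicator (ball 0 R) (y - x) \<partial>\<mu>)
        \<le> J * ennreal (norm (grad u y) powr p)"
      proof (cases "y \<in> S")
        case True
        have "(\<integral>\<^sup>+x. ennreal (norm (grad u y) powr p * w (y - x)) * indicator (ball 0 R) (y - x) \<partial>\<mu>)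
          = ennreal (norm (grad u y) powr p) * (\<integral>\<^sup>+x. ennreal (w (y - x)) * indicator (ball 0 R) (y - x) \<partial>\<mu>)"
          by (subst nn_integral_cmult[symmetric]) (simp_all add: ennreal_mult' mult.assoc)
        also have "\<dots> \<le> ennreal (norm (grad u y) powr p) * J" by (intro mult_left_mono J True) auto
        finally show ?thesis by (simp add: mult.commute)
      qed (simp add: S)
    qed
    also have "\<dots> = J * (\<integral>\<^sup>+y. ennreal (norm (grad u y) powr p) \<partial>lborel)"
      by (rule nn_integral_cmult) measurable
    finally show "(\<integral>\<^sup>+x. ?Y x \<partial>\<mu>) \<le> J * (\<integral>\<^sup>+y. ennreal (norm (grad u y) powr p) \<partial>lborel)" .
  qed auto
  finally show ?thesis by (simp add: mult.assoc)
qed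

text \<open>The factor in front of the gradient term is small because
  the integral of the kernel over \<open>ball 0 r\<close> tends to \<open>0\<close> as \<open>r\<close> decreases to \<open>0\<close>.\<close>

lemma trace_inequality:
  fixes w :: "real^'n \<Rightarrow> real" and \<mu> :: "(real^'n) measure"
  assumes p: "1 < p" and R: "R > 0"
    and [measurable]: "w \<in> borel_measurable borel"
    and w: "\<And>y. y \<noteq> 0 \<Longrightarrow> norm y < R \<Longrightarrow> w y > 0"
    and I: "(\<integral>\<^sup>+y. ennreal ((norm y powr (1 - real CARD('n)) * w y powr (- 1 / p)) powr (p / (p - 1)))
      * indicator (ball 0 R) y \<partial>lborel) < \<infinity>"
    and \<mu>: "finite_measure \<mu>" "sets \<mu> = sets borel"
    and J: "\<And>y. y \<in> S \<Longrightarrow> (\<integral>\<^sup>+x. ennreal (w (y - x)) * indicator (ball 0 R) (y - x) \<partial>\<mu>) \<le> ennreal J"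
    and \<epsilon>: "\<epsilon> > 0"
  obtains C where "C > 0" "\<And>u. (\<And>x. u differentiable (at x)) \<Longrightarrow> continuous_on UNIV (grad u) \<Longrightarrow>
    (\<And>y. y \<notin> S \<Longrightarrow> grad u y = 0) \<Longrightarrow>
    (\<integral>\<^sup>+x. ennreal (\<bar>u x\<bar> powr p) \<partial>\<mu>) \<le> ennreal \<epsilon> * (\<integral>\<^sup>+x. ennreal (norm (grad u x) powr p) \<partial>lborel)
      + ennreal C * (\<integral>\<^sup>+x. ennreal (\<bar>u x\<bar> powr p) \<partial>lborel)"
proof -
  define k where "k y = (norm y powr (1 - real CARD('n)) * w y powr (- 1 / p)) powr (p / (p - 1))" for y :: "real^'n"
  have [measurable]: "k \<in> borel_measurable borel" unfolding k_def by measurable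
  define K where "K r = (\<integral>\<^sup>+y. ennreal (k y) * indicator (ball 0 r) y \<partial>lborel)" for r
  \<comment> \<open>Continuity from above: the balls shrink to the origin, which has measure 0 for
    the density \<open>k\<close>.\<close>
  have "(\<lambda>n. emeasure (density lborel (\<lambda>y. ennreal (k y))) (ball 0 (R / Suc n)))
      \<longlonglongrightarrow> emeasure (density lborel (\<lambda>y. ennreal (k y))) (\<Inter>n. ball 0 (R / Suc n))"
  proof (rule Lim_emeasure_decseq)
    show "range (\<lambda>n. ball (0::real^'n) (R / Suc n)) \<subseteq> sets (density lborel (\<lambda>y. ennreal (k y)))" by auto
    show "decseq (\<lambda>n. ball (0::real^'n) (R / Suc n))"
      unfolding decseq_def using R by (auto intro!: subset_ball divide_left_mono simp: frac_le)
    fix n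
    have "emeasure (density lborel (\<lambda>y. ennreal (k y))) (ball 0 (R / Suc n)) = K (R / Suc n)"
      by (simp add: emeasure_density K_def)
    also have "\<dots> \<le> K R"
    proof -
      have "R / Suc n \<le> R" using R by (simp add: divide_le_eq)
      then show ?thesis
        unfolding K_def
        by (intro nn_integral_mono mult_left_mono) (auto split: split_indicator intro: order_less_le_trans)
    qed
    also have "\<dots> < \<infinity>" using I by (simp add: K_def k_def)
    finally show "emeasure (density lborel (\<lambda>y. ennreal (k y))) (ball 0 (R / Suc n)) \<noteq> \<infinity>" by simp
  qed
  moreover have "(\<Inter>n. ball (0::real^'n) (R / Suc n)) = {0}"
  proof -
    have "y = 0" if y: "\<And>n. norm y < R / Suc n" for y :: "real^'n"
    proof (rule ccontr)
      assume "y \<noteq> 0"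
      then obtain n where "inverse (real (Suc n)) < norm y / R"
        using reals_Archimedean[of "norm y / R"] R by auto
      then show False using y[of n] R by (simp add: field_simps)
    qed
    then show ?thesis using R by auto
  qed
  moreover have "emeasure (density lborel (\<lambda>y. ennreal (k y))) {0} = 0"
    by (simp add: emeasure_density nn_integral_indicator_singleton)
  ultimately have lim: "(\<lambda>n. K (R / Suc n)) \<longlonglongrightarrow> 0"
    by (simp add: emeasure_density K_def)
  define \<beta>1 where "\<beta>1 = measure lborel (ball (0::real^'n) 1)"
  have \<beta>1: "\<beta>1 > 0" using content_ball_pos[of 1 "0::real^'n"] by (simp add: \<beta>1_def)
  \<comment> \<open>By scaling, \<open>r ^ N / \<beta>\<close> is the same for every radius
    \<open>r\<close>. So \<open>A\<close> covers the whole gradient factor except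
    \<open>b powr (p - 1)\<close>, and \<open>b\<close> can be chosen before the radius. The term
    \<open>max J 0 + 1\<close> keeps \<open>A\<close> positive.\<close>
  define A where "A = 2 powr (p - 1) * (1 / (CARD('n) * \<beta>1)) powr p * (max J 0 + 1)"
  have A: "A > 0" using \<beta>1 by (auto simp: A_def intro!: mult_pos_pos)
  define b where "b = (\<epsilon> / A) powr (1 / (p - 1))"
  have b: "b > 0" "b powr (p - 1) = \<epsilon> / A" using p A \<epsilon> by (auto simp: b_def powr_powr)
  have "\<forall>\<^sub>F n in sequentially. K (R / Suc n) < ennreal b"
    using lim b by (intro order_tendstoD(2)) auto
  then obtain n where n: "K (R / Suc n) < ennreal b" by (auto simp: eventually_sequentially)
  define r where "r = R / Suc n"
  have r: "r > 0" "r \<le> R" using R by (auto simp: r_def field_simps)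
  define \<beta> where "\<beta> = measure lborel (ball (0::real^'n) r)"
  have \<beta>: "\<beta> = r ^ CARD('n) * \<beta>1"
    using content_ball_conv_unit_ball[of r "0::real^'n"] r by (simp add: \<beta>_def \<beta>1_def)
  have \<beta>0: "\<beta> > 0" using \<beta> \<beta>1 r by simp
  \<comment> \<open>The added 1 keeps \<open>C\<close> positive even when \<mu> is 0.\<close>
  define C where "C = 2 powr (p - 1) / \<beta> * (measure \<mu> UNIV + 1)"
  have sp: "space \<mu> = UNIV" using sets_eq_imp_space_eq[OF \<mu>(2)] by simp
  show ?thesis
  proof (rule that)
    show "C > 0"
      unfolding C_def using \<beta>0 by (intro mult_pos_pos divide_pos_pos add_nonneg_pos) auto
    fix u :: "real^'n \<Rightarrow> real"
    assume u: "\<And>x. u differentiable (at x)" "continuous_on UNIV (grad u)" "\<And>y. y \<notin> S \<Longrightarrow> grad u y = 0"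
    let ?U = "\<integral>\<^sup>+x. ennreal (\<bar>u x\<bar> powr p) \<partial>lborel" and ?G = "\<integral>\<^sup>+x. ennreal (norm (grad u x) powr p) \<partial>lborel"
    have "(\<integral>\<^sup>+x. ennreal (\<bar>u x\<bar> powr p) \<partial>\<mu>) \<le>
      ennreal (2 powr (p - 1) / \<beta>) * emeasure \<mu> UNIV * ?U
      + ennreal (2 powr (p - 1) * (r ^ CARD('n) / CARD('n) / \<beta>) powr p * b powr (p - 1)) * ennreal J * ?G"
      unfolding \<beta>_def
    proof (rule trace_inequality_explicit[where w = w and S = S, OF p u(1,2) r(1) _ _ b(1)])
      show "w y > 0" if "y \<noteq> 0" "norm y < r" for y using w that r by auto
      show "(\<integral>\<^sup>+ y. ennreal ((norm y powr (1 - real CARD('n)) * w y powr (- 1 / p)) powr (p / (p - 1))) * indicator (ball 0 r) y \<partial>lborel) \<le> ennreal b"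
        using n by (simp add: K_def k_def r_def)
      show "(\<integral>\<^sup>+x. ennreal (w (y - x)) * indicator (ball 0 r) (y - x) \<partial>\<mu>) \<le> ennreal J" if "y \<in> S" for y
        by (rule order_trans[OF _ J[OF that]])
          (use r in \<open>auto intro!: nn_integral_mono mult_left_mono split: split_indicator\<close>)
    qed (use u \<mu> in auto)
    also have "\<dots> \<le> ennreal C * ?U + ennreal \<epsilon> * ?G"
    proof (intro add_mono mult_right_mono)
      have "emeasure \<mu> UNIV \<le> ennreal (measure \<mu> UNIV + 1)"
        using \<mu> by (simp add: finite_measure.emeasure_eq_measure ennreal_leI)
      then show "ennreal (2 powr (p - 1) / \<beta>) * emeasure \<mu> UNIV \<le> ennreal C"
        unfolding C_def using \<beta>0 by (subst ennreal_mult) (auto intro!: mult_left_mono)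
      have r_eq: "r ^ CARD('n) / CARD('n) / \<beta> = 1 / (CARD('n) * \<beta>1)"
        using r \<beta>1 by (simp add: \<beta>)
      have "2 powr (p - 1) * (r ^ CARD('n) / CARD('n) / \<beta>) powr p * b powr (p - 1) * (max J 0 + 1)
          = A * b powr (p - 1)"
        unfolding r_eq A_def by (simp only: mult_ac)
      also have "\<dots> = \<epsilon>" using A by (simp add: b(2))
      finally have "2 powr (p - 1) * (r ^ CARD('n) / CARD('n) / \<beta>) powr p * b powr (p - 1) * (max J 0 + 1) = \<epsilon>" .
      moreover have "ennreal c * ennreal J \<le> ennreal (c * (max J 0 + 1))" if "c \<ge> 0" for c
        using that by (subst ennreal_mult) ((simp; fail) | (intro mult_left_mono ennreal_leI; simp))+
      ultimately show "ennreal (2 powr (p - 1) * (r ^ CARD('n) / CARD('n) / \<beta>) powr p * b powr (p - 1)) * ennreal J \<le> ennreal \<epsilon>"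
        by (metis mult_nonneg_nonneg powr_ge_zero)
    qed auto
    finally show "(\<integral>\<^sup>+x. ennreal (\<bar>u x\<bar> powr p) \<partial>\<mu>) \<le> ennreal \<epsilon> * ?G + ennreal C * ?U"
      by (simp add: add.commute)
  qed
qed

section \<open>Power and logarithmic weights\<close>

text \<open>By \<open>cover\<close>, \<open>f (y - x)\<close> is dominated by the sum of
  \<open>c i\<close> times the indicators of the balls around \<open>y\<close>. Whole balls are used
  in place of shells because the measure is controlled on balls only.\<close>

lemma nn_integral_radial_le:
  fixes \<mu> :: "'a::euclidean_space measure" and f :: "'a \<Rightarrow> real"
  assumes sets[measurable_cong, simp]: "sets \<mu> = sets borel"
    and [measurable]: "f \<in> borel_measurable borel"
    and cover: "\<And>z. norm z < R \<Longrightarrow> \<exists>i. norm z < \<rho> i \<and> f z \<le> c i"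
    and c: "\<And>i. 0 \<le> c i" and m: "\<And>i. 0 \<le> m i" "\<And>i. emeasure \<mu> (ball y (\<rho> i)) \<le> ennreal (m i)"
    and sum: "summable (\<lambda>i. c i * m i)"
  shows "(\<integral>\<^sup>+x. ennreal (f (y - x)) * indicator (ball 0 R) (y - x) \<partial>\<mu>) \<le> ennreal (\<Sum>i. c i * m i)"
proof -
  have [measurable]: "ball y r \<in> sets borel" for r by simp
  have "(\<integral>\<^sup>+x. ennreal (f (y - x)) * indicator (ball 0 R) (y - x) \<partial>\<mu>)
    \<le> (\<integral>\<^sup>+x. (\<Sum>i. ennreal (c i) * indicator (ball y (\<rho> i)) x) \<partial>\<mu>)"
  proof (rule nn_integral_mono)
    fix x
    show "ennreal (f (y - x)) * indicator (ball 0 R) (y - x) \<le> (\<Sum>i. ennreal (c i) * indicator (ball y (\<rho> i)) x)"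
    proof (cases "norm (y - x) < R")
      case True
      then obtain i where i: "norm (y - x) < \<rho> i" "f (y - x) \<le> c i" using cover by blast
      have "ennreal (f (y - x)) * indicator (ball 0 R) (y - x) \<le> ennreal (c i) * indicator (ball y (\<rho> i)) x"
      proof -
        have "y - x \<in> ball 0 R" "x \<in> ball y (\<rho> i)" using i True by (simp_all add: dist_norm norm_minus_commute)
        then show ?thesis using i by (simp add: ennreal_leI)
      qed
      also have "\<dots> = (\<Sum>i\<in>{i}. ennreal (c i) * indicator (ball y (\<rho> i)) x)"
        by (subst sum.insert; simp)
      also have "\<dots> \<le> (\<Sum>i. ennreal (c i) * indicator (ball y (\<rho> i)) x)"
        by (rule sum_le_suminf) auto
      finally show ?thesis .
    qed simp
  qed
  also have "\<dots> = (\<Sum>i. ennreal (c i) * emeasure \<mu> (ball y (\<rho> i)))"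
    by (subst nn_integral_suminf) (simp_all add: nn_integral_cmult)
  also have "\<dots> \<le> (\<Sum>i. ennreal (c i * m i))"
    by (intro suminf_le) (auto simp: ennreal_mult c m intro!: mult_left_mono)
  also have "\<dots> = ennreal (\<Sum>i. c i * m i)"
    using c m sum by (intro suminf_ennreal2) auto
  finally show ?thesis .
qed

lemma geometric_shell:
  fixes t R q :: real
  assumes "0 < t" "t < R" "0 < q" "q < 1"
  obtains i :: nat where "R * q ^ Suc i \<le> t" "t < R * q ^ i"
proof -
  obtain n where "q ^ n < t / R" using real_arch_pow_inv[of "t / R" q] assms by auto
  then have ex: "R * q ^ n \<le> t" using assms by (simp add: field_simps)
  define j where "j = (LEAST n. R * q ^ n \<le> t)"
  have j: "R * q ^ j \<le> t" unfolding j_def by (rule LeastI[of _ n]) (rule ex)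
  then have "j \<noteq> 0" using assms by (intro notI) simp
  then obtain i where i: "j = Suc i" by (cases j) auto
  then have "\<not> R * q ^ i \<le> t" using not_less_Least[of i "\<lambda>n. R * q ^ n \<le> t"] by (simp add: j_def)
  then show ?thesis using that[of i] i j by simp
qed

text \<open>On the shell between the radii \<open>R / 2^(i+1)\<close> and \<open>R / 2^i\<close> the
  weight is at most its value at the inner radius, and the shell lies in the outer ball. The terms
  decay like \<open>2^(-(\<theta>-s) i)\<close>. The series itself is kept as the bound, since only
  its independence of \<open>y\<close> matters.\<close>

lemma nn_integral_power_weight:
  fixes \<mu> :: "'a::euclidean_space measure"
  assumes sets: "sets \<mu> = sets borel" and R: "R > 0" and M: "M \<ge> 0" and s: "0 \<le> s" "s < \<theta>"
    and m: "\<And>r. 0 < r \<Longrightarrow> r \<le> R \<Longrightarrow> emeasure \<mu> (ball y r) \<le> ennreal (M * r powr \<theta>)"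
  shows "(\<integral>\<^sup>+x. ennreal (norm (y - x) powr (- s)) * indicator (ball 0 R) (y - x) \<partial>\<mu>)
    \<le> ennreal (\<Sum>i. (R * (1/2) ^ Suc i) powr (- s) * (M * (R * (1/2) ^ i) powr \<theta>))"
proof (rule nn_integral_radial_le[where \<rho> = "\<lambda>i. R * (1/2) ^ i"])
  fix z :: 'a assume z: "norm z < R"
  show "\<exists>i. norm z < R * (1/2) ^ i \<and> norm z powr (- s) \<le> (R * (1/2) ^ Suc i) powr (- s)"
  proof (cases "z = 0")
    \<comment> \<open>\<open>0 powr (- s)\<close> is 0, so the centre satisfies any bound.\<close>
    case True
    then show ?thesis using R by (intro exI[of _ 0]) auto
  next
    case False
    then obtain i where "R * (1/2) ^ Suc i \<le> norm z" "norm z < R * (1/2) ^ i"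
      using geometric_shell[of "norm z" R "1/2"] z by auto
    then show ?thesis using R s by (intro exI[of _ i] conjI powr_mono2') auto
  qed
next
  have "R * (1/2) ^ i \<le> R" for i using R by (simp add: power_le_one)
  then show "emeasure \<mu> (ball y (R * (1/2) ^ i)) \<le> ennreal (M * (R * (1/2) ^ i) powr \<theta>)" for i
    using R by (intro m) auto
  have "(R * (1/2) ^ Suc i) powr (- s) * (M * (R * (1/2) ^ i) powr \<theta>)
    = M * R powr (\<theta> - s) * 2 powr s * ((1/2) powr (\<theta> - s)) ^ i" for i
  proof -
    have 1: "(R * (1/2) ^ Suc i) powr (- s) = R powr (- s) * ((1/2) powr (- s) * ((1/2) ^ i) powr (- s))"
      by (simp only: power_Suc powr_mult)
    have 2: "(R * (1/2) ^ i) powr \<theta> = R powr \<theta> * ((1/2) ^ i) powr \<theta>"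
      using R by (simp add: powr_mult)
    have 3: "(1/2::real) powr (- s) = 2 powr s" by (simp add: powr_divide powr_minus_divide)
    have "((1/2::real) ^ i) powr (- s) * ((1/2) ^ i) powr \<theta> = ((1/2) ^ i) powr (\<theta> - s)"
      by (simp add: powr_add[symmetric])
    also have "\<dots> = ((1/2) powr (\<theta> - s)) ^ i"
      by (simp add: powr_realpow[symmetric] powr_powr mult.commute)
    finally have 4: "((1/2::real) ^ i) powr (- s) * ((1/2) ^ i) powr \<theta> = ((1/2) powr (\<theta> - s)) ^ i" .
    have 5: "R powr (- s) * R powr \<theta> = R powr (\<theta> - s)" by (simp add: powr_add[symmetric])
    have "(R * (1/2) ^ Suc i) powr (- s) * (M * (R * (1/2) ^ i) powr \<theta>)
      = M * (R powr (- s) * R powr \<theta>) * 2 powr s * (((1/2) ^ i) powr (- s) * ((1/2) ^ i) powr \<theta>)"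
      unfolding 1 2 3 by (simp only: mult_ac)
    then show ?thesis unfolding 4 5 .
  qed
  moreover have "(1/2::real) powr (\<theta> - s) < 1"
    using s powr_less_mono[of "s - \<theta>" 0 "2::real"] by (simp add: powr_divide powr_minus_divide[symmetric])
  ultimately show "summable (\<lambda>i. (R * (1/2) ^ Suc i) powr (- s) * (M * (R * (1/2) ^ i) powr \<theta>))"
    by (simp only:) (intro summable_mult summable_geometric, simp)
qed (use sets M in auto)

lemma emeasure_lborel_ball:
  assumes "r > 0"
  shows "emeasure lborel (ball (y::'a::euclidean_space) r) = ennreal (measure lborel (ball (0::'a) 1) * r powr DIM('a))"
proof -
  have "emeasure lborel (ball y r) = ennreal (measure lborel (ball y r))"
    using emeasure_lborel_ball_finite[of y r] by (simp add: emeasure_eq_ennreal_measure)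
  then show ?thesis
    using content_ball_conv_unit_ball[of r y] assms by (simp add: powr_realpow mult.commute)
qed

text \<open>For \<open>w = |y|^(-s)\<close> the integrand is \<open>|y|\<close> to the power
  \<open>-(N - 1 - s/p) p / (p - 1)\<close>, which exceeds \<open>-N\<close> exactly when
  \<open>s > N - p\<close>. The power-weight estimate for Lebesgue measure, where \<theta> is
  \<open>N\<close>, then applies.\<close>

lemma power_kernel_finite:
  assumes p: "1 < p" and R: "0 < R" "R \<le> 1" and s: "real CARD('n) - p < s"
  shows "(\<integral>\<^sup>+y. ennreal ((norm y powr (1 - real CARD('n)) * (norm y powr (- s)) powr (- 1 / p)) powr (p / (p - 1)))
      * indicator (ball (0::real^'n) R) y \<partial>lborel) < \<infinity>"
proof -
  let ?N = "real CARD('n)"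
  \<comment> \<open>The power-weight estimate asks for a nonnegative exponent. Since
    \<open>|y| < R \<le> 1\<close>, replacing a negative one by 0 only enlarges the
    integrand.\<close>
  define \<gamma> where "\<gamma> = max 0 ((?N - 1 - s / p) * (p / (p - 1)))"
  have "(?N - 1 - s / p) * (p / (p - 1)) = ((?N - 1) * p - s) / (p - 1)"
    using p by (simp add: field_simps)
  also have "\<dots> < ?N" using p s by (simp add: divide_less_eq algebra_simps)
  finally have \<gamma>: "0 \<le> \<gamma>" "\<gamma> < ?N" by (auto simp: \<gamma>_def)
  have "(\<integral>\<^sup>+y. ennreal ((norm y powr (1 - ?N) * (norm y powr (- s)) powr (- 1 / p)) powr (p / (p - 1)))
      * indicator (ball (0::real^'n) R) y \<partial>lborel)
    \<le> (\<integral>\<^sup>+y. ennreal (norm (0 - y) powr (- \<gamma>)) * indicator (ball (0::real^'n) R) (0 - y) \<partial>lborel)"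
  proof (rule nn_integral_mono)
    fix y :: "real^'n"
    have "(norm y powr (1 - ?N) * (norm y powr (- s)) powr (- 1 / p)) powr (p / (p - 1)) \<le> norm y powr (- \<gamma>)"
      if "norm y < R"
    proof (cases "y = 0")
      case False
      have "(norm y powr (1 - ?N) * (norm y powr (- s)) powr (- 1 / p)) powr (p / (p - 1))
        = norm y powr (- ((?N - 1 - s / p) * (p / (p - 1))))"
        by (simp add: powr_powr powr_add[symmetric] algebra_simps)
      also have "\<dots> \<le> norm y powr (- \<gamma>)"
        using that R False by (intro powr_mono') (auto simp: \<gamma>_def)
      finally show ?thesis .
    qed simp
    then show "ennreal ((norm y powr (1 - ?N) * (norm y powr (- s)) powr (- 1 / p)) powr (p / (p - 1)))
      * indicator (ball 0 R) y \<le> ennreal (norm (0 - y) powr (- \<gamma>)) * indicator (ball 0 R) (0 - y)"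
      by (auto intro!: ennreal_leI split: split_indicator)
  qed
  also have "\<dots> \<le> ennreal (\<Sum>i. (R * (1/2) ^ Suc i) powr (- \<gamma>) *
      (measure lborel (ball (0::real^'n) 1) * (R * (1/2) ^ i) powr real DIM(real^'n)))"
    by (rule nn_integral_power_weight) (use R \<gamma> emeasure_lborel_ball[of _ "0::real^'n"] in auto)
  finally show ?thesis by (simp add: order_le_less_trans)
qed

text \<open>For \<open>p = N\<close> and \<open>w = ln(D / |y|)^b\<close> the integrand is
  \<open>|y|^(-N) ln(D / |y|)^(-\<gamma>)\<close>. On shells of ratio \<open>1/e\<close> the factor
  \<open>|y|^(-N)\<close> contributes a bounded mass each, and the logarithm is at least
  \<open>Suc i\<close> on the shell with index \<open>i\<close> because the radii start at
  \<open>D / e\<close>. What remains is the sum of \<open>i^(-\<gamma>)\<close> with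
  \<open>\<gamma> > 1\<close>.\<close>

lemma log_kernel_finite:
  assumes N: "CARD('n) \<ge> 2" and D: "D > 0" and b: "real CARD('n) - 1 < b"
  shows "(\<integral>\<^sup>+y. ennreal ((norm y powr (1 - real CARD('n)) * (ln (D / norm y) powr b) powr (- 1 / real CARD('n)))
      powr (real CARD('n) / (real CARD('n) - 1))) * indicator (ball (0::real^'n) (D * exp (- 1))) y \<partial>lborel) < \<infinity>"
proof -
  let ?N = "real CARD('n)"
  define \<gamma> where "\<gamma> = b / (?N - 1)"
  have \<gamma>: "\<gamma> > 1" using N b by (simp add: \<gamma>_def less_divide_eq)
  define f where "f z = norm z powr (- ?N) * ln (D / norm z) powr (- \<gamma>)" for z :: "real^'n"
  define \<rho> where "\<rho> i = D * exp (- 1) * exp (- 1) ^ i" for i :: nat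
  have \<rho>: "\<rho> i > 0" "\<rho> (Suc i) = \<rho> i * exp (- 1)" for i using D by (auto simp: \<rho>_def)
  have f_eq: "(norm y powr (1 - ?N) * (ln (D / norm y) powr b) powr (- 1 / ?N)) powr (?N / (?N - 1)) = f y" for y :: "real^'n"
  proof -
    have "(1 - ?N) * (?N / (?N - 1)) = - ?N" using N by (simp add: field_simps)
    moreover have "b * (- 1 / ?N) * (?N / (?N - 1)) = - \<gamma>" using N by (simp add: \<gamma>_def)
    ultimately show ?thesis unfolding f_def by (simp only: powr_mult powr_powr)
  qed
  have "(\<integral>\<^sup>+y. ennreal (f y) * indicator (ball 0 (D * exp (- 1))) y \<partial>lborel)
    = (\<integral>\<^sup>+y. ennreal (f (0 - y)) * indicator (ball 0 (D * exp (- 1))) (0 - y) \<partial>lborel)"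
    by (intro nn_integral_cong) (simp add: f_def split: split_indicator)
  also have "\<dots> \<le> ennreal (\<Sum>i. (\<rho> (Suc i) powr (- ?N) * real (Suc i) powr (- \<gamma>)) *
      (measure lborel (ball (0::real^'n) 1) * \<rho> i powr ?N))"
  proof (rule nn_integral_radial_le[where \<rho> = \<rho>])
    show "f \<in> borel_measurable borel" unfolding f_def by measurable
    fix z :: "real^'n" assume z: "norm z < D * exp (- 1)"
    show "\<exists>i. norm z < \<rho> i \<and> f z \<le> \<rho> (Suc i) powr (- ?N) * real (Suc i) powr (- \<gamma>)"
    proof (cases "z = 0")
      case True
      then show ?thesis using \<rho> by (intro exI[of _ 0]) (auto simp: f_def)
    next
      case False
      then obtain i where i: "\<rho> (Suc i) \<le> norm z" "norm z < \<rho> i"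
        using geometric_shell[of "norm z" "D * exp (- 1)" "exp (- 1)"] z unfolding \<rho>_def by auto
      have "\<rho> i = D * exp (- real (Suc i))"
        by (simp add: \<rho>_def exp_of_nat_mult[symmetric] exp_add[symmetric])
      then have "norm z * exp (real (Suc i)) \<le> D * exp (- real (Suc i)) * exp (real (Suc i))"
        using i by (intro mult_right_mono) auto
      also have "\<dots> = D" by (simp add: exp_minus del: of_nat_Suc)
      finally have "exp (real (Suc i)) \<le> D / norm z"
        using False by (simp add: field_simps del: of_nat_Suc)
      then have "real (Suc i) \<le> ln (D / norm z)"
        using D False by (subst ln_ge_iff) auto
      then have "ln (D / norm z) powr (- \<gamma>) \<le> real (Suc i) powr (- \<gamma>)"
        using \<gamma> by (intro powr_mono2') auto
      moreover have "norm z powr (- ?N) \<le> \<rho> (Suc i) powr (- ?N)"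
        using i \<rho> by (intro powr_mono2') auto
      ultimately show ?thesis using i by (intro exI[of _ i] conjI) (auto simp: f_def intro!: mult_mono)
    qed
  next
    have "(\<rho> (Suc i) powr (- ?N) * real (Suc i) powr (- \<gamma>)) * (measure lborel (ball (0::real^'n) 1) * \<rho> i powr ?N)
      = exp ?N * measure lborel (ball (0::real^'n) 1) * real (Suc i) powr (- \<gamma>)" for i
    proof -
      have "\<rho> (Suc i) powr (- ?N) * \<rho> i powr ?N = exp ?N"
      proof -
        have "\<rho> i powr (- ?N) * \<rho> i powr ?N = 1" using \<rho>(1)[of i] by (simp add: powr_add[symmetric])
        moreover have "exp (- 1) powr (- ?N) = exp ?N" by (simp add: powr_def)
        ultimately show ?thesis by (simp only: \<rho>(2) powr_mult) simp
      qed
      moreover have "\<rho> (Suc i) powr (- ?N) * x * (y * \<rho> i powr ?N) = (\<rho> (Suc i) powr (- ?N) * \<rho> i powr ?N) * y * x" for x y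
        by (simp only: mult_ac)
      ultimately show ?thesis by simp
    qed
    moreover have "summable (\<lambda>i. real (Suc i) powr (- \<gamma>))"
      using \<gamma> by (subst summable_Suc_iff) (simp add: summable_real_powr_iff)
    ultimately show "summable (\<lambda>i. (\<rho> (Suc i) powr (- ?N) * real (Suc i) powr (- \<gamma>)) *
        (measure lborel (ball (0::real^'n) 1) * \<rho> i powr ?N))"
      by (simp only:) (intro summable_mult)
    show "emeasure lborel (ball (0::real^'n) (\<rho> i)) \<le> ennreal (measure lborel (ball (0::real^'n) 1) * \<rho> i powr ?N)" for i
      using emeasure_lborel_ball[OF \<rho>(1), of "0::real^'n"] by simp
  qed auto
  also have "\<dots> < \<infinity>" by simp
  finally show ?thesis unfolding f_eq .
qed

text \<open>The radii \<open>D exp(-2^i / 2)\<close> let the logarithm double from one shell to the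
  next, which makes the series geometric with ratio \<open>2^(b-\<beta>)\<close>. Shells of constant
  ratio would give the sum of \<open>i^(b-\<beta>)\<close> and would require
  \<open>\<beta> > b + 1\<close>, more than is available.\<close>

lemma nn_integral_log_weight:
  fixes \<mu> :: "'a::euclidean_space measure"
  assumes sets: "sets \<mu> = sets borel" and D: "D > 0" and M: "M \<ge> 0" and b: "0 \<le> b" "b < \<beta>"
    and m: "\<And>r. 0 < r \<Longrightarrow> r < D \<Longrightarrow> emeasure \<mu> (ball y r) \<le> ennreal (M * ln (D / r) powr (- \<beta>))"
  shows "(\<integral>\<^sup>+x. ennreal (ln (D / norm (y - x)) powr b) * indicator (ball 0 (D * exp (- 1))) (y - x) \<partial>\<mu>)
    \<le> ennreal (\<Sum>i. (2 ^ Suc i) powr b * (M * (2 ^ i / 2) powr (- \<beta>)))"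
proof (rule nn_integral_radial_le[where \<rho> = "\<lambda>i. D * exp (- (2 ^ i / 2))" and f = "\<lambda>z. ln (D / norm z) powr b"])
  fix z :: 'a assume z: "norm z < D * exp (- 1)"
  show "\<exists>i. norm z < D * exp (- (2 ^ i / 2)) \<and> ln (D / norm z) powr b \<le> (2 ^ Suc i) powr b"
  proof (cases "z = 0")
    case True
    then show ?thesis using D by (intro exI[of _ 0]) auto
  next
    case False
    define L where "L = ln (D / norm z)"
    have nz: "norm z = D * exp (- L)" using False D by (simp add: L_def exp_minus)
    then have "L > 1" using z D by simp
    \<comment> \<open>Dyadic shells for \<open>1 / L\<close> single out the power of 2 just below
      the logarithm \<open>L\<close>.\<close>
    then obtain i where i: "1 * (1/2) ^ Suc i \<le> 1 / L" "1 / L < 1 * (1/2) ^ i"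
      using geometric_shell[of "1 / L" 1 "1/2"] by auto
    then have L: "L \<le> 2 ^ Suc i" "2 ^ i < L"
      using \<open>L > 1\<close> by (auto simp: field_simps power_divide)
    have "(2::real) ^ i / 2 < 2 ^ i" by simp
    then have "2 ^ i / 2 < L" using L by linarith
    then have "norm z < D * exp (- (2 ^ i / 2))" using D by (simp add: nz)
    moreover have "L powr b \<le> (2 ^ Suc i) powr b" using L(1) b \<open>L > 1\<close> by (intro powr_mono2) auto
    ultimately show ?thesis unfolding L_def by blast
  qed
next
  fix i
  have "emeasure \<mu> (ball y (D * exp (- (2 ^ i / 2)))) \<le> ennreal (M * ln (D / (D * exp (- (2 ^ i / 2)))) powr (- \<beta>))"
    using D by (intro m) auto
  also have "D / (D * exp (- (2 ^ i / 2))) = exp (2 ^ i / 2)"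
    using D by (simp add: exp_minus field_simps)
  also have "ln (exp (2 ^ i / 2 :: real)) = 2 ^ i / 2" by (rule ln_exp)
  finally show "emeasure \<mu> (ball y (D * exp (- (2 ^ i / 2)))) \<le> ennreal (M * (2 ^ i / 2) powr (- \<beta>))" .
next
  have "(2 ^ Suc i) powr b * (M * (2 ^ i / 2) powr (- \<beta>)) = M * 2 powr (b + \<beta>) * (2 powr (b - \<beta>)) ^ i" for i :: nat
  proof -
    have "(2 ^ Suc i) powr b = (2::real) powr (b + real i * b)"
      by (simp add: powr_realpow[symmetric] powr_powr algebra_simps del: power_Suc)
    moreover have "(2 ^ i / 2) powr (- \<beta>) = (2::real) powr (\<beta> - real i * \<beta>)"
    proof -
      have "(2 ^ i / 2 :: real) = 2 powr (real i - 1)" by (simp add: powr_diff powr_realpow)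
      then show ?thesis by (simp add: powr_powr algebra_simps)
    qed
    moreover have "(2 powr (b - \<beta>)) ^ i = (2::real) powr (real i * (b - \<beta>))"
      by (simp add: powr_realpow[symmetric] powr_powr mult.commute)
    ultimately show ?thesis by (simp add: powr_add[symmetric] algebra_simps)
  qed
  moreover have "(2::real) powr (b - \<beta>) < 1" using b powr_less_mono[of "b - \<beta>" 0 "2::real"] by simp
  ultimately show "summable (\<lambda>i. (2 ^ Suc i) powr b * (M * (2 ^ i / 2) powr (- \<beta>)))"
    by (simp only:) (intro summable_mult summable_geometric, simp)
qed (use sets M in auto)

section \<open>Morrey potentials are form bounded\<close>

lemma borel_measurable_restrict_indicator:
  fixes V :: "'a::euclidean_space \<Rightarrow> real"
  assumes "V \<in> borel_measurable (lebesgue_on \<Omega>)" "S \<subseteq> \<Omega>" "S \<in> sets lebesgue"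
  shows "(\<lambda>x. ennreal \<bar>V x\<bar> * indicator S x) \<in> borel_measurable lebesgue"
proof -
  have [measurable]: "V \<in> borel_measurable (lebesgue_on S)"
    using measurable_restrict_mono[OF assms(1,2)] .
  have "(\<lambda>x. ennreal \<bar>V x\<bar>) \<in> borel_measurable (lebesgue_on S)" by measurable
  then show ?thesis
    using assms(3) by (subst (asm) borel_measurable_restrict_space_iff_ennreal) auto
qed

text \<open>A Morrey condition bounds integrals over balls of radius below the diameter, none of
  which has to cover \<open>S\<close>; finitely many of them do by compactness.\<close>

lemma nn_integral_finite_if_locally_finite:
  fixes S :: "'a::euclidean_space set" and f :: "'a \<Rightarrow> ennreal"
  assumes S: "compact S" and f: "(\<lambda>x. f x * indicator S x) \<in> borel_measurable lebesgue"
    and loc: "\<And>y. y \<in> S \<Longrightarrow> \<exists>r>0. (\<integral>\<^sup>+x\<in>ball y r \<inter> S. f x \<partial>lebesgue) < \<infinity>"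
  shows "(\<integral>\<^sup>+x\<in>S. f x \<partial>lebesgue) < \<infinity>"
proof -
  obtain r where r: "\<And>y. y \<in> S \<Longrightarrow> r y > 0" "\<And>y. y \<in> S \<Longrightarrow> (\<integral>\<^sup>+x\<in>ball y (r y) \<inter> S. f x \<partial>lebesgue) < \<infinity>"
    using loc by metis
  obtain T where T: "T \<subseteq> S" "finite T" "S \<subseteq> (\<Union>y\<in>T. ball y (r y))"
  proof (rule compactE_image[OF S, of S "\<lambda>y. ball y (r y)"])
    show "S \<subseteq> (\<Union>y\<in>S. ball y (r y))" using r(1) by force
  qed auto
  have "(\<integral>\<^sup>+x\<in>S. f x \<partial>lebesgue) \<le> (\<integral>\<^sup>+x. (\<Sum>y\<in>T. f x * indicator S x * indicator (ball y (r y)) x) \<partial>lebesgue)"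
  proof (rule nn_integral_mono)
    fix x
    show "f x * indicator S x \<le> (\<Sum>y\<in>T. f x * indicator S x * indicator (ball y (r y)) x)"
    proof (cases "x \<in> S")
      case True
      then obtain y where y: "y \<in> T" "x \<in> ball y (r y)" using T by auto
      then have "f x * indicator S x = f x * indicator S x * indicator (ball y (r y)) x" by simp
      also have "\<dots> \<le> (\<Sum>y\<in>T. f x * indicator S x * indicator (ball y (r y)) x)"
        by (rule member_le_sum) (use y T in auto)
      finally show ?thesis .
    qed simp
  qed
  also have "\<dots> = (\<Sum>y\<in>T. \<integral>\<^sup>+x. f x * indicator S x * indicator (ball y (r y)) x \<partial>lebesgue)"
    by (rule nn_integral_sum, rule borel_measurable_times_ennreal[OF f])
      (rule borel_measurable_indicator, simp add: fmeasurableD)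
  also have "\<dots> = (\<Sum>y\<in>T. \<integral>\<^sup>+x\<in>ball y (r y) \<inter> S. f x \<partial>lebesgue)"
    by (intro sum.cong refl nn_integral_cong) (auto simp: indicator_def)
  also have "\<dots> < \<infinity>" using r T by (auto simp: ennreal_sum_less_top subset_iff)
  finally show ?thesis .
qed

text \<open>The Morrey--Adams inequality as a property of \<open>V\<close> on \<open>S\<close>. The
  class of \<open>u\<close> is C^1 rather than smooth because \<open>\<zeta>^(1/p) \<phi>\<close>
  will be inserted, for which only C^1 regularity is established; confining the gradient to
  \<open>S\<close> is what the trace inequality asks.\<close>

definition form_bounded :: "real \<Rightarrow> (real^'n) set \<Rightarrow> (real^'n \<Rightarrow> real) \<Rightarrow> bool"
  where "form_bounded p S V \<longleftrightarrow> (\<forall>\<epsilon>>0. \<exists>C>0. \<forall>u. (\<forall>x. u differentiable (at x)) \<longrightarrow>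
    continuous_on UNIV (grad u) \<longrightarrow> (\<forall>x. x \<notin> S \<longrightarrow> grad u x = 0) \<longrightarrow>
    (\<integral>\<^sup>+x. ennreal \<bar>V x\<bar> * indicator S x * ennreal (\<bar>u x\<bar> powr p) \<partial>lebesgue)
      \<le> ennreal \<epsilon> * (\<integral>\<^sup>+x. ennreal (norm (grad u x) powr p) \<partial>lborel)
        + ennreal C * (\<integral>\<^sup>+x. ennreal (\<bar>u x\<bar> powr p) \<partial>lborel))"

lemma form_boundedE:
  assumes "form_bounded p S V" "\<epsilon> > 0"
  obtains C where "C > 0" "\<And>u. (\<And>x. u differentiable (at x)) \<Longrightarrow> continuous_on UNIV (grad u) \<Longrightarrow>
    (\<And>x. x \<notin> S \<Longrightarrow> grad u x = 0) \<Longrightarrow>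
    (\<integral>\<^sup>+x. ennreal \<bar>V x\<bar> * indicator S x * ennreal (\<bar>u x\<bar> powr p) \<partial>lebesgue)
      \<le> ennreal \<epsilon> * (\<integral>\<^sup>+x. ennreal (norm (grad u x) powr p) \<partial>lborel)
        + ennreal C * (\<integral>\<^sup>+x. ennreal (\<bar>u x\<bar> powr p) \<partial>lborel)"
  using assms(1)[unfolded form_bounded_def, rule_format, OF assms(2)]
  by (elim exE conjE) (rule that, assumption, simp)

text \<open>The measure is moved to the Borel \<open>\<sigma>\<close>-algebra because the trace inequality applies Fubini to it and
  \<^const>\<open>lborel\<close>.\<close>

definition potential_measure :: "'a::euclidean_space set \<Rightarrow> ('a \<Rightarrow> real) \<Rightarrow> 'a measure"
  where "potential_measure S V = distr (density lebesgue (\<lambda>x. ennreal \<bar>V x\<bar> * indicator S x)) borel (\<lambda>x. x)"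

lemma sets_potential_measure [simp, measurable_cong]: "sets (potential_measure S V) = sets borel"
  by (simp add: potential_measure_def)

context
  fixes S :: "'a::euclidean_space set" and V :: "'a \<Rightarrow> real"
  assumes meas: "(\<lambda>x. ennreal \<bar>V x\<bar> * indicator S x) \<in> borel_measurable lebesgue"
begin

lemma nn_integral_potential_measure:
  assumes "f \<in> borel_measurable borel"
  shows "(\<integral>\<^sup>+x. f x \<partial>potential_measure S V) = (\<integral>\<^sup>+x. ennreal \<bar>V x\<bar> * indicator S x * f x \<partial>lebesgue)"
proof -
  have id: "(\<lambda>x. x) \<in> measurable (density lebesgue (\<lambda>x. ennreal \<bar>V x\<bar> * indicator S x)) borel"
    by (auto simp: measurable_def)
  have f: "f \<in> borel_measurable lebesgue" using assms by (simp add: measurable_completion)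
  show ?thesis
    unfolding potential_measure_def
    by (subst nn_integral_distr[OF id]) (use assms f meas in \<open>simp_all add: nn_integral_density\<close>)
qed

lemma emeasure_potential_measure:
  assumes "B \<in> sets borel"
  shows "emeasure (potential_measure S V) B = (\<integral>\<^sup>+x\<in>B \<inter> S. ennreal \<bar>V x\<bar> \<partial>lebesgue)"
proof -
  have "emeasure (potential_measure S V) B = (\<integral>\<^sup>+x. indicator B x \<partial>potential_measure S V)"
    using assms by simp
  also have "\<dots> = (\<integral>\<^sup>+x. ennreal \<bar>V x\<bar> * indicator S x * indicator B x \<partial>lebesgue)"
    using assms by (intro nn_integral_potential_measure) simp
  also have "\<dots> = (\<integral>\<^sup>+x\<in>B \<inter> S. ennreal \<bar>V x\<bar> \<partial>lebesgue)"
    by (intro nn_integral_cong) (auto simp: indicator_def)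
  finally show ?thesis .
qed

lemma finite_potential_measure:
  assumes "(\<integral>\<^sup>+x\<in>S. ennreal \<bar>V x\<bar> \<partial>lebesgue) < \<infinity>"
  shows "finite_measure (potential_measure S V)"
proof (rule finite_measureI)
  have "space (potential_measure S V) = UNIV" by (simp add: potential_measure_def)
  then show "emeasure (potential_measure S V) (space (potential_measure S V)) \<noteq> \<infinity>"
    using assms by (simp add: emeasure_potential_measure)
qed

end

text \<open>The trace inequality for the measure \<open>|V| dx\<close> on \<open>S\<close>. The
  cases \<open>p > N\<close>, \<open>p < N\<close> and \<open>p = N\<close> differ only in the
  weight \<open>w\<close> and in the proof that \<open>I\<close> and \<open>J\<close> hold for
  it.\<close>

lemma form_boundedI:
  fixes S :: "(real^'n) set" and w :: "real^'n \<Rightarrow> real"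
  assumes meas: "(\<lambda>x. ennreal \<bar>V x\<bar> * indicator S x) \<in> borel_measurable lebesgue"
    and fin: "(\<integral>\<^sup>+x\<in>S. ennreal \<bar>V x\<bar> \<partial>lebesgue) < \<infinity>"
    and p: "1 < p" and R: "R > 0"
    and w: "w \<in> borel_measurable borel" "\<And>y. y \<noteq> 0 \<Longrightarrow> norm y < R \<Longrightarrow> w y > 0"
    and I: "(\<integral>\<^sup>+y. ennreal ((norm y powr (1 - real CARD('n)) * w y powr (- 1 / p)) powr (p / (p - 1)))
      * indicator (ball 0 R) y \<partial>lborel) < \<infinity>"
    and J: "\<And>y. y \<in> S \<Longrightarrow> (\<integral>\<^sup>+x. ennreal (w (y - x)) * indicator (ball 0 R) (y - x) \<partial>potential_measure S V) \<le> ennreal J"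
  shows "form_bounded p S V"
  unfolding form_bounded_def
proof (intro allI impI)
  fix \<epsilon> :: real assume "\<epsilon> > 0"
  from trace_inequality[OF p R w I finite_potential_measure[OF meas fin] sets_potential_measure J this]
  obtain C where C: "C > 0" "\<And>u. (\<And>x. u differentiable (at x)) \<Longrightarrow> continuous_on UNIV (grad u) \<Longrightarrow>
    (\<And>y. y \<notin> S \<Longrightarrow> grad u y = 0) \<Longrightarrow>
    (\<integral>\<^sup>+x. ennreal (\<bar>u x\<bar> powr p) \<partial>potential_measure S V) \<le> ennreal \<epsilon> * (\<integral>\<^sup>+x. ennreal (norm (grad u x) powr p) \<partial>lborel)
      + ennreal C * (\<integral>\<^sup>+x. ennreal (\<bar>u x\<bar> powr p) \<partial>lborel)" by blast
  show "\<exists>C>0. \<forall>u. (\<forall>x. u differentiable (at x)) \<longrightarrow>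
    continuous_on UNIV (grad u) \<longrightarrow> (\<forall>x. x \<notin> S \<longrightarrow> grad u x = 0) \<longrightarrow>
    (\<integral>\<^sup>+x. ennreal \<bar>V x\<bar> * indicator S x * ennreal (\<bar>u x\<bar> powr p) \<partial>lebesgue)
      \<le> ennreal \<epsilon> * (\<integral>\<^sup>+x. ennreal (norm (grad u x) powr p) \<partial>lborel)
        + ennreal C * (\<integral>\<^sup>+x. ennreal (\<bar>u x\<bar> powr p) \<partial>lborel)"
  proof (intro exI[of _ C] conjI C(1) allI impI)
    fix u :: "real^'n \<Rightarrow> real"
    assume u: "\<forall>x. u differentiable (at x)" "continuous_on UNIV (grad u)" "\<forall>x. x \<notin> S \<longrightarrow> grad u x = 0"
    then have "continuous_on UNIV u"
      by (simp add: continuous_at_imp_continuous_on differentiable_imp_continuous_within)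
    then have [measurable]: "u \<in> borel_measurable borel" by (simp add: borel_measurable_continuous_onI)
    show "(\<integral>\<^sup>+x. ennreal \<bar>V x\<bar> * indicator S x * ennreal (\<bar>u x\<bar> powr p) \<partial>lebesgue)
      \<le> ennreal \<epsilon> * (\<integral>\<^sup>+x. ennreal (norm (grad u x) powr p) \<partial>lborel)
        + ennreal C * (\<integral>\<^sup>+x. ennreal (\<bar>u x\<bar> powr p) \<partial>lborel)"
      using C(2)[of u] u nn_integral_potential_measure[OF meas, of "\<lambda>x. ennreal (\<bar>u x\<bar> powr p)"] by simp
  qed
qed

text \<open>For \<open>p > N\<close> the Riesz kernel is integrable to the conjugate exponent
  without the help of a weight, and the total mass of \<open>|V|\<close> serves as \<open>J\<close>.
  The weight 1 is written as \<open>norm y powr (- 0)\<close> so that the power-kernel estimate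
  applies with exponent 0.\<close>

lemma form_bounded_L1:
  fixes S :: "(real^'n) set"
  assumes meas: "(\<lambda>x. ennreal \<bar>V x\<bar> * indicator S x) \<in> borel_measurable lebesgue"
    and fin: "(\<integral>\<^sup>+x\<in>S. ennreal \<bar>V x\<bar> \<partial>lebesgue) < \<infinity>"
    and p: "1 < p" "real CARD('n) < p"
  shows "form_bounded p S V"
proof -
  interpret finite_measure "potential_measure S V" by (rule finite_potential_measure[OF meas fin])
  show ?thesis
  proof (rule form_boundedI[OF meas fin p(1), where R = 1 and w = "\<lambda>y. norm y powr (- 0)"])
    show "(\<integral>\<^sup>+y. ennreal ((norm y powr (1 - real CARD('n)) * (norm y powr (- 0)) powr (- 1 / p)) powr (p / (p - 1)))
      * indicator (ball (0::real^'n) 1) y \<partial>lborel) < \<infinity>"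
      using p by (intro power_kernel_finite) auto
    fix y :: "real^'n"
    have "(\<integral>\<^sup>+x. ennreal (norm (y - x) powr (- 0)) * indicator (ball 0 1) (y - x) \<partial>potential_measure S V)
      \<le> (\<integral>\<^sup>+x. 1 \<partial>potential_measure S V)"
      by (intro nn_integral_mono) (simp split: split_indicator)
    then show "(\<integral>\<^sup>+x. ennreal (norm (y - x) powr (- 0)) * indicator (ball 0 1) (y - x) \<partial>potential_measure S V)
      \<le> ennreal (measure (potential_measure S V) (space (potential_measure S V)))"
      by (simp add: emeasure_eq_measure)
  qed auto
qed

lemma form_bounded_power:
  fixes S :: "(real^'n) set"
  assumes meas: "(\<lambda>x. ennreal \<bar>V x\<bar> * indicator S x) \<in> borel_measurable lebesgue"
    and fin: "(\<integral>\<^sup>+x\<in>S. ennreal \<bar>V x\<bar> \<partial>lebesgue) < \<infinity>"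
    and p: "1 < p" and \<theta>: "\<theta> > 0" "real CARD('n) - p < \<theta>" and M: "M \<ge> 0" and D: "D > 0"
    and m: "\<And>y r. y \<in> S \<Longrightarrow> 0 < r \<Longrightarrow> r < D \<Longrightarrow> (\<integral>\<^sup>+x\<in>ball y r \<inter> S. ennreal \<bar>V x\<bar> \<partial>lebesgue) \<le> ennreal (M * r powr \<theta>)"
  shows "form_bounded p S V"
proof -
  \<comment> \<open>\<open>R < D\<close> because the hypothesis covers radii below \<open>D\<close>
    while the dyadic estimate includes the radius \<open>R\<close> itself; \<open>R \<le> 1\<close>
    is demanded by the kernel estimate.\<close>
  define R where "R = min 1 (D / 2)"
  have R: "R > 0" "R \<le> 1" "R < D" using D by (auto simp: R_def)
  \<comment> \<open>The lower bound on \<open>s\<close> makes the kernel integrable, the upper bound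
    makes the potential of \<open>|V|\<close> bounded.\<close>
  obtain s where s: "max 0 (real CARD('n) - p) < s" "s < \<theta>" using \<theta> dense[of "max 0 (real CARD('n) - p)" \<theta>] by auto
  show ?thesis
  proof (rule form_boundedI[OF meas fin p R(1), where w = "\<lambda>y. norm y powr (- s)"])
    show "(\<integral>\<^sup>+y. ennreal ((norm y powr (1 - real CARD('n)) * (norm y powr (- s)) powr (- 1 / p)) powr (p / (p - 1)))
      * indicator (ball (0::real^'n) R) y \<partial>lborel) < \<infinity>"
      using p s R by (intro power_kernel_finite) auto
    show "(\<integral>\<^sup>+x. ennreal (norm (y - x) powr (- s)) * indicator (ball 0 R) (y - x) \<partial>potential_measure S V)
      \<le> ennreal (\<Sum>i. (R * (1/2) ^ Suc i) powr (- s) * (M * (R * (1/2) ^ i) powr \<theta>))" if "y \<in> S" for y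
      by (rule nn_integral_power_weight)
        (use R s M m that in \<open>auto simp: emeasure_potential_measure[OF meas]\<close>)
  qed auto
qed

lemma form_bounded_log:
  fixes S :: "(real^'n) set"
  assumes meas: "(\<lambda>x. ennreal \<bar>V x\<bar> * indicator S x) \<in> borel_measurable lebesgue"
    and fin: "(\<integral>\<^sup>+x\<in>S. ennreal \<bar>V x\<bar> \<partial>lebesgue) < \<infinity>"
    and N: "CARD('n) \<ge> 2" and \<beta>: "real CARD('n) - 1 < \<beta>" and M: "M \<ge> 0" and D: "D > 0"
    and m: "\<And>y r. y \<in> S \<Longrightarrow> 0 < r \<Longrightarrow> r < D \<Longrightarrow> (\<integral>\<^sup>+x\<in>ball y r \<inter> S. ennreal \<bar>V x\<bar> \<partial>lebesgue) \<le> ennreal (M * ln (D / r) powr (- \<beta>))"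
  shows "form_bounded (real CARD('n)) S V"
proof -
  \<comment> \<open>Again two thresholds: \<open>b\<close> above \<open>N - 1\<close> serves the
    kernel, \<open>b\<close> below \<beta> serves the potential.\<close>
  obtain b where b: "real CARD('n) - 1 < b" "b < \<beta>" using dense[OF \<beta>] by auto
  show ?thesis
  proof (rule form_boundedI[OF meas fin, where R = "D * exp (- 1)" and w = "\<lambda>y. ln (D / norm y) powr b"])
    show "(\<integral>\<^sup>+y. ennreal ((norm y powr (1 - real CARD('n)) * (ln (D / norm y) powr b) powr (- 1 / real CARD('n)))
      powr (real CARD('n) / (real CARD('n) - 1))) * indicator (ball (0::real^'n) (D * exp (- 1))) y \<partial>lborel) < \<infinity>"
      by (rule log_kernel_finite[OF N D b(1)])
    show "(\<integral>\<^sup>+x. ennreal (ln (D / norm (y - x)) powr b) * indicator (ball 0 (D * exp (- 1))) (y - x) \<partial>potential_measure S V)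
      \<le> ennreal (\<Sum>i. (2 ^ Suc i) powr b * (M * (2 ^ i / 2) powr (- \<beta>)))" if "y \<in> S" for y
      by (rule nn_integral_log_weight)
        (use D M m that b N in \<open>auto simp: emeasure_potential_measure[OF meas]\<close>)
    show "ln (D / norm y) powr b > 0" if "y \<noteq> 0" "norm y < D * exp (- 1)" for y :: "real^'n"
    proof -
      have "D * exp (- 1) < D" using D by simp
      then have "D / norm y > 1" using that by (simp add: less_divide_eq)
      then have "ln (D / norm y) > 0" by (rule ln_gt_zero)
      then show ?thesis by (metis less_irrefl powr_gt_zero)
    qed
  qed (use N D in auto)
qed

lemma ennreal_less_infinityE:
  assumes "x < \<infinity>" obtains M where "M \<ge> 0" "x = ennreal M"
  using assms by (cases x rule: ennreal_cases) auto

lemma ennreal_le_of_inverse_mult_le: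
  assumes "ennreal a * x \<le> ennreal M" "a > 0"
  shows "x \<le> ennreal (M / a)"
proof -
  have "ennreal (1 / a) * (ennreal a * x) \<le> ennreal (1 / a) * ennreal M"
    using assms by (intro mult_left_mono) auto
  then show ?thesis
    using assms by (simp add: mult.assoc[symmetric] ennreal_mult'[symmetric])
qed

text \<open>At diameter 0 the Morrey condition has no admissible radius and gives no information,
  but such a set has at most one point.\<close>

lemma nn_integral_diameter_0:
  fixes S :: "'a::euclidean_space set"
  assumes "bounded S" "\<not> diameter S > 0"
  shows "(\<integral>\<^sup>+x\<in>S. f x \<partial>lebesgue) = 0"
proof -
  have "x = y" if "x \<in> S" "y \<in> S" for x y
    using diameter_bounded_bound[OF assms(1) that] assms(2) by (metis dist_le_zero_iff linorder_not_less order_trans)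
  then have "S = {} \<or> (\<exists>a. S = {a})" by blast
  then have "finite S" by auto
  then have "S \<in> null_sets lebesgue"
    using finite_imp_null_set_lborel null_sets_completionI by blast
  then show ?thesis by (simp add: nn_integral_null_set)
qed

text \<open>The compact set \<open>S\<close> itself serves as \<omega> in the Morrey conditions, so
  the centres lie in \<open>S\<close> and the scale is \<open>diameter S\<close>. A positive
  diameter ensures that there are admissible radii.\<close>

lemma potential_locally_integrable_and_form_bounded:
  fixes V :: "real^'n \<Rightarrow> real"
  assumes N: "CARD('n) \<ge> 2" and p: "1 < p"
    and V1: "p \<ge> 2 \<Longrightarrow> V \<in> morrey_p_loc p \<Omega>"
    and V2: "p < 2 \<Longrightarrow> \<exists>q. ereal (real CARD('n)) < q \<and> V \<in> morrey_loc q \<Omega>"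
  shows "V \<in> borel_measurable (lebesgue_on \<Omega>)"
    and "\<And>S. compact S \<Longrightarrow> S \<subseteq> \<Omega> \<Longrightarrow> (\<integral>\<^sup>+x\<in>S. ennreal \<bar>V x\<bar> \<partial>lebesgue) < \<infinity>"
    and "\<And>S. compact S \<Longrightarrow> S \<subseteq> \<Omega> \<Longrightarrow> diameter S > 0 \<Longrightarrow> form_bounded p S V"
proof -
  let ?N = "real CARD('n)"
  consider (power) q where "p < ?N" "ereal (?N / p) < q" "V \<in> morrey_loc q \<Omega>"
    | (L1) "p > ?N" "V \<in> Lp_loc 1 \<Omega>"
    | (log) q where "p = ?N" "?N < q" "V \<in> morrey_log_loc q \<Omega>"
  proof (cases "p \<ge> 2")
    case True
    from V1[OF this] show ?thesis
      using that unfolding morrey_p_loc_def by (auto split: if_splits)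
  next
    \<comment> \<open>Here \<open>p < 2 \<le> N\<close> and \<open>q > N > N / p\<close>, so this is
      again the power case.\<close>
    case False
    then obtain q where q: "ereal ?N < q" "V \<in> morrey_loc q \<Omega>" using V2 by auto
    have "?N / p < ?N" using p N by (simp add: divide_less_eq)
    then have "ereal (?N / p) < ereal ?N" by simp
    from less_trans[OF this q(1)] have "ereal (?N / p) < q" .
    moreover have "p < ?N" using False N by simp
    ultimately show ?thesis using that(1) q by blast
  qed
  then have "V \<in> borel_measurable (lebesgue_on \<Omega>) \<and> (\<forall>S. compact S \<longrightarrow> S \<subseteq> \<Omega> \<longrightarrow>
    (\<integral>\<^sup>+x\<in>S. ennreal \<bar>V x\<bar> \<partial>lebesgue) < \<infinity> \<and> (diameter S > 0 \<longrightarrow> form_bounded p S V))"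
  proof cases
    case power
    \<comment> \<open>The growth exponent of the mass of balls. \<open>\<theta> > N - p\<close> is
      \<open>q > N / p\<close> rewritten, and \<open>q = \<infinity>\<close> gives
      \<open>\<theta> = N\<close>.\<close>
    define \<theta> where "\<theta> = ?N * real_of_ereal (1 - 1 / q)"
    have \<theta>: "?N - p < \<theta>"
    proof (cases q)
      case (real r)
      have r: "?N / p < r" using power real by simp
      then have "r > 0" using p N by (smt (verit) divide_nonneg_nonneg of_nat_0_le_iff)
      have "\<theta> = ?N * (1 - 1 / r)" using \<open>r > 0\<close> real by (simp add: \<theta>_def one_ereal_def)
      moreover have "?N / r < p" using r \<open>r > 0\<close> p by (simp add: field_simps)
      ultimately show ?thesis by (simp add: algebra_simps)
    next
      case PInf
      then show ?thesis using p by (simp add: \<theta>_def)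
    next
      case MInf
      then show ?thesis using power by simp
    qed
    have Vm: "V \<in> borel_measurable (lebesgue_on \<Omega>)" using power by (simp add: morrey_loc_def)
    have *: "(\<integral>\<^sup>+x\<in>S. ennreal \<bar>V x\<bar> \<partial>lebesgue) < \<infinity> \<and> (diameter S > 0 \<longrightarrow> form_bounded p S V)"
      if S: "compact S" "S \<subseteq> \<Omega>" for S
    proof -
      have meas: "(\<lambda>x. ennreal \<bar>V x\<bar> * indicator S x) \<in> borel_measurable lebesgue"
        using borel_measurable_restrict_indicator[OF Vm S(2)] S by (simp add: lmeasurable_compact fmeasurableD)
      have "S \<Subset> \<Omega>" using S by (simp add: compactly_contained_def compact_imp_closed)
      then have "(SUP y\<in>S. SUP r\<in>{0<..<diameter S}. ennreal (r powr (- \<theta>)) *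
          (\<integral>\<^sup>+x\<in>ball y r \<inter> S. ennreal \<bar>V x\<bar> \<partial>lebesgue)) < \<infinity>" (is "?M < \<infinity>")
        using power unfolding morrey_loc_def \<theta>_def by blast
      then obtain M where M: "M \<ge> 0" "?M = ennreal M" by (rule ennreal_less_infinityE)
      have m: "(\<integral>\<^sup>+x\<in>ball y r \<inter> S. ennreal \<bar>V x\<bar> \<partial>lebesgue) \<le> ennreal (M * r powr \<theta>)"
        if "y \<in> S" "0 < r" "r < diameter S" for y r
      proof -
        have "ennreal (r powr (- \<theta>)) * (\<integral>\<^sup>+x\<in>ball y r \<inter> S. ennreal \<bar>V x\<bar> \<partial>lebesgue) \<le> ennreal M"
          unfolding M(2)[symmetric] using that by (intro SUP_upper2[of y] SUP_upper) auto
        then have "(\<integral>\<^sup>+x\<in>ball y r \<inter> S. ennreal \<bar>V x\<bar> \<partial>lebesgue) \<le> ennreal (M / r powr (- \<theta>))"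
          using that by (intro ennreal_le_of_inverse_mult_le) auto
        then show ?thesis by (simp add: powr_minus divide_inverse)
      qed
      have fin: "(\<integral>\<^sup>+x\<in>S. ennreal \<bar>V x\<bar> \<partial>lebesgue) < \<infinity>"
      proof (cases "diameter S > 0")
        case True
        show ?thesis
        proof (rule nn_integral_finite_if_locally_finite[OF S(1) meas])
          fix y assume "y \<in> S"
          from m[OF this, of "diameter S / 2"] True
          show "\<exists>r>0. (\<integral>\<^sup>+x\<in>ball y r \<inter> S. ennreal \<bar>V x\<bar> \<partial>lebesgue) < \<infinity>"
            by (intro exI[of _ "diameter S / 2"]) (auto intro: order_le_less_trans)
        qed
      qed (simp add: nn_integral_diameter_0 compact_imp_bounded S)
      moreover have "form_bounded p S V" if "diameter S > 0"
        using form_bounded_power[OF meas fin p _ \<theta> M(1) that m] \<theta> power by simp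
      ultimately show ?thesis by blast
    qed
    show ?thesis using Vm * by blast
  next
    case L1
    then have Vm: "V \<in> borel_measurable (lebesgue_on \<Omega>)" by (simp add: Lp_loc_def)
    have "(\<integral>\<^sup>+x\<in>S. ennreal \<bar>V x\<bar> \<partial>lebesgue) < \<infinity> \<and> form_bounded p S V"
      if S: "compact S" "S \<subseteq> \<Omega>" for S
    proof -
      have meas: "(\<lambda>x. ennreal \<bar>V x\<bar> * indicator S x) \<in> borel_measurable lebesgue"
        using borel_measurable_restrict_indicator[OF Vm S(2)] S by (simp add: lmeasurable_compact fmeasurableD)
      have "set_integrable lebesgue S (\<lambda>x. norm (V x) powr 1)"
        using L1 S by (simp add: Lp_loc_def)
      then have "integrable lebesgue (\<lambda>x. indicator S x * \<bar>V x\<bar>)"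
        by (simp add: set_integrable_def)
      then have "(\<integral>\<^sup>+x. ennreal (norm (indicator S x * \<bar>V x\<bar>)) \<partial>lebesgue) < \<infinity>"
        by (simp add: integrable_iff_bounded)
      also have "(\<integral>\<^sup>+x. ennreal (norm (indicator S x * \<bar>V x\<bar>)) \<partial>lebesgue) = (\<integral>\<^sup>+x\<in>S. ennreal \<bar>V x\<bar> \<partial>lebesgue)"
        by (intro nn_integral_cong) (simp split: split_indicator)
      finally show ?thesis using form_bounded_L1[OF meas _ p] L1 by blast
    qed
    then show ?thesis using Vm by blast
  next
    case log
    define \<beta> where "\<beta> = q * (?N - 1) / ?N"
    have \<beta>: "?N - 1 < \<beta>" using log N by (simp add: \<beta>_def less_divide_eq mult.commute)
    have Vm: "V \<in> borel_measurable (lebesgue_on \<Omega>)" using log by (simp add: morrey_log_loc_def)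
    have *: "(\<integral>\<^sup>+x\<in>S. ennreal \<bar>V x\<bar> \<partial>lebesgue) < \<infinity> \<and> (diameter S > 0 \<longrightarrow> form_bounded p S V)"
      if S: "compact S" "S \<subseteq> \<Omega>" for S
    proof -
      have meas: "(\<lambda>x. ennreal \<bar>V x\<bar> * indicator S x) \<in> borel_measurable lebesgue"
        using borel_measurable_restrict_indicator[OF Vm S(2)] S by (simp add: lmeasurable_compact fmeasurableD)
      have "S \<Subset> \<Omega>" using S by (simp add: compactly_contained_def compact_imp_closed)
      then have "(SUP y\<in>S. SUP r\<in>{0<..<diameter S}. ennreal (ln (diameter S / r) powr \<beta>) *
          (\<integral>\<^sup>+x\<in>ball y r \<inter> S. ennreal \<bar>V x\<bar> \<partial>lebesgue)) < \<infinity>" (is "?M < \<infinity>")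
        using log unfolding morrey_log_loc_def \<beta>_def by blast
      then obtain M where M: "M \<ge> 0" "?M = ennreal M" by (rule ennreal_less_infinityE)
      have m: "(\<integral>\<^sup>+x\<in>ball y r \<inter> S. ennreal \<bar>V x\<bar> \<partial>lebesgue) \<le> ennreal (M * ln (diameter S / r) powr (- \<beta>))"
        if "y \<in> S" "0 < r" "r < diameter S" for y r
      proof -
        have "ennreal (ln (diameter S / r) powr \<beta>) * (\<integral>\<^sup>+x\<in>ball y r \<inter> S. ennreal \<bar>V x\<bar> \<partial>lebesgue) \<le> ennreal M"
          unfolding M(2)[symmetric] using that by (intro SUP_upper2[of y] SUP_upper) auto
        moreover have "diameter S / r > 1" using that by simp
        ultimately have "(\<integral>\<^sup>+x\<in>ball y r \<inter> S. ennreal \<bar>V x\<bar> \<partial>lebesgue) \<le> ennreal (M / ln (diameter S / r) powr \<beta>)"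
          by (intro ennreal_le_of_inverse_mult_le) auto
        then show ?thesis by (simp add: powr_minus divide_inverse)
      qed
      have fin: "(\<integral>\<^sup>+x\<in>S. ennreal \<bar>V x\<bar> \<partial>lebesgue) < \<infinity>"
      proof (cases "diameter S > 0")
        case True
        show ?thesis
        proof (rule nn_integral_finite_if_locally_finite[OF S(1) meas])
          fix y assume "y \<in> S"
          from m[OF this, of "diameter S / 2"] True
          show "\<exists>r>0. (\<integral>\<^sup>+x\<in>ball y r \<inter> S. ennreal \<bar>V x\<bar> \<partial>lebesgue) < \<infinity>"
            by (intro exI[of _ "diameter S / 2"]) (auto intro: order_le_less_trans)
        qed
      qed (simp add: nn_integral_diameter_0 compact_imp_bounded S)
      moreover have "form_bounded p S V" if "diameter S > 0"
        using form_bounded_log[OF meas fin N \<beta> M(1) that m] log by simp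
      ultimately show ?thesis by blast
    qed
    show ?thesis using Vm * by blast
  qed
  then show "V \<in> borel_measurable (lebesgue_on \<Omega>)"
    and "\<And>S. compact S \<Longrightarrow> S \<subseteq> \<Omega> \<Longrightarrow> (\<integral>\<^sup>+x\<in>S. ennreal \<bar>V x\<bar> \<partial>lebesgue) < \<infinity>"
    and "\<And>S. compact S \<Longrightarrow> S \<subseteq> \<Omega> \<Longrightarrow> diameter S > 0 \<Longrightarrow> form_bounded p S V"
    by blast+
qed

section \<open>Calculus for the quasilinear energy\<close>

lemma inner_matrix_symmetric:
  fixes M :: "real^'n^'n"
  assumes "transpose M = M"
  shows "x \<bullet> (M *v y) = y \<bullet> (M *v x)"
proof -
  have "x \<bullet> (M *v y) = (x v* M) \<bullet> y" by (simp add: dot_lmul_matrix)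
  also have "x v* M = M *v x" using vector_transpose_matrix[of x M] assms by simp
  finally show ?thesis by (simp add: inner_commute)
qed

lemma norm_mat_scaleR: "norm_mat M (c *\<^sub>R x) = \<bar>c\<bar> * norm_mat M x"
  by (simp add: norm_mat_def matrix_vector_mult_scaleR real_sqrt_mult flip: mult.assoc)

text \<open>Cauchy--Schwarz for a possibly degenerate form, read off from its nonnegativity on the
  span of \<open>x\<close> and \<open>y\<close>.\<close>

lemma norm_mat_triangle:
  fixes M :: "real^'n^'n"
  assumes sym: "transpose M = M" and psd: "\<And>\<xi>. 0 \<le> \<xi> \<bullet> (M *v \<xi>)"
  shows "norm_mat M (x + y) \<le> norm_mat M x + norm_mat M y"
proof -
  define a b c where "a = x \<bullet> (M *v x)" and "b = x \<bullet> (M *v y)" and "c = y \<bullet> (M *v y)"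
  have ac: "a \<ge> 0" "c \<ge> 0" using psd by (auto simp: a_def c_def)
  have q: "(s *\<^sub>R x + t *\<^sub>R y) \<bullet> (M *v (s *\<^sub>R x + t *\<^sub>R y)) = s\<^sup>2 * a + 2 * s * t * b + t\<^sup>2 * c" for s t
    using inner_matrix_symmetric[OF sym, of y x]
    by (simp add: a_def b_def c_def matrix_vector_right_distrib matrix_vector_mult_scaleR inner_add_left
      inner_add_right algebra_simps power2_eq_square)
  have nn: "0 \<le> s\<^sup>2 * a + 2 * s * t * b + t\<^sup>2 * c" for s t
    using psd[of "s *\<^sub>R x + t *\<^sub>R y"] by (simp add: q)
  have "b \<le> sqrt a * sqrt c"
  proof (cases "a = 0 \<or> c = 0")
    case True
    have "b \<le> 0"
    proof (rule ccontr)
      assume "\<not> b \<le> 0"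
      then have b: "b > 0" by simp
      \<comment> \<open>When one diagonal term vanishes, the form is affine in one coefficient; with
        a positive cross term the chosen coefficient would give it the value -1.\<close>
      show False using True
      proof
        assume "a = 0"
        then show False using nn[of "- (c + 1) / (2 * b)" 1] b by (simp add: field_simps)
      next
        assume "c = 0"
        then show False using nn[of 1 "- (a + 1) / (2 * b)"] b by (simp add: field_simps)
      qed
    qed
    then show ?thesis using True by auto
  next
    case False
    then have "a > 0" "c > 0" using ac by auto
    define r where "r = sqrt a * sqrt c"
    have r: "r > 0" "r * r = a * c"
      using \<open>a > 0\<close> \<open>c > 0\<close> by (auto simp: r_def real_sqrt_mult[symmetric])
    \<comment> \<open>Evaluation at \<open>s = sqrt c\<close> and \<open>t = - sqrt a\<close>, where
      both diagonal terms equal \<open>r * r\<close>.\<close>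
    have "0 \<le> 2 * r * (r - b)"
      using nn[of "sqrt c" "- sqrt a"] r ac by (simp add: r_def algebra_simps)
    then have "b \<le> r" using r by (simp add: zero_le_mult_iff)
    then show ?thesis by (simp add: r_def)
  qed
  then have "a + 2 * b + c \<le> (sqrt a + sqrt c)\<^sup>2"
    using ac by (simp add: power2_sum)
  then have "sqrt (a + 2 * b + c) \<le> sqrt a + sqrt c"
    using ac by (intro real_le_lsqrt) auto
  then show ?thesis using q[of 1 1] by (simp add: norm_mat_def a_def c_def)
qed

lemma norm_mat_nonneg: "0 \<le> \<xi> \<bullet> (M *v \<xi>) \<Longrightarrow> 0 \<le> norm_mat M \<xi>"
  by (simp add: norm_mat_def)

lemma norm_mat_zero [simp]: "norm_mat M 0 = 0"
  by (simp add: norm_mat_def)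

lemma norm_mat_le:
  assumes "\<xi> \<bullet> (M *v \<xi>) \<le> \<Lambda> * (norm \<xi>)\<^sup>2"
  shows "norm_mat M \<xi> \<le> sqrt \<Lambda> * norm \<xi>"
proof -
  have "norm_mat M \<xi> \<le> sqrt (\<Lambda> * (norm \<xi>)\<^sup>2)"
    unfolding norm_mat_def using assms by (rule real_sqrt_le_mono)
  then show ?thesis by (simp add: real_sqrt_mult)
qed

lemma norm_le_norm_mat:
  assumes "inverse \<Lambda> * (norm \<xi>)\<^sup>2 \<le> \<xi> \<bullet> (M *v \<xi>)" "\<Lambda> > 0"
  shows "norm \<xi> \<le> sqrt \<Lambda> * norm_mat M \<xi>"
proof -
  have "(norm \<xi>)\<^sup>2 \<le> \<Lambda> * (\<xi> \<bullet> (M *v \<xi>))"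
    using assms by (simp add: field_simps)
  then have "sqrt ((norm \<xi>)\<^sup>2) \<le> sqrt (\<Lambda> * (\<xi> \<bullet> (M *v \<xi>)))" by (rule real_sqrt_le_mono)
  then show ?thesis by (simp add: norm_mat_def real_sqrt_mult)
qed

lemma borel_measurable_norm_mat:
  fixes A :: "'a \<Rightarrow> real^'n^'n"
  assumes "A \<in> borel_measurable M" "g \<in> borel_measurable M"
  shows "(\<lambda>x. norm_mat (A x) (g x)) \<in> borel_measurable M"
proof (rule borel_measurable_continuous_Pair[OF assms])
  show "continuous_on UNIV (\<lambda>x :: (real^'n^'n) \<times> (real^'n). norm_mat (fst x) (snd x))"
    unfolding norm_mat_def inner_vec_def matrix_vector_mult_def
    by (auto intro!: continuous_intros)
qed

text \<open>Convexity of \<open>t \<mapsto> t\<^sup>p\<close> with the weights \<open>1 - z\<close> and \<open>z\<close> absorbs the cutoff factor \<open>1 - z\<close>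
  without any loss in front of the leading term.\<close>

lemma add_powr_le_weighted:
  fixes X Y z p :: real
  assumes p: "1 < p" and X: "0 \<le> X" and Y: "0 \<le> Y" and z: "0 < z" "z \<le> 1"
  shows "((1 - z) * X + Y) powr p \<le> (1 - z) * X powr p + z powr (1 - p) * Y powr p"
proof -
  have "((1 - z) * X + z * (Y / z)) powr p \<le> (1 - z) * X powr p + z * (Y / z) powr p"
    using convex_onD[OF powr_convex_nonneg[of p], of z X "Y / z"] assms by simp
  also have "z * (Y / z) powr p = z powr (1 - p) * Y powr p"
    using z by (simp add: powr_divide powr_diff)
  finally show ?thesis using z by simp
qed

lemma abs_powr_tendsto_0:
  assumes "0 < c" shows "((\<lambda>y::real. \<bar>y\<bar> powr c) \<longlongrightarrow> 0) (at 0)"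
  by (rule tendsto_zero_powrI[OF tendsto_rabs_zero[OF tendsto_ident_at] tendsto_const]) (use assms in auto)

text \<open>Meant for \<open>\<eta> = |\<xi>| powr a\<close>. The absolute value gives a function on
  the whole line, so the chain rule also applies where the cutoff vanishes; at 0 the difference
  quotient is at most \<open>|y| powr (a - 1)\<close> in absolute value.\<close>

lemma abs_powr_has_derivative:
  fixes t a :: real
  assumes "1 < a"
  shows "((\<lambda>t. \<bar>t\<bar> powr a) has_real_derivative (a * sgn t * \<bar>t\<bar> powr (a - 1))) (at t)"
proof -
  consider "t > 0" | "t < 0" | "t = 0" by linarith
  then show ?thesis
  proof cases
    case 1
    have "((\<lambda>t. t powr a) has_real_derivative (a * sgn t * \<bar>t\<bar> powr (a - 1))) (at t)"
      using 1 by (auto intro!: derivative_eq_intros)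
    then show ?thesis
      by (rule has_field_derivative_transform_within_open[of _ _ _ "{0<..}"]) (use 1 in auto)
  next
    case 2
    have "((\<lambda>t. (- t) powr a) has_real_derivative (a * sgn t * \<bar>t\<bar> powr (a - 1))) (at t)"
      using 2 by (auto intro!: derivative_eq_intros)
    then show ?thesis
      by (rule has_field_derivative_transform_within_open[of _ _ _ "{..<0}"]) (use 2 in auto)
  next
    case 3
    have "((\<lambda>y. \<bar>y\<bar> powr (a - 1)) \<longlongrightarrow> 0) (at (0::real))"
      using assms by (intro abs_powr_tendsto_0) simp
    then have "((\<lambda>y. (\<bar>y\<bar> powr a - \<bar>0\<bar> powr a) / (y - 0)) \<longlongrightarrow> 0) (at (0::real))"
    proof (rule Lim_null_comparison[rotated])
      show "\<forall>\<^sub>F y::real in at 0. norm ((\<bar>y\<bar> powr a - \<bar>0\<bar> powr a) / (y - 0)) \<le> \<bar>y\<bar> powr (a - 1)"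
        unfolding eventually_at_filter by (auto simp: powr_diff)
    qed
    then show ?thesis using 3 by (simp add: has_field_derivative_iff)
  qed
qed

lemma continuous_on_abs_powr_deriv:
  fixes a :: real
  assumes "1 < a"
  shows "continuous_on UNIV (\<lambda>t::real. a * sgn t * \<bar>t\<bar> powr (a - 1))"
proof -
  have "isCont (\<lambda>t::real. a * sgn t * \<bar>t\<bar> powr (a - 1)) t" for t
  proof (cases "t = 0")
    case True
    have "((\<lambda>y. a * \<bar>y\<bar> powr (a - 1)) \<longlongrightarrow> 0) (at (0::real))"
      using tendsto_mult_right_zero[OF abs_powr_tendsto_0[of "a - 1"]] assms by simp
    then have "((\<lambda>t::real. a * sgn t * \<bar>t\<bar> powr (a - 1)) \<longlongrightarrow> 0) (at 0)"
      by (rule Lim_null_comparison[rotated]) (use assms in \<open>auto simp: abs_mult sgn_if intro!: always_eventually\<close>)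
    then show ?thesis using True by (simp add: isCont_def)
  next
    case False
    then show ?thesis by (intro continuous_intros) auto
  qed
  then show ?thesis by (simp add: continuous_at_imp_continuous_on)
qed

section \<open>C^1 calculus of gradients\<close>

lemma smooth_on_C1:
  fixes f :: "real^'n \<Rightarrow> real"
  assumes "smooth_on UNIV f"
  shows "f differentiable (at x)" "continuous_on UNIV (grad f)"
proof -
  have "Ck_on 1 UNIV f" using assms by (simp add: smooth_on_def)
  then have "\<forall>x. f differentiable (at x)" "\<And>v. continuous_on UNIV (\<lambda>x. frechet_derivative f (at x) v)"
    by (auto simp: One_nat_def simp del: One_nat_def[symmetric])
  then show "f differentiable (at x)" "continuous_on UNIV (grad f)"
    unfolding grad_def by (auto intro!: continuous_on_vec_lambda)
qed

lemma grad_mult: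
  assumes "f differentiable (at x)" "g differentiable (at x)"
  shows "grad (\<lambda>x. f x * g x) x = f x *\<^sub>R grad g x + g x *\<^sub>R grad f x"
    "(\<lambda>x. f x * g x) differentiable (at x)"
proof -
  have *: "((\<lambda>x. f x * g x) has_derivative (\<lambda>v. (f x *\<^sub>R grad g x + g x *\<^sub>R grad f x) \<bullet> v)) (at x)"
    using has_derivative_mult[OF has_derivative_grad[OF assms(1)] has_derivative_grad[OF assms(2)]]
    by (simp add: inner_add_left mult.commute)
  show "grad (\<lambda>x. f x * g x) x = f x *\<^sub>R grad g x + g x *\<^sub>R grad f x" by (rule grad_eqI[OF *])
  show "(\<lambda>x. f x * g x) differentiable (at x)" using * differentiableI by blast
qed

lemma grad_compose:
  assumes "f differentiable (at x)" "(h has_real_derivative h') (at (f x))"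
  shows "grad (\<lambda>x. h (f x)) x = h' *\<^sub>R grad f x" "(\<lambda>x. h (f x)) differentiable (at x)"
proof -
  have *: "((\<lambda>x. h (f x)) has_derivative (\<lambda>v. (h' *\<^sub>R grad f x) \<bullet> v)) (at x)"
    using has_derivative_compose[OF has_derivative_grad[OF assms(1)] assms(2)[unfolded has_field_derivative_def]]
    by simp
  show "grad (\<lambda>x. h (f x)) x = h' *\<^sub>R grad f x" by (rule grad_eqI[OF *])
  show "(\<lambda>x. h (f x)) differentiable (at x)" using * differentiableI by blast
qed

lemma grad_eq_0_outside_closure:
  fixes f :: "real^'n \<Rightarrow> real"
  assumes "x \<notin> closure {x. f x \<noteq> 0}"
  shows "grad f x = 0"
proof (rule grad_eqI)
  have "((\<lambda>x. 0) has_derivative (\<lambda>v. 0 \<bullet> v)) (at x)" by simp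
  then show "(f has_derivative (\<lambda>v. 0 \<bullet> v)) (at x)"
    by (rule has_derivative_transform_within_open[of _ _ _ _ "- closure {x. f x \<noteq> 0}"])
      (use assms closure_subset[of "{x. f x \<noteq> 0}"] in auto)
qed

lemma compact_support_bounded:
  fixes f :: "'a::topological_space \<Rightarrow> 'b::real_normed_vector"
  assumes "compact S" "continuous_on UNIV f" "\<And>x. x \<notin> S \<Longrightarrow> f x = 0"
  obtains B where "B \<ge> 0" "\<And>x. norm (f x) \<le> B"
proof -
  have "compact (f ` S)"
    using continuous_on_subset[OF assms(2)] assms(1) by (intro compact_continuous_image) auto
  then have "bounded (f ` S)" by (rule compact_imp_bounded)
  then obtain B where "\<And>x. x \<in> S \<Longrightarrow> norm (f x) \<le> B" by (auto simp: bounded_iff)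
  then show ?thesis using that[of "max 0 B"] assms(3) by (metis max.cobounded1 max.coboundedI2 norm_zero)
qed

section \<open>Energy of test functions\<close>

text \<open>\<open>\<zeta> = \<xi>\<^sup>m\<close> for a smooth cutoff \<open>\<xi>\<close> and \<open>m \<ge> 2 p\<close>, so that \<open>\<nabla>\<zeta>\<close> vanishes to high order where \<open>\<zeta>\<close>
  does and \<open>\<xi>\<^sup>m\<^sup>/\<^sup>p\<close> is still \<open>C\<^sup>1\<close>.\<close>

lemma power_cutoff:
  fixes K L :: "(real^'n) set"
  assumes p: "1 < p" and K: "compact K" "K \<subseteq> interior L"
  obtains \<zeta> \<eta> :: "real^'n \<Rightarrow> real" and N C where
    "smooth_on UNIV \<zeta>" "\<And>x. 0 \<le> \<zeta> x" "\<And>x. \<zeta> x \<le> 1" "open N" "K \<subseteq> N" "\<And>x. x \<in> N \<Longrightarrow> \<zeta> x = 1"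
    "\<And>x. x \<notin> L \<Longrightarrow> \<zeta> x = 0" "\<And>x. x \<notin> L \<Longrightarrow> grad \<zeta> x = 0"
    "C \<ge> 0" "\<And>x. norm (grad \<zeta> x) powr p \<le> C * \<zeta> x powr (p - 1)"
    "\<And>x. \<eta> differentiable (at x)" "continuous_on UNIV (grad \<eta>)" "\<And>x. 0 \<le> \<eta> x"
    "\<And>x. \<eta> x powr p = \<zeta> x" "\<And>x. x \<notin> L \<Longrightarrow> grad \<eta> x = 0" "\<And>x. norm (grad \<eta> x) powr p \<le> C"
proof -
  obtain \<xi> :: "real^'n \<Rightarrow> real" and N where \<xi>: "smooth_on UNIV \<xi>" "\<And>x. 0 \<le> \<xi> x" "\<And>x. \<xi> x \<le> 1"
    "open N" "K \<subseteq> N" "\<And>x. x \<in> N \<Longrightarrow> \<xi> x = 1" "{x. \<xi> x \<noteq> 0} \<Subset> interior L"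
    using smooth_cutoff[OF K(1) open_interior K(2)] by blast
  note C1 = smooth_on_C1[OF \<xi>(1)]
  have cl: "compact (closure {x. \<xi> x \<noteq> 0})" "closure {x. \<xi> x \<noteq> 0} \<subseteq> L"
    using \<xi>(7) interior_subset[of L] by (auto simp: compactly_contained_def)
  have \<xi>0: "\<xi> x = 0" "grad \<xi> x = 0" if "x \<notin> L" for x
    using that cl(2) closure_subset[of "{x. \<xi> x \<noteq> 0}"] grad_eq_0_outside_closure[of x \<xi>] by auto
  obtain B where B: "B \<ge> 0" "\<And>x. norm (grad \<xi> x) \<le> B"
    using compact_support_bounded[OF cl(1) C1(2)] grad_eq_0_outside_closure[of _ \<xi>] by metis
  define m where "m = nat \<lceil>2 * p\<rceil>"
  have m: "real m \<ge> 2 * p" by (simp add: m_def) linarith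
  then have m2: "real m \<ge> 2" using p by linarith
  then have "m \<ge> 2" by simp
  define a where "a = real m / p"
  have a: "a \<ge> 2" "a * p = m" using m p by (auto simp: a_def le_divide_eq)
  define \<zeta> where "\<zeta> x = \<xi> x ^ m" for x
  define \<eta> where "\<eta> x = \<bar>\<xi> x\<bar> powr a" for x
  define C where "C = (real m * B) powr p + (a * B) powr p"
  have g\<zeta>: "grad \<zeta> x = (real m * \<xi> x ^ (m - 1)) *\<^sub>R grad \<xi> x" for x
    unfolding \<zeta>_def[abs_def]
    by (rule grad_compose(1)[OF C1(1)]) (auto intro!: derivative_eq_intros)
  have g\<eta>: "grad \<eta> x = (a * sgn (\<xi> x) * \<bar>\<xi> x\<bar> powr (a - 1)) *\<^sub>R grad \<xi> x" "\<eta> differentiable (at x)" for x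
    unfolding \<eta>_def[abs_def]
    using grad_compose[OF C1(1) abs_powr_has_derivative[of a]] a by auto
  show ?thesis
  proof (rule that)
    show "smooth_on UNIV \<zeta>" unfolding \<zeta>_def[abs_def] by (rule smooth_on_power[OF \<xi>(1)])
    show "0 \<le> \<zeta> x" for x by (simp add: \<zeta>_def \<xi>)
    show "\<zeta> x \<le> 1" for x by (simp add: \<zeta>_def \<xi> power_le_one)
    show "open N" "K \<subseteq> N" by fact+
    show "\<zeta> x = 1" if "x \<in> N" for x using \<xi>(6)[OF that] by (simp add: \<zeta>_def)
    show "\<zeta> x = 0" "grad \<zeta> x = 0" "grad \<eta> x = 0" if "x \<notin> L" for x
      using \<xi>0[OF that] \<open>m \<ge> 2\<close> by (auto simp: g\<zeta> g\<eta>) (simp add: \<zeta>_def)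
    show "C \<ge> 0" by (simp add: C_def)
    show "norm (grad \<zeta> x) powr p \<le> C * \<zeta> x powr (p - 1)" for x
    proof (cases "\<xi> x = 0")
      case True
      then show ?thesis using \<open>m \<ge> 2\<close> by (simp add: g\<zeta> \<zeta>_def power_0_left)
    next
      case False
      then have pos: "\<xi> x > 0" using \<xi>(2)[of x] by simp
      have "norm (grad \<zeta> x) powr p = (real m * norm (grad \<xi> x)) powr p * (\<xi> x ^ (m - 1)) powr p"
        using pos by (simp add: g\<zeta> powr_mult abs_mult mult_ac)
      also have "\<dots> \<le> (real m * B) powr p * (\<xi> x ^ m) powr (p - 1)"
      proof (rule mult_mono)
        show "(real m * norm (grad \<xi> x)) powr p \<le> (real m * B) powr p"
          using B p by (intro powr_mono2 mult_left_mono) auto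
        have "(\<xi> x ^ (m - 1)) powr p = \<xi> x powr (real (m - 1) * p)"
          using pos by (simp add: powr_realpow[symmetric] powr_powr)
        \<comment> \<open>\<open>(m - 1) p \<ge> m (p - 1)\<close> amounts to
          \<open>m \<ge> p\<close>, and the base is at most 1.\<close>
        also have "\<dots> \<le> \<xi> x powr (real m * (p - 1))"
          using \<xi>(3)[of x] pos m p \<open>m \<ge> 2\<close> by (intro powr_mono') (auto simp: of_nat_diff algebra_simps)
        also have "\<dots> = (\<xi> x ^ m) powr (p - 1)"
          using pos by (simp add: powr_realpow[symmetric] powr_powr)
        finally show "(\<xi> x ^ (m - 1)) powr p \<le> (\<xi> x ^ m) powr (p - 1)" .
      qed auto
      also have "\<dots> \<le> C * \<zeta> x powr (p - 1)"
        unfolding \<zeta>_def C_def by (intro mult_right_mono) auto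
      finally show ?thesis .
    qed
    show "\<eta> differentiable (at x)" for x by (rule g\<eta>)
    have "grad \<eta> = (\<lambda>x. (a * sgn (\<xi> x) * \<bar>\<xi> x\<bar> powr (a - 1)) *\<^sub>R grad \<xi> x)" using g\<eta> by auto
    moreover have "continuous_on UNIV (\<lambda>x. (a * sgn (\<xi> x) * \<bar>\<xi> x\<bar> powr (a - 1)) *\<^sub>R grad \<xi> x)"
      by (intro continuous_on_scaleR C1 continuous_on_compose2[OF continuous_on_abs_powr_deriv smooth_on_continuous[OF \<xi>(1)]])
        (use a in auto)
    ultimately show "continuous_on UNIV (grad \<eta>)" by simp
    show "0 \<le> \<eta> x" for x by (simp add: \<eta>_def)
    show "\<eta> x powr p = \<zeta> x" for x
    proof (cases "\<xi> x = 0")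
      case True
      then show ?thesis using \<open>m \<ge> 2\<close> by (simp add: \<eta>_def \<zeta>_def)
    next
      case False
      then have pos: "\<xi> x > 0" using \<xi>(2)[of x] by simp
      then show ?thesis by (simp add: \<eta>_def \<zeta>_def powr_powr a powr_realpow)
    qed
    show "norm (grad \<eta> x) powr p \<le> C" for x
    proof -
      have "\<bar>\<xi> x\<bar> powr (a - 1) \<le> 1 powr (a - 1)"
        using \<xi>(2,3)[of x] a by (intro powr_mono2) auto
      moreover have "\<bar>sgn (\<xi> x)\<bar> \<le> 1" by (simp add: sgn_if)
      ultimately have "\<bar>sgn (\<xi> x)\<bar> * \<bar>\<xi> x\<bar> powr (a - 1) \<le> 1" by (simp add: mult_le_one)
      then have "a * (\<bar>sgn (\<xi> x)\<bar> * \<bar>\<xi> x\<bar> powr (a - 1)) * norm (grad \<xi> x) \<le> a * 1 * B"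
        using a B by (intro mult_mono) auto
      then have "norm (grad \<eta> x) \<le> a * B"
        using a by (simp add: g\<eta> abs_mult mult_ac)
      then have "norm (grad \<eta> x) powr p \<le> (a * B) powr p" using p by (intro powr_mono2) auto
      also have "\<dots> \<le> C" by (simp add: C_def)
      finally show ?thesis .
    qed
  qed
qed

text \<open>Splitting \<open>Q_form\<close> requires each piece to be integrable. The dominating
  \<open>g\<close> is 1 for gradient terms and \<open>V\<close> for potential terms.\<close>

lemma set_integrable_compact_support:
  fixes f g :: "'a::euclidean_space \<Rightarrow> real"
  assumes \<Omega>: "\<Omega> \<in> sets lebesgue" and f: "f \<in> borel_measurable (lebesgue_on \<Omega>)"
    and S: "S \<subseteq> \<Omega>" "\<And>x. x \<in> \<Omega> \<Longrightarrow> x \<notin> S \<Longrightarrow> f x = 0"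
    and B: "B \<ge> 0" "\<And>x. x \<in> S \<Longrightarrow> \<bar>f x\<bar> \<le> B * \<bar>g x\<bar>"
    and g: "(\<lambda>x. ennreal \<bar>g x\<bar> * indicator S x) \<in> borel_measurable lebesgue"
      "(\<integral>\<^sup>+x\<in>S. ennreal \<bar>g x\<bar> \<partial>lebesgue) < \<infinity>"
  shows "set_integrable lebesgue \<Omega> f"
  unfolding set_integrable_def
proof (rule integrableI_bounded)
  show "(\<lambda>x. indicator \<Omega> x *\<^sub>R f x) \<in> borel_measurable lebesgue"
    using f \<Omega> by (subst (asm) borel_measurable_restrict_space_iff) auto
  have "(\<integral>\<^sup>+x. ennreal (norm (indicator \<Omega> x *\<^sub>R f x)) \<partial>lebesgue) \<le> (\<integral>\<^sup>+x. ennreal B * (ennreal \<bar>g x\<bar> * indicator S x) \<partial>lebesgue)"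
  proof (rule nn_integral_mono)
    fix x
    show "ennreal (norm (indicator \<Omega> x *\<^sub>R f x)) \<le> ennreal B * (ennreal \<bar>g x\<bar> * indicator S x)"
    proof (cases "x \<in> S")
      case True
      then show ?thesis using S B(2)[OF True] B(1) by (auto simp: ennreal_mult[symmetric] ennreal_leI)
    next
      case False
      then show ?thesis using S(2)[of x] by (cases "x \<in> \<Omega>") auto
    qed
  qed
  also have "\<dots> = ennreal B * (\<integral>\<^sup>+x\<in>S. ennreal \<bar>g x\<bar> \<partial>lebesgue)"
    by (rule nn_integral_cmult[OF g(1)])
  also have "\<dots> < \<infinity>" using g(2) by (simp add: ennreal_mult_less_top)
  finally show "(\<integral>\<^sup>+x. ennreal (norm (indicator \<Omega> x *\<^sub>R f x)) \<partial>lebesgue) < \<infinity>" .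
qed

text \<open>\<open>1 - (1 - z)^p \<le> n z\<close> makes the change of the potential term
  proportional to the cutoff, so the gradient gain, which carries the same factor, can absorb it.
  The integer \<open>n\<close> is there because Bernoulli's inequality is applied to a natural
  exponent.\<close>

lemma Bernoulli_powr:
  fixes z p :: real
  assumes "0 \<le> z" "z \<le> 1" "0 < p" "p \<le> real n"
  shows "1 - real n * z \<le> (1 - z) powr p" "(1 - z) powr p \<le> 1"
proof -
  have n: "n > 0" using assms by (cases n) auto
  have "1 + real n * (- z) \<le> (1 + (- z)) ^ n" using assms by (intro Bernoulli_inequality) auto
  also have "\<dots> \<le> (1 - z) powr p"
  proof (cases "z = 1")
    case False
    then have "(1 - z) ^ n = (1 - z) powr real n" using assms by (simp add: powr_realpow)
    also have "\<dots> \<le> (1 - z) powr p" using assms by (intro powr_mono') auto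
    finally show ?thesis by simp
  qed (use n in \<open>simp add: zero_power\<close>)
  finally show "1 - real n * z \<le> (1 - z) powr p" by simp
  show "(1 - z) powr p \<le> 1" using assms powr_mono2[of p "1 - z" 1] by simp
qed

lemma compact_sets_lebesgue: "compact (S::'a::euclidean_space set) \<Longrightarrow> S \<in> sets lebesgue"
  by (simp add: lmeasurable_compact fmeasurableD)

section \<open>The energy under multiplication by a cutoff\<close>

text \<open>Of the conditions on \<open>V\<close> only measurability and local integrability enter
  here, enough to split integrals; form boundedness is supplied separately, for a single compact
  set.\<close>

locale quasilinear_form =
  fixes \<Omega> :: "(real^'n) set" and A :: "real^'n \<Rightarrow> real^'n^'n" and V :: "real^'n \<Rightarrow> real" and p :: real
  assumes open_\<Omega>: "open \<Omega>" and p: "1 < p"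
    and A_meas: "A \<in> borel_measurable (lebesgue_on \<Omega>)"
    and A_sym: "\<And>x. x \<in> \<Omega> \<Longrightarrow> transpose (A x) = A x"
    and elliptic: "locally_elliptic \<Omega> A"
    and V_meas: "V \<in> borel_measurable (lebesgue_on \<Omega>)"
    and V_int: "\<And>S. compact S \<Longrightarrow> S \<subseteq> \<Omega> \<Longrightarrow> (\<integral>\<^sup>+x\<in>S. ennreal \<bar>V x\<bar> \<partial>lebesgue) < \<infinity>"
begin

lemma \<Omega>_sets: "\<Omega> \<in> sets lebesgue"
  using open_\<Omega> by simp

lemma elliptic_compact:
  assumes "compact S" "S \<subseteq> \<Omega>"
  obtains \<Lambda> where "\<Lambda> > 0" "\<And>x \<xi>. x \<in> S \<Longrightarrow> inverse \<Lambda> * (norm \<xi>)\<^sup>2 \<le> \<xi> \<bullet> (A x *v \<xi>)"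
    "\<And>x \<xi>. x \<in> S \<Longrightarrow> \<xi> \<bullet> (A x *v \<xi>) \<le> \<Lambda> * (norm \<xi>)\<^sup>2"
proof -
  have "S \<Subset> \<Omega>" using assms by (simp add: compactly_contained_def compact_imp_closed)
  then show ?thesis using elliptic that unfolding locally_elliptic_def by meson
qed

lemma A_psd: "x \<in> \<Omega> \<Longrightarrow> 0 \<le> \<xi> \<bullet> (A x *v \<xi>)"
proof -
  assume "x \<in> \<Omega>"
  then have "{x} \<Subset> \<Omega>" by (simp add: compactly_contained_def)
  then obtain \<Lambda> where "\<Lambda> > 0" "\<forall>y\<in>{x}. \<forall>\<xi>. inverse \<Lambda> * (norm \<xi>)\<^sup>2 \<le> \<xi> \<bullet> (A y *v \<xi>)"
    using elliptic unfolding locally_elliptic_def by meson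
  then have "inverse \<Lambda> * (norm \<xi>)\<^sup>2 \<le> \<xi> \<bullet> (A x *v \<xi>)" "0 \<le> inverse \<Lambda> * (norm \<xi>)\<^sup>2" by auto
  then show ?thesis by linarith
qed

lemma A_norm_nonneg: "x \<in> \<Omega> \<Longrightarrow> 0 \<le> norm_mat (A x) \<xi>"
  using A_psd norm_mat_nonneg by blast

lemma test_fun_bounded_support:
  assumes "\<phi> \<in> test_fun \<Omega>"
  obtains S B where "compact S" "S \<subseteq> \<Omega>" "\<And>x. x \<notin> S \<Longrightarrow> \<phi> x = 0" "\<And>x. x \<notin> S \<Longrightarrow> grad \<phi> x = 0"
    "B \<ge> 0" "\<And>x. \<bar>\<phi> x\<bar> \<le> B" "\<And>x. norm (grad \<phi> x) \<le> B"
proof -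
  let ?S = "closure {x. \<phi> x \<noteq> 0}"
  have s: "smooth_on UNIV \<phi>" and S: "compact ?S" "?S \<subseteq> \<Omega>"
    using assms by (auto simp: test_fun_def compactly_contained_def)
  have 0: "\<phi> x = 0" "grad \<phi> x = 0" if "x \<notin> ?S" for x
    using that closure_subset[of "{x. \<phi> x \<noteq> 0}"] grad_eq_0_outside_closure[of x \<phi>] by auto
  obtain B1 where B1: "B1 \<ge> 0" "\<And>x. norm (\<phi> x) \<le> B1"
    using compact_support_bounded[OF S(1) smooth_on_continuous[OF s] 0(1)] by blast
  obtain B2 where B2: "B2 \<ge> 0" "\<And>x. norm (grad \<phi> x) \<le> B2"
    using compact_support_bounded[OF S(1) smooth_on_C1(2)[OF s] 0(2)] by blast
  show ?thesis
  proof (rule that[of ?S "max B1 B2"])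
    show "\<bar>\<phi> x\<bar> \<le> max B1 B2" for x using B1(2)[of x] by simp
    show "norm (grad \<phi> x) \<le> max B1 B2" for x using B2(2)[of x] by simp
    show "0 \<le> max B1 B2" using B1(1) by simp
  qed (fact S 0)+
qed

lemma continuous_measurable_on: "continuous_on UNIV (f :: real^'n \<Rightarrow> 'b::topological_space) \<Longrightarrow> f \<in> borel_measurable (lebesgue_on \<Omega>)"
  by (intro measurable_restrict_space1 measurable_completion) (simp add: borel_measurable_continuous_onI)

text \<open>The factor \<open>c\<close> allows one proof for the full energy, \<open>c = 1\<close>,
  and for the part gained by the cutoff, \<open>c = \<zeta>\<close>.\<close>

lemma energy_integrable:
  assumes \<phi>: "\<phi> \<in> test_fun \<Omega>" and c: "c \<in> borel_measurable borel" "\<And>x. \<bar>c x\<bar> \<le> 1"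
  shows "set_integrable lebesgue \<Omega> (\<lambda>x. c x * norm_mat (A x) (grad \<phi> x) powr p)"
proof -
  have s: "smooth_on UNIV \<phi>" using \<phi> by (simp add: test_fun_def)
  obtain S B where S: "compact S" "S \<subseteq> \<Omega>" "\<And>x. x \<notin> S \<Longrightarrow> grad \<phi> x = 0"
    and B: "B \<ge> 0" "\<And>x. norm (grad \<phi> x) \<le> B"
    using test_fun_bounded_support[OF \<phi>] by metis
  obtain \<Lambda> where \<Lambda>: "\<Lambda> > 0" "\<And>x \<xi>. x \<in> S \<Longrightarrow> \<xi> \<bullet> (A x *v \<xi>) \<le> \<Lambda> * (norm \<xi>)\<^sup>2"
    using elliptic_compact[OF S(1,2)] by metis
  have [measurable]: "(\<lambda>x. norm_mat (A x) (grad \<phi> x)) \<in> borel_measurable (lebesgue_on \<Omega>)"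
    by (intro borel_measurable_norm_mat A_meas continuous_measurable_on smooth_on_C1[OF s])
  have [measurable]: "c \<in> borel_measurable (lebesgue_on \<Omega>)"
    using c by (intro measurable_restrict_space1 measurable_completion) simp
  show ?thesis
  proof (rule set_integrable_compact_support[OF \<Omega>_sets _ S(2), where g = "\<lambda>x. 1"])
    show "(\<lambda>x. c x * norm_mat (A x) (grad \<phi> x) powr p) \<in> borel_measurable (lebesgue_on \<Omega>)" by measurable
    show "\<bar>c x * norm_mat (A x) (grad \<phi> x) powr p\<bar> \<le> (sqrt \<Lambda> * B) powr p * \<bar>1\<bar>" if "x \<in> S" for x
    proof -
      have "norm_mat (A x) (grad \<phi> x) \<le> sqrt \<Lambda> * norm (grad \<phi> x)" by (rule norm_mat_le[OF \<Lambda>(2)[OF that]])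
      also have "\<dots> \<le> sqrt \<Lambda> * B" using \<Lambda> B by (intro mult_left_mono) auto
      finally have "norm_mat (A x) (grad \<phi> x) powr p \<le> (sqrt \<Lambda> * B) powr p"
        using A_norm_nonneg S that p by (intro powr_mono2) auto
      then have "\<bar>c x\<bar> * norm_mat (A x) (grad \<phi> x) powr p \<le> 1 * (sqrt \<Lambda> * B) powr p"
        using c by (intro mult_mono) auto
      then show ?thesis by (simp add: abs_mult)
    qed
    show "(\<integral>\<^sup>+ x\<in>S. ennreal \<bar>1\<bar> \<partial>lebesgue) < \<infinity>"
      using S(1) lmeasurable_compact[OF S(1)]
      by (simp add: compact_sets_lebesgue fmeasurable_def del: emeasure_completion)
    show "(\<lambda>x. ennreal \<bar>1\<bar> * indicator S x) \<in> borel_measurable lebesgue"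
      using S(1) by (auto intro!: borel_measurable_indicator compact_sets_lebesgue)
  qed (use S in auto)
qed

text \<open>\<open>v\<close> stands for \<open>V\<close> in the energy and for \<open>|V|\<close> in
  the error term.\<close>

lemma potential_integrable:
  assumes \<phi>: "\<phi> \<in> test_fun \<Omega>" and c: "c \<in> borel_measurable borel" "\<And>x. \<bar>c x\<bar> \<le> 1"
    and v: "v \<in> borel_measurable (lebesgue_on \<Omega>)" "\<And>x. \<bar>v x\<bar> \<le> \<bar>V x\<bar>"
  shows "set_integrable lebesgue \<Omega> (\<lambda>x. v x * (c x * \<bar>\<phi> x\<bar> powr p))"
proof -
  have s: "smooth_on UNIV \<phi>" using \<phi> by (simp add: test_fun_def)
  obtain S B where S: "compact S" "S \<subseteq> \<Omega>" "\<And>x. x \<notin> S \<Longrightarrow> \<phi> x = 0"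
    and B: "B \<ge> 0" "\<And>x. \<bar>\<phi> x\<bar> \<le> B"
    using test_fun_bounded_support[OF \<phi>] by metis
  have [measurable]: "\<phi> \<in> borel_measurable (lebesgue_on \<Omega>)"
    by (intro continuous_measurable_on smooth_on_continuous[OF s])
  have [measurable]: "c \<in> borel_measurable (lebesgue_on \<Omega>)"
    using c by (intro measurable_restrict_space1 measurable_completion) simp
  note v(1)[measurable]
  show ?thesis
  proof (rule set_integrable_compact_support[OF \<Omega>_sets _ S(2), where g = V])
    show "(\<lambda>x. v x * (c x * \<bar>\<phi> x\<bar> powr p)) \<in> borel_measurable (lebesgue_on \<Omega>)" by measurable
    show "\<bar>v x * (c x * \<bar>\<phi> x\<bar> powr p)\<bar> \<le> B powr p * \<bar>V x\<bar>" if "x \<in> S" for x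
    proof -
      have "\<bar>\<phi> x\<bar> powr p \<le> B powr p" using B p by (intro powr_mono2) auto
      then have "\<bar>c x\<bar> * \<bar>\<phi> x\<bar> powr p \<le> 1 * B powr p" using c by (intro mult_mono) auto
      then have "\<bar>v x\<bar> * (\<bar>c x\<bar> * \<bar>\<phi> x\<bar> powr p) \<le> \<bar>V x\<bar> * (1 * B powr p)"
        by (rule mult_mono[OF v(2)]) auto
      then show ?thesis by (simp add: abs_mult mult_ac)
    qed
    show "(\<lambda>x. ennreal \<bar>V x\<bar> * indicator S x) \<in> borel_measurable lebesgue"
      using S(1,2) by (intro borel_measurable_restrict_indicator[OF V_meas]) (auto simp: compact_sets_lebesgue)
    show "(\<integral>\<^sup>+ x\<in>S. ennreal \<bar>V x\<bar> \<partial>lebesgue) < \<infinity>" using V_int S by blast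
  qed (use S in auto)
qed

text \<open>The factor vanishes on an open \<open>N\<close> and not merely on \<open>K\<close>: then
  the closure of the support misses \<open>N\<close>, and the product is admissible in the
  inequality on \<open>\<Omega> - K\<close>.\<close>

lemma test_fun_mult:
  assumes "\<phi> \<in> test_fun \<Omega>" "smooth_on UNIV c" "open N" "\<And>x. x \<in> N \<Longrightarrow> c x = 0" "K \<subseteq> N"
  shows "(\<lambda>x. c x * \<phi> x) \<in> test_fun (\<Omega> - K)" "(\<lambda>x. c x * \<phi> x) \<in> test_fun \<Omega>"
proof -
  have s: "smooth_on UNIV (\<lambda>x. c x * \<phi> x)" using assms by (intro smooth_on_mult) (auto simp: test_fun_def)
  have cl: "closure {x. c x * \<phi> x \<noteq> 0} \<subseteq> closure {x. \<phi> x \<noteq> 0}" by (intro closure_mono) auto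
  have \<phi>: "compact (closure {x. \<phi> x \<noteq> 0})" "closure {x. \<phi> x \<noteq> 0} \<subseteq> \<Omega>"
    using assms(1) by (auto simp: test_fun_def compactly_contained_def)
  have "compact (closure {x. c x * \<phi> x \<noteq> 0})"
    using compact_Int_closed[OF \<phi>(1) closed_closure[of "{x. c x * \<phi> x \<noteq> 0}"]] cl by (simp add: Int_absorb1)
  moreover have "closure {x. c x * \<phi> x \<noteq> 0} \<subseteq> - N"
    using assms by (intro closure_minimal) auto
  ultimately show "(\<lambda>x. c x * \<phi> x) \<in> test_fun (\<Omega> - K)" "(\<lambda>x. c x * \<phi> x) \<in> test_fun \<Omega>"
    using s cl \<phi> assms(5) unfolding test_fun_def compactly_contained_def by blast+
qed

end

context quasilinear_form
begin

text \<open>Replacing \<open>\<phi>\<close> by \<open>(1 - \<zeta>) \<phi>\<close> gains \<open>- \<integral> \<zeta> |\<nabla>\<phi>|\<^sub>A\<^sup>p\<close> by convexity, and this gain pays for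
  \<open>\<integral> |V| \<zeta> \<phi>\<^sup>p\<close> by the form boundedness applied to \<open>\<zeta>\<^sup>1\<^sup>/\<^sup>p \<phi>\<close>.\<close>

lemma energy_cutoff_estimate:
  fixes L :: "(real^'n) set" and \<zeta> \<eta> :: "real^'n \<Rightarrow> real"
  assumes L: "compact L" "L \<subseteq> \<Omega>" and fb: "form_bounded p L V"
    and \<zeta>: "smooth_on UNIV \<zeta>" "\<And>x. 0 \<le> \<zeta> x" "\<And>x. \<zeta> x \<le> 1"
      "\<And>x. x \<notin> L \<Longrightarrow> \<zeta> x = 0" "\<And>x. x \<notin> L \<Longrightarrow> grad \<zeta> x = 0"
    and C0: "C0 \<ge> 0" "\<And>x. norm (grad \<zeta> x) powr p \<le> C0 * \<zeta> x powr (p - 1)"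
    and \<eta>: "\<And>x. \<eta> differentiable (at x)" "continuous_on UNIV (grad \<eta>)" "\<And>x. 0 \<le> \<eta> x"
      "\<And>x. \<eta> x powr p = \<zeta> x" "\<And>x. x \<notin> L \<Longrightarrow> grad \<eta> x = 0" "\<And>x. norm (grad \<eta> x) powr p \<le> C0"
  shows "\<exists>C\<ge>0. \<forall>\<phi>\<in>test_fun \<Omega>. (\<forall>x. 0 \<le> \<phi> x) \<longrightarrow>
    (\<lambda>x. (1 - \<zeta> x) * \<phi> x) \<in> test_fun \<Omega> \<longrightarrow>
    Q_form A V p \<Omega> (\<lambda>x. (1 - \<zeta> x) * \<phi> x) \<le> Q_form A V p \<Omega> \<phi> + C * (LINT x:L|lebesgue. \<phi> x powr p)"
proof -
  obtain \<Lambda> where \<Lambda>: "\<Lambda> > 0" "\<And>x \<xi>. x \<in> L \<Longrightarrow> inverse \<Lambda> * (norm \<xi>)\<^sup>2 \<le> \<xi> \<bullet> (A x *v \<xi>)"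
    "\<And>x \<xi>. x \<in> L \<Longrightarrow> \<xi> \<bullet> (A x *v \<xi>) \<le> \<Lambda> * (norm \<xi>)\<^sup>2"
    using elliptic_compact[OF L] by metis
  define \<tau> where "\<tau> = sqrt \<Lambda> powr p"
  have \<tau>: "\<tau> > 0" using \<Lambda> by (simp add: \<tau>_def)
  obtain n :: nat where n: "p \<le> real n" using real_arch_simple by blast
  then have n0: "real n > 0" using p by linarith
  \<comment> \<open>Tuned so that \<open>n\<close> times the potential error costs exactly one copy
    of the gain \<open>E\<close>: \<open>2 powr (p - 1)\<close> comes from splitting the gradient of
    a product, and \<tau> from comparing the Euclidean norm with that of \<open>A\<close>.\<close>
  define \<epsilon> where "\<epsilon> = 1 / (real n * 2 powr (p - 1) * \<tau>)"
  have \<epsilon>: "\<epsilon> > 0" using n0 \<tau> by (simp add: \<epsilon>_def)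
  obtain C1 where C1: "C1 > 0" "\<And>u. (\<And>x. u differentiable (at x)) \<Longrightarrow> continuous_on UNIV (grad u) \<Longrightarrow>
    (\<And>x. x \<notin> L \<Longrightarrow> grad u x = 0) \<Longrightarrow>
    (\<integral>\<^sup>+x. ennreal \<bar>V x\<bar> * indicator L x * ennreal (\<bar>u x\<bar> powr p) \<partial>lebesgue)
      \<le> ennreal \<epsilon> * (\<integral>\<^sup>+x. ennreal (norm (grad u x) powr p) \<partial>lborel)
        + ennreal C1 * (\<integral>\<^sup>+x. ennreal (\<bar>u x\<bar> powr p) \<partial>lborel)"
    using form_boundedE[OF fb \<epsilon>] by blast
  define C where "C = \<tau> * C0 + real n * (\<epsilon> * 2 powr (p - 1) * C0 + C1)"
  show ?thesis
  proof (intro exI[of _ C] conjI ballI impI)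
    show "C \<ge> 0" using \<tau> C0 n0 \<epsilon> C1 by (simp add: C_def)
    fix \<phi> assume \<phi>: "\<phi> \<in> test_fun \<Omega>" "\<forall>x. 0 \<le> \<phi> x" and \<psi>: "(\<lambda>x. (1 - \<zeta> x) * \<phi> x) \<in> test_fun \<Omega>"
    have s\<phi>: "smooth_on UNIV \<phi>" using \<phi> by (simp add: test_fun_def)
    note \<phi> = \<phi>(1) \<phi>(2)[rule_format]
    note C1\<phi> = smooth_on_C1[OF s\<phi>] and C1\<zeta> = smooth_on_C1[OF \<zeta>(1)]
    define X where "X x = norm_mat (A x) (grad \<phi> x) powr p" for x
    \<comment> \<open>\<open>E\<close> is the gradient gain, \<open>T\<close> the potential error it
      has to absorb, and \<open>P\<close> the lower-order mass that remains.\<close>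
    define E where "E = (LINT x:\<Omega>|lebesgue. \<zeta> x * X x)"
    define T where "T = (LINT x:\<Omega>|lebesgue. \<bar>V x\<bar> * (\<zeta> x * \<phi> x powr p))"
    define P where "P = (LINT x:L|lebesgue. \<phi> x powr p)"
    have L_borel[measurable]: "L \<in> sets borel" using L(1) by (simp add: compact_imp_closed borel_closed)
    have \<zeta>m[measurable]: "\<zeta> \<in> borel_measurable borel" and \<phi>m[measurable]: "\<phi> \<in> borel_measurable borel"
      using smooth_on_continuous[OF \<zeta>(1)] smooth_on_continuous[OF s\<phi>]
      by (simp_all add: borel_measurable_continuous_onI)
    have iX: "set_integrable lebesgue \<Omega> X"
      using energy_integrable[OF \<phi>(1), of "\<lambda>_. 1"] by (simp add: X_def[abs_def])
    have iE: "set_integrable lebesgue \<Omega> (\<lambda>x. \<zeta> x * X x)"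
      using energy_integrable[OF \<phi>(1), of \<zeta>] \<zeta> by (simp add: X_def[abs_def])
    have iV: "set_integrable lebesgue \<Omega> (\<lambda>x. V x * \<bar>\<phi> x\<bar> powr p)"
      using potential_integrable[OF \<phi>(1), of "\<lambda>_. 1" V] V_meas by simp
    have iT: "set_integrable lebesgue \<Omega> (\<lambda>x. \<bar>V x\<bar> * (\<zeta> x * \<phi> x powr p))"
      using potential_integrable[OF \<phi>(1), of \<zeta> "\<lambda>x. \<bar>V x\<bar>"] V_meas \<zeta> \<phi>(2) by simp
    have iP: "set_integrable lebesgue \<Omega> (\<lambda>x. indicator L x * \<phi> x powr p)"
    proof -
      obtain B where B: "B \<ge> 0" "\<And>x. \<bar>\<phi> x\<bar> \<le> B" using test_fun_bounded_support[OF \<phi>(1)] by metis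
      show ?thesis
      proof (rule set_integrable_compact_support[OF \<Omega>_sets _ L(2), where g = "\<lambda>x. 1"])
        show "(\<lambda>x. indicator L x * \<phi> x powr p) \<in> borel_measurable (lebesgue_on \<Omega>)"
          by (intro measurable_restrict_space1 measurable_completion) measurable
        show "\<bar>indicator L x * \<phi> x powr p\<bar> \<le> B powr p * \<bar>1\<bar>" if "x \<in> L" for x
          using that B(2)[of x] \<phi>(2)[of x] p by (auto intro!: powr_mono2)
        show "(\<integral>\<^sup>+ x\<in>L. ennreal \<bar>1\<bar> \<partial>lebesgue) < \<infinity>"
          using L(1) lmeasurable_compact[OF L(1)]
          by (simp add: compact_sets_lebesgue fmeasurable_def del: emeasure_completion)
        show "(\<lambda>x. ennreal \<bar>1\<bar> * indicator L x) \<in> borel_measurable lebesgue"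
          using L(1) by (auto intro!: borel_measurable_indicator compact_sets_lebesgue)
      qed auto
    qed
    have P_eq: "P = (LINT x:\<Omega>|lebesgue. indicator L x * \<phi> x powr p)"
      unfolding P_def set_lebesgue_integral_def
      using L(2) by (intro Bochner_Integration.integral_cong) (auto split: split_indicator)
    have X0: "X x \<ge> 0" for x by (simp add: X_def)

    \<comment> \<open>Weighted convexity with \<open>z = \<zeta> x\<close>: its factor
      \<open>\<zeta> x powr (1 - p)\<close> cancels against the bound
      \<open>C0 * \<zeta> x powr (p - 1)\<close> for the gradient of the cutoff.\<close>
    have grad_bound: "norm_mat (A x) (grad (\<lambda>x. (1 - \<zeta> x) * \<phi> x) x) powr p
        \<le> (1 - \<zeta> x) * X x + \<tau> * C0 * (indicator L x * \<phi> x powr p)" if x: "x \<in> \<Omega>" for x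
    proof -
      have d: "(\<lambda>x. 1 - \<zeta> x) differentiable (at x)" "grad (\<lambda>x. 1 - \<zeta> x) x = - grad \<zeta> x"
      proof -
        have "((\<lambda>x. 1 - \<zeta> x) has_derivative (\<lambda>v. (- grad \<zeta> x) \<bullet> v)) (at x)"
          by (auto intro!: derivative_eq_intros has_derivative_grad C1\<zeta>)
        then show "(\<lambda>x. 1 - \<zeta> x) differentiable (at x)" "grad (\<lambda>x. 1 - \<zeta> x) x = - grad \<zeta> x"
          by (auto intro: grad_eqI differentiableI)
      qed
      have g: "grad (\<lambda>x. (1 - \<zeta> x) * \<phi> x) x = (1 - \<zeta> x) *\<^sub>R grad \<phi> x + (- \<phi> x) *\<^sub>R grad \<zeta> x"
        using grad_mult(1)[OF d(1) C1\<phi>(1)] d(2) by simp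
      show ?thesis
      proof (cases "x \<in> L")
        case False
        then show ?thesis using \<zeta>(4,5) by (simp add: g X_def)
      next
        case True
        let ?Y = "\<phi> x * (sqrt \<Lambda> * norm (grad \<zeta> x))"
        have Y: "?Y \<ge> 0" using \<phi>(2)[of x] \<Lambda> by simp
        have "norm_mat (A x) (grad (\<lambda>x. (1 - \<zeta> x) * \<phi> x) x)
          \<le> norm_mat (A x) ((1 - \<zeta> x) *\<^sub>R grad \<phi> x) + norm_mat (A x) ((- \<phi> x) *\<^sub>R grad \<zeta> x)"
          unfolding g by (rule norm_mat_triangle[OF A_sym[OF x] A_psd[OF x]])
        also have "\<dots> = (1 - \<zeta> x) * norm_mat (A x) (grad \<phi> x) + \<phi> x * norm_mat (A x) (grad \<zeta> x)"
          unfolding norm_mat_scaleR using \<phi>(2)[of x] \<zeta>(3)[of x] by simp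
        also have "\<dots> \<le> (1 - \<zeta> x) * norm_mat (A x) (grad \<phi> x) + ?Y"
          using norm_mat_le[OF \<Lambda>(3)[OF True]] \<phi>(2)[of x] by (intro add_left_mono mult_left_mono) auto
        finally have 1: "norm_mat (A x) (grad (\<lambda>x. (1 - \<zeta> x) * \<phi> x) x) powr p
          \<le> ((1 - \<zeta> x) * norm_mat (A x) (grad \<phi> x) + ?Y) powr p"
          using p A_norm_nonneg[OF x] by (intro powr_mono2) auto
        show ?thesis
        proof (cases "\<zeta> x = 0")
          \<comment> \<open>The bound on \<open>grad \<zeta> x\<close> contains
            \<open>0 powr (p - 1) = 0\<close>, so this gradient vanishes and division by
            \<open>\<zeta> x\<close> is avoided.\<close>
          case True
          then have "norm (grad \<zeta> x) powr p \<le> 0" using C0(2)[of x] p by simp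
          then have "grad \<zeta> x = 0" using powr_ge_zero[of "norm (grad \<zeta> x)" p] by (metis norm_eq_zero order_antisym powr_eq_0_iff)
          then show ?thesis using 1 True C0 \<tau> by (simp add: X_def add_increasing2)
        next
          case False
          then have z: "0 < \<zeta> x" using \<zeta>(2)[of x] by simp
          have "((1 - \<zeta> x) * norm_mat (A x) (grad \<phi> x) + ?Y) powr p \<le> (1 - \<zeta> x) * X x + \<zeta> x powr (1 - p) * ?Y powr p"
            unfolding X_def by (rule add_powr_le_weighted[OF p A_norm_nonneg[OF x] Y z \<zeta>(3)])
          also have "\<zeta> x powr (1 - p) * ?Y powr p = \<tau> * \<phi> x powr p * (\<zeta> x powr (1 - p) * norm (grad \<zeta> x) powr p)"
            by (simp add: powr_mult \<tau>_def mult_ac)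
          also have "\<dots> \<le> \<tau> * \<phi> x powr p * (\<zeta> x powr (1 - p) * (C0 * \<zeta> x powr (p - 1)))"
            using C0(2)[of x] \<tau> by (intro mult_left_mono) auto
          also have "\<zeta> x powr (1 - p) * (C0 * \<zeta> x powr (p - 1)) = C0"
          proof -
            have "\<zeta> x powr (1 - p) * \<zeta> x powr (p - 1) = 1" using z by (simp add: powr_add[symmetric])
            then show ?thesis by simp
          qed
          finally show ?thesis using 1 \<open>x \<in> L\<close> by (simp add: mult_ac)
        qed
      qed
    qed
    \<comment> \<open>The sign of \<open>V\<close> is unknown, so the deviation of
      \<open>(1 - \<zeta> x) powr p\<close> from 1 is estimated with \<open>|V|\<close>.\<close>
    have pot_bound: "V x * \<bar>(1 - \<zeta> x) * \<phi> x\<bar> powr p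
        \<le> V x * \<bar>\<phi> x\<bar> powr p + real n * (\<bar>V x\<bar> * (\<zeta> x * \<phi> x powr p))" for x
    proof -
      have b: "1 - real n * \<zeta> x \<le> (1 - \<zeta> x) powr p" "(1 - \<zeta> x) powr p \<le> 1"
        using Bernoulli_powr[of "\<zeta> x" p n] \<zeta> n p by auto
      have "V x * ((1 - \<zeta> x) powr p - 1) \<le> \<bar>V x\<bar> * (real n * \<zeta> x)"
      proof -
        have "V x * ((1 - \<zeta> x) powr p - 1) \<le> \<bar>V x * ((1 - \<zeta> x) powr p - 1)\<bar>" by simp
        also have "\<dots> = \<bar>V x\<bar> * (1 - (1 - \<zeta> x) powr p)" using b by (simp add: abs_mult)
        also have "\<dots> \<le> \<bar>V x\<bar> * (real n * \<zeta> x)" using b by (intro mult_left_mono) auto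
        finally show ?thesis .
      qed
      then have "V x * ((1 - \<zeta> x) powr p - 1) * \<phi> x powr p \<le> \<bar>V x\<bar> * (real n * \<zeta> x) * \<phi> x powr p"
        by (intro mult_right_mono) auto
      moreover have "\<bar>(1 - \<zeta> x) * \<phi> x\<bar> powr p = (1 - \<zeta> x) powr p * \<phi> x powr p" "\<bar>\<phi> x\<bar> = \<phi> x"
        using \<phi>(2)[of x] \<zeta>(3)[of x] by (simp_all add: powr_mult abs_mult)
      ultimately show ?thesis by (simp only: algebra_simps)
    qed

    \<comment> \<open>\<open>- \<zeta> x * X x\<close> is kept apart from the energy density, so
      that \<open>Q_form\<close> of \<phi> is recovered intact and the gain appears as
      \<open>- E\<close>.\<close>
    have "Q_form A V p \<Omega> (\<lambda>x. (1 - \<zeta> x) * \<phi> x)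
      \<le> (LINT x:\<Omega>|lebesgue. (X x + V x * \<bar>\<phi> x\<bar> powr p) - \<zeta> x * X x
          + real n * (\<bar>V x\<bar> * (\<zeta> x * \<phi> x powr p)) + \<tau> * C0 * (indicator L x * \<phi> x powr p))"
      unfolding Q_form_def
    proof (rule set_integral_mono)
      show "set_integrable lebesgue \<Omega> (\<lambda>x. norm_mat (A x) (grad (\<lambda>x. (1 - \<zeta> x) * \<phi> x) x) powr p +
        V x * \<bar>(1 - \<zeta> x) * \<phi> x\<bar> powr p)"
        using energy_integrable[OF \<psi>, of "\<lambda>_. 1"] potential_integrable[OF \<psi>, of "\<lambda>_. 1" V] V_meas
        by (intro set_integral_add) auto
      show "set_integrable lebesgue \<Omega> (\<lambda>x. (X x + V x * \<bar>\<phi> x\<bar> powr p) - \<zeta> x * X x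
          + real n * (\<bar>V x\<bar> * (\<zeta> x * \<phi> x powr p)) + \<tau> * C0 * (indicator L x * \<phi> x powr p))"
        by (intro set_integral_add set_integral_diff set_integrable_mult_right iX iV iE iT iP)
      show "norm_mat (A x) (grad (\<lambda>x. (1 - \<zeta> x) * \<phi> x) x) powr p + V x * \<bar>(1 - \<zeta> x) * \<phi> x\<bar> powr p
        \<le> (X x + V x * \<bar>\<phi> x\<bar> powr p) - \<zeta> x * X x
          + real n * (\<bar>V x\<bar> * (\<zeta> x * \<phi> x powr p)) + \<tau> * C0 * (indicator L x * \<phi> x powr p)" if "x \<in> \<Omega>" for x
        using grad_bound[OF that] pot_bound[of x] by (simp add: algebra_simps)
    qed
    also have "\<dots> = Q_form A V p \<Omega> \<phi> - E + real n * T + \<tau> * C0 * P"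
    proof -
      have Q: "Q_form A V p \<Omega> \<phi> = (LINT x:\<Omega>|lebesgue. X x + V x * \<bar>\<phi> x\<bar> powr p)"
        by (simp add: Q_form_def X_def)
      have i1: "set_integrable lebesgue \<Omega> (\<lambda>x. X x + V x * \<bar>\<phi> x\<bar> powr p)"
        by (intro set_integral_add iX iV)
      show ?thesis
        unfolding Q E_def T_def P_eq
        by (simp add: set_integral_add set_integral_diff set_integrable_mult_right i1 iE iT iP)
    qed
    finally have main: "Q_form A V p \<Omega> (\<lambda>x. (1 - \<zeta> x) * \<phi> x) \<le> Q_form A V p \<Omega> \<phi> - E + real n * T + \<tau> * C0 * P" .

    have ET: "ennreal (LINT x:\<Omega>|lebesgue. f x) = (\<integral>\<^sup>+x. ennreal (indicator \<Omega> x * f x) \<partial>lebesgue)"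
      if "set_integrable lebesgue \<Omega> f" "\<And>x. x \<in> \<Omega> \<Longrightarrow> f x \<ge> 0" for f
      using that unfolding set_integrable_def set_lebesgue_integral_def
      by (subst nn_integral_eq_integral) (auto split: split_indicator)
    have T0: "T \<ge> 0" "E \<ge> 0" "P \<ge> 0"
      unfolding T_def E_def P_def set_lebesgue_integral_def
      using \<zeta>(2) X0 by (auto intro!: Bochner_Integration.integral_nonneg)
    \<comment> \<open>Since \<open>\<eta> = \<zeta>^(1/p)\<close>, the power \<open>|u|^p\<close> is
      \<open>\<zeta> \<phi>^p\<close>, the function integrated against \<open>|V|\<close> in
      \<open>T\<close>.\<close>
    define u where "u x = \<eta> x * \<phi> x" for x
    have u1: "u differentiable (at x)" "grad u x = \<eta> x *\<^sub>R grad \<phi> x + \<phi> x *\<^sub>R grad \<eta> x" for x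
      using grad_mult[OF \<eta>(1) C1\<phi>(1)] by (auto simp: u_def[abs_def])
    have \<eta>c: "continuous_on UNIV \<eta>"
      using \<eta>(1) by (simp add: continuous_at_imp_continuous_on differentiable_imp_continuous_within)
    have "grad u = (\<lambda>x. \<eta> x *\<^sub>R grad \<phi> x + \<phi> x *\<^sub>R grad \<eta> x)" using u1 by auto
    then have u2: "continuous_on UNIV (grad u)"
      using \<eta>(2) \<eta>c C1\<phi>(2) smooth_on_continuous[OF s\<phi>] by (auto intro!: continuous_intros)
    have \<eta>0: "\<eta> x = 0" if "x \<notin> L" for x using \<eta>(4)[of x] \<zeta>(4)[OF that] by simp
    have u3: "grad u x = 0" if "x \<notin> L" for x using that \<eta>(5) \<eta>0 by (simp add: u1)
    have up: "\<bar>u x\<bar> powr p = \<zeta> x * \<phi> x powr p" for x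
      using \<eta>(3,4)[of x] \<phi>(2)[of x] by (simp add: u_def abs_mult powr_mult)
    have "ennreal T = (\<integral>\<^sup>+x. ennreal \<bar>V x\<bar> * indicator L x * ennreal (\<bar>u x\<bar> powr p) \<partial>lebesgue)"
      unfolding T_def
    proof (subst ET[OF iT])
      show "0 \<le> \<bar>V x\<bar> * (\<zeta> x * \<phi> x powr p)" for x using \<zeta>(2) by simp
      show "(\<integral>\<^sup>+x. ennreal (indicator \<Omega> x * (\<bar>V x\<bar> * (\<zeta> x * \<phi> x powr p))) \<partial>lebesgue)
        = (\<integral>\<^sup>+x. ennreal \<bar>V x\<bar> * indicator L x * ennreal (\<bar>u x\<bar> powr p) \<partial>lebesgue)"
      proof (intro nn_integral_cong)
        fix x show "ennreal (indicator \<Omega> x * (\<bar>V x\<bar> * (\<zeta> x * \<phi> x powr p)))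
          = ennreal \<bar>V x\<bar> * indicator L x * ennreal (\<bar>u x\<bar> powr p)"
          using L(2) \<zeta>(2)[of x] \<zeta>(4)[of x] by (cases "x \<in> L") (auto simp: up ennreal_mult)
      qed
    qed
    also have "\<dots> \<le> ennreal \<epsilon> * (\<integral>\<^sup>+x. ennreal (norm (grad u x) powr p) \<partial>lborel)
        + ennreal C1 * (\<integral>\<^sup>+x. ennreal (\<bar>u x\<bar> powr p) \<partial>lborel)"
      by (rule C1(2)[OF u1(1) u2 u3])
    also have "\<dots> \<le> ennreal \<epsilon> * ennreal (2 powr (p - 1) * (\<tau> * E + C0 * P)) + ennreal C1 * ennreal P"
    proof (intro add_mono mult_left_mono)
      have iG: "set_integrable lebesgue \<Omega> (\<lambda>x. 2 powr (p - 1) * (\<tau> * (\<zeta> x * X x) + C0 * (indicator L x * \<phi> x powr p)))"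
        by (intro set_integrable_mult_right set_integral_add iE iP)
      have "(\<integral>\<^sup>+x. ennreal (norm (grad u x) powr p) \<partial>lborel) = (\<integral>\<^sup>+x. ennreal (norm (grad u x) powr p) \<partial>lebesgue)"
        by (simp add: nn_integral_completion)
      also have "\<dots> \<le> (\<integral>\<^sup>+x. ennreal (indicator \<Omega> x * (2 powr (p - 1) * (\<tau> * (\<zeta> x * X x) + C0 * (indicator L x * \<phi> x powr p)))) \<partial>lebesgue)"
      proof (intro nn_integral_mono ennreal_leI)
        fix x
        show "norm (grad u x) powr p \<le> indicator \<Omega> x * (2 powr (p - 1) * (\<tau> * (\<zeta> x * X x) + C0 * (indicator L x * \<phi> x powr p)))"
        proof (cases "x \<in> L")
          case False
          then show ?thesis using u3 \<zeta>(4) p by (simp split: split_indicator)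
        next
          case True
          have "norm (grad u x) \<le> \<eta> x * norm (grad \<phi> x) + \<phi> x * norm (grad \<eta> x)"
            unfolding u1(2) using norm_triangle_ineq[of "\<eta> x *\<^sub>R grad \<phi> x" "\<phi> x *\<^sub>R grad \<eta> x"] \<eta>(3)[of x] \<phi>(2)[of x] by simp
          then have "norm (grad u x) powr p \<le> (\<eta> x * norm (grad \<phi> x) + \<phi> x * norm (grad \<eta> x)) powr p"
            using p by (intro powr_mono2) auto
          also have "\<dots> \<le> 2 powr (p - 1) * ((\<eta> x * norm (grad \<phi> x)) powr p + (\<phi> x * norm (grad \<eta> x)) powr p)"
            using p \<eta>(3) \<phi>(2) by (intro add_powr_le) auto
          also have "\<dots> = 2 powr (p - 1) * (\<zeta> x * norm (grad \<phi> x) powr p + norm (grad \<eta> x) powr p * \<phi> x powr p)"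
            by (simp add: powr_mult \<eta>(4) mult_ac)
          also have "\<dots> \<le> 2 powr (p - 1) * (\<zeta> x * (\<tau> * X x) + C0 * \<phi> x powr p)"
          proof (intro mult_left_mono add_mono mult_right_mono \<eta>(6) \<zeta>(2))
            have "norm (grad \<phi> x) \<le> sqrt \<Lambda> * norm_mat (A x) (grad \<phi> x)"
              by (rule norm_le_norm_mat[OF \<Lambda>(2)[OF True] \<Lambda>(1)])
            then have "norm (grad \<phi> x) powr p \<le> (sqrt \<Lambda> * norm_mat (A x) (grad \<phi> x)) powr p"
              using p by (intro powr_mono2) auto
            then show "norm (grad \<phi> x) powr p \<le> \<tau> * X x" by (simp add: powr_mult \<tau>_def X_def)
          qed auto
          finally show ?thesis using True L(2) by (auto simp: mult_ac)
        qed
      qed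
      also have "\<dots> = ennreal (LINT x:\<Omega>|lebesgue. 2 powr (p - 1) * (\<tau> * (\<zeta> x * X x) + C0 * (indicator L x * \<phi> x powr p)))"
        using \<tau> C0 \<zeta>(2) X0 by (intro ET[OF iG, symmetric]) auto
      also have "(LINT x:\<Omega>|lebesgue. 2 powr (p - 1) * (\<tau> * (\<zeta> x * X x) + C0 * (indicator L x * \<phi> x powr p)))
        = 2 powr (p - 1) * (\<tau> * E + C0 * P)"
        unfolding E_def P_eq
        by (simp add: set_integral_add set_integrable_mult_right iE iP)
      finally show "(\<integral>\<^sup>+x. ennreal (norm (grad u x) powr p) \<partial>lborel) \<le> ennreal (2 powr (p - 1) * (\<tau> * E + C0 * P))" .
      have "(\<integral>\<^sup>+x. ennreal (\<bar>u x\<bar> powr p) \<partial>lborel) = (\<integral>\<^sup>+x. ennreal (\<bar>u x\<bar> powr p) \<partial>lebesgue)"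
        by (simp add: nn_integral_completion)
      also have "\<dots> \<le> (\<integral>\<^sup>+x. ennreal (indicator \<Omega> x * (indicator L x * \<phi> x powr p)) \<partial>lebesgue)"
      proof (intro nn_integral_mono ennreal_leI)
        fix x show "\<bar>u x\<bar> powr p \<le> indicator \<Omega> x * (indicator L x * \<phi> x powr p)"
          using \<zeta>(3)[of x] \<zeta>(4)[of x] L(2) by (auto simp: up mult_left_le_one_le \<zeta>(2) split: split_indicator)
      qed
      also have "\<dots> = ennreal P" unfolding P_eq by (intro ET[OF iP, symmetric]) auto
      finally show "(\<integral>\<^sup>+x. ennreal (\<bar>u x\<bar> powr p) \<partial>lborel) \<le> ennreal P" .
    qed auto
    also have "\<dots> = ennreal (\<epsilon> * (2 powr (p - 1) * (\<tau> * E + C0 * P)) + C1 * P)"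
      using \<epsilon> C1(1) T0 \<tau> C0(1) by (simp add: ennreal_mult[symmetric] ennreal_plus[symmetric] del: ennreal_plus)
    \<comment> \<open>All quantities are finite, so the estimate can be read in the reals, where
      \<open>E\<close> may be cancelled.\<close>
    finally have "T \<le> \<epsilon> * (2 powr (p - 1) * (\<tau> * E + C0 * P)) + C1 * P"
      using \<epsilon> C1(1) T0 \<tau> C0(1) by (subst (asm) ennreal_le_iff) auto
    then have "real n * T \<le> real n * (\<epsilon> * (2 powr (p - 1) * (\<tau> * E + C0 * P)) + C1 * P)"
      using n0 by (intro mult_left_mono) auto
    also have "\<dots> = (real n * 2 powr (p - 1) * \<tau> * \<epsilon>) * E + real n * (\<epsilon> * 2 powr (p - 1) * C0 + C1) * P"
      by (simp add: algebra_simps)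
    also have "real n * 2 powr (p - 1) * \<tau> * \<epsilon> = 1" using n0 \<tau> by (simp add: \<epsilon>_def)
    finally have "real n * T \<le> E + real n * (\<epsilon> * 2 powr (p - 1) * C0 + C1) * P" by simp
    with main show "Q_form A V p \<Omega> (\<lambda>x. (1 - \<zeta> x) * \<phi> x) \<le> Q_form A V p \<Omega> \<phi> + C * (LINT x:L|lebesgue. \<phi> x powr p)"
      unfolding P_def[symmetric] by (simp add: C_def algebra_simps)
  qed
qed

end

section \<open>Passage to the limit along a null-sequence\<close>

lemma nn_integral_le_of_AE_tendsto:
  fixes h :: "nat \<Rightarrow> 'a \<Rightarrow> real"
  assumes [measurable]: "\<And>k. h k \<in> borel_measurable M"
    and lim: "AE x in M. (\<lambda>k. h k x) \<longlonglongrightarrow> g x"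
    and B: "\<And>k. (\<integral>\<^sup>+x. ennreal (h k x) \<partial>M) \<le> B"
  shows "(\<integral>\<^sup>+x. ennreal (g x) \<partial>M) \<le> B"
proof -
  have "(\<integral>\<^sup>+x. ennreal (g x) \<partial>M) = (\<integral>\<^sup>+x. liminf (\<lambda>k. ennreal (h k x)) \<partial>M)"
    using lim
    by (intro nn_integral_cong_AE, eventually_elim)
      (metis lim_imp_Liminf sequentially_bot tendsto_ennrealI)
  also have "\<dots> \<le> liminf (\<lambda>k. \<integral>\<^sup>+x. ennreal (h k x) \<partial>M)" by (rule nn_integral_liminf) simp
  also have "\<dots> \<le> B" using B by (intro Liminf_le always_eventually) auto
  finally show ?thesis .
qed

lemma Lp_norm_tendsto_0:
  assumes "(\<lambda>k. Lp_norm p S (g k)) \<longlonglongrightarrow> 0" "0 < p"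
  shows "(\<lambda>k. LINT x:S|lebesgue. norm (g k x) powr p) \<longlonglongrightarrow> 0"
proof -
  have "(\<lambda>k. Lp_norm p S (g k) powr p) \<longlonglongrightarrow> 0"
    by (rule tendsto_zero_powrI[OF assms(1) tendsto_const _ assms(2)]) (simp add: Lp_norm_def)
  moreover have "(LINT x:S|lebesgue. norm (g k x) powr p) \<ge> 0" for k
    unfolding set_lebesgue_integral_def by (intro Bochner_Integration.integral_nonneg) simp
  ultimately show ?thesis using assms(2) by (simp add: Lp_norm_def powr_powr)
qed

text \<open>A difference whose power is not integrable would have \<open>Lp_norm\<close> 0 by
  convention; convergence of norms carries information only once integrability is known.\<close>

lemma set_integrable_diff_powr:
  fixes f g :: "real^'n \<Rightarrow> real"
  assumes p: "1 \<le> p" and S: "S \<in> sets lebesgue"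
    and m: "f \<in> borel_measurable (lebesgue_on S)" "g \<in> borel_measurable (lebesgue_on S)"
    and f: "set_integrable lebesgue S (\<lambda>x. \<bar>f x\<bar> powr p)" and g: "set_integrable lebesgue S (\<lambda>x. \<bar>g x\<bar> powr p)"
  shows "set_integrable lebesgue S (\<lambda>x. \<bar>f x - g x\<bar> powr p)"
  unfolding set_integrable_def
proof (rule Bochner_Integration.integrable_bound)
  have "set_integrable lebesgue S (\<lambda>x. 2 powr (p - 1) * (\<bar>f x\<bar> powr p + \<bar>g x\<bar> powr p))"
    by (intro set_integrable_mult_right set_integral_add f g)
  then show "integrable lebesgue (\<lambda>x. indicator S x *\<^sub>R (2 powr (p - 1) * (\<bar>f x\<bar> powr p + \<bar>g x\<bar> powr p)))"
    by (simp add: set_integrable_def)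
  note m[measurable]
  have "(\<lambda>x. \<bar>f x - g x\<bar> powr p) \<in> borel_measurable (lebesgue_on S)" by measurable
  then show "(\<lambda>x. indicator S x *\<^sub>R \<bar>f x - g x\<bar> powr p) \<in> borel_measurable lebesgue"
    using S by (subst (asm) borel_measurable_restrict_space_iff) auto
  have "\<bar>f x - g x\<bar> powr p \<le> 2 powr (p - 1) * (\<bar>f x\<bar> powr p + \<bar>g x\<bar> powr p)" for x
  proof -
    have "\<bar>f x - g x\<bar> powr p \<le> (\<bar>f x\<bar> + \<bar>g x\<bar>) powr p" using p by (intro powr_mono2) auto
    also have "\<dots> \<le> 2 powr (p - 1) * (\<bar>f x\<bar> powr p + \<bar>g x\<bar> powr p)" using p by (intro add_powr_le) auto
    finally show ?thesis .
  qed
  then show "AE x in lebesgue. norm (indicator S x *\<^sub>R \<bar>f x - g x\<bar> powr p)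
    \<le> norm (indicator S x *\<^sub>R (2 powr (p - 1) * (\<bar>f x\<bar> powr p + \<bar>g x\<bar> powr p)))"
    by (intro always_eventually) (auto split: split_indicator intro: order_trans)
qed

lemma set_integrable_continuous_powr:
  fixes f :: "real^'n \<Rightarrow> real"
  assumes "continuous_on UNIV f" "compact S" "0 < p"
  shows "set_integrable lebesgue S (\<lambda>x. \<bar>f x\<bar> powr p)"
proof -
  have "continuous_on S (\<lambda>x. \<bar>f x\<bar> powr p)"
    using assms by (intro continuous_on_powr' continuous_intros continuous_on_subset[OF assms(1)]) auto
  then have i: "integrable lborel (\<lambda>x. indicator S x *\<^sub>R \<bar>f x\<bar> powr p)"
    by (rule borel_integrable_compact[OF assms(2)])
  then show ?thesis
    unfolding set_integrable_def
    by (subst integrable_completion) (auto dest: borel_measurable_integrable)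
qed

lemma Lp_norm_convergent_bounded:
  fixes f :: "nat \<Rightarrow> real^'n \<Rightarrow> real"
  assumes p: "1 < p" and S: "compact S"
    and f: "\<And>k. continuous_on UNIV (f k)" "\<And>k x. 0 \<le> f k x"
    and \<phi>: "\<phi> \<in> borel_measurable (lebesgue_on S)" "set_integrable lebesgue S (\<lambda>x. \<bar>\<phi> x\<bar> powr p)"
    and conv: "(\<lambda>k. Lp_norm p S (\<lambda>x. f k x - \<phi> x)) \<longlonglongrightarrow> 0"
  shows "\<exists>B. \<forall>k. (LINT x:S|lebesgue. f k x powr p) \<le> B"
proof -
  have Ss: "S \<in> sets lebesgue" using S by (rule compact_sets_lebesgue)
  have fi: "set_integrable lebesgue S (\<lambda>x. \<bar>f k x\<bar> powr p)" for k
    using p by (intro set_integrable_continuous_powr f S) simp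
  have di: "set_integrable lebesgue S (\<lambda>x. \<bar>f k x - \<phi> x\<bar> powr p)" for k
  proof (rule set_integrable_diff_powr)
    show "f k \<in> borel_measurable (lebesgue_on S)"
      using f by (intro measurable_restrict_space1 measurable_completion) (simp add: borel_measurable_continuous_onI)
  qed (use p Ss \<phi> fi in auto)
  have "(\<lambda>k. LINT x:S|lebesgue. \<bar>f k x - \<phi> x\<bar> powr p) \<longlonglongrightarrow> 0"
    using Lp_norm_tendsto_0[OF conv] p by simp
  then have "Bseq (\<lambda>k. LINT x:S|lebesgue. \<bar>f k x - \<phi> x\<bar> powr p)"
    by (auto intro: convergent_imp_Bseq convergentI)
  then obtain B1 where B1: "\<And>k. (LINT x:S|lebesgue. \<bar>f k x - \<phi> x\<bar> powr p) \<le> B1"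
    unfolding Bseq_def by (metis abs_le_D1 real_norm_def)
  show ?thesis
  proof (intro exI allI)
    fix k
    have "(LINT x:S|lebesgue. f k x powr p) \<le> (LINT x:S|lebesgue. 2 powr (p - 1) * (\<bar>f k x - \<phi> x\<bar> powr p + \<bar>\<phi> x\<bar> powr p))"
    proof (rule set_integral_mono)
      show "set_integrable lebesgue S (\<lambda>x. f k x powr p)" using fi[of k] f(2) by simp
      show "set_integrable lebesgue S (\<lambda>x. 2 powr (p - 1) * (\<bar>f k x - \<phi> x\<bar> powr p + \<bar>\<phi> x\<bar> powr p))"
        by (intro set_integrable_mult_right set_integral_add di \<phi>)
      fix x
      have "f k x powr p \<le> (\<bar>f k x - \<phi> x\<bar> + \<bar>\<phi> x\<bar>) powr p" using p f(2) by (intro powr_mono2) auto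
      also have "\<dots> \<le> 2 powr (p - 1) * (\<bar>f k x - \<phi> x\<bar> powr p + \<bar>\<phi> x\<bar> powr p)" using p by (intro add_powr_le) auto
      finally show "f k x powr p \<le> 2 powr (p - 1) * (\<bar>f k x - \<phi> x\<bar> powr p + \<bar>\<phi> x\<bar> powr p)" .
    qed
    also have "\<dots> = 2 powr (p - 1) * ((LINT x:S|lebesgue. \<bar>f k x - \<phi> x\<bar> powr p) + (LINT x:S|lebesgue. \<bar>\<phi> x\<bar> powr p))"
      by (simp add: set_integral_add di \<phi>)
    also have "\<dots> \<le> 2 powr (p - 1) * (B1 + (LINT x:S|lebesgue. \<bar>\<phi> x\<bar> powr p))"
      by (intro mult_left_mono add_right_mono B1) auto
    finally show "(LINT x:S|lebesgue. f k x powr p) \<le> 2 powr (p - 1) * (B1 + (LINT x:S|lebesgue. \<bar>\<phi> x\<bar> powr p))" .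
  qed
qed

text \<open>On a compact set, L^p convergence yields a subsequence converging almost everywhere, and
  Fatou's lemma bounds the integral over that set. The subsequence may depend on the set but
  \<open>B\<close> does not, so a second use of Fatou along an exhaustion by compact sets replaces a
  diagonal argument.\<close>

lemma weighted_Lp_loc_limit:
  fixes f :: "nat \<Rightarrow> real^'n \<Rightarrow> real" and \<phi> w :: "real^'n \<Rightarrow> real"
  assumes \<Omega>: "open \<Omega>" and p: "1 < p"
    and w: "w \<in> borel_measurable lebesgue" "\<And>x. 0 \<le> w x" "\<And>x. x \<notin> \<Omega> \<Longrightarrow> w x = 0"
    and f: "\<And>k. continuous_on UNIV (f k)"
    and \<phi>: "\<phi> \<in> Lp_loc p \<Omega>"
    and conv: "\<And>C. compact C \<Longrightarrow> C \<subseteq> \<Omega> \<Longrightarrow> (\<lambda>k. Lp_norm p C (\<lambda>x. f k x - \<phi> x)) \<longlonglongrightarrow> 0"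
    and B: "\<And>k. (\<integral>\<^sup>+x. ennreal (w x * \<bar>f k x\<bar> powr p) \<partial>lebesgue) \<le> B"
  shows "(\<integral>\<^sup>+x. ennreal (w x * \<bar>\<phi> x\<bar> powr p) \<partial>lebesgue) \<le> B"
proof -
  note w(1)[measurable]
  have \<phi>m: "\<phi> \<in> borel_measurable (lebesgue_on \<Omega>)" using \<phi> by (simp add: Lp_loc_def)
  have [measurable]: "(\<lambda>x. indicator \<Omega> x * \<phi> x) \<in> borel_measurable lebesgue"
    using \<phi>m \<Omega> by (subst (asm) borel_measurable_restrict_space_iff) auto
  have fm: "f k \<in> borel_measurable lebesgue" for k
    using f by (intro measurable_completion) (simp add: borel_measurable_continuous_onI)
  note fm[measurable]
  \<comment> \<open>\<phi> is measurable only on \<Omega>; its truncation is measurable on the whole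
    space, and the weight vanishes where the two differ.\<close>
  have w\<phi>: "w x * \<bar>\<phi> x\<bar> powr p = w x * \<bar>indicator \<Omega> x * \<phi> x\<bar> powr p" for x
    using w(3)[of x] by (cases "x \<in> \<Omega>") auto
  obtain C :: "nat \<Rightarrow> (real^'n) set" where C: "\<And>n. compact (C n)" "\<And>n. C n \<subseteq> \<Omega>" "\<And>x. x \<in> \<Omega> \<Longrightarrow> \<exists>N. \<forall>n\<ge>N. x \<in> C n"
  proof (rule open_Union_compact_subsets[OF \<Omega>])
    fix C :: "nat \<Rightarrow> (real^'n) set"
    assume C: "\<And>n. compact (C n)" "\<And>n. C n \<subseteq> \<Omega>"
      and ex: "\<And>K. compact K \<Longrightarrow> K \<subseteq> \<Omega> \<Longrightarrow> \<exists>N. \<forall>n\<ge>N. K \<subseteq> C n"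
    have "\<exists>N. \<forall>n\<ge>N. x \<in> C n" if "x \<in> \<Omega>" for x using ex[of "{x}"] that by simp
    then show thesis using C by (intro that[of C]) auto
  qed
  have CB: "(\<integral>\<^sup>+x. ennreal (indicator (C n) x * (w x * \<bar>indicator \<Omega> x * \<phi> x\<bar> powr p)) \<partial>lebesgue) \<le> B" for n
  proof -
    let ?S = "C n"
    have S[measurable]: "?S \<in> sets lebesgue" using C(1) by (rule compact_sets_lebesgue)
    have int: "set_integrable lebesgue ?S (\<lambda>x. \<bar>f k x - \<phi> x\<bar> powr p)" for k
    proof (rule set_integrable_diff_powr)
      show "f k \<in> borel_measurable (lebesgue_on ?S)" using fm by (rule measurable_restrict_space1)
      show "\<phi> \<in> borel_measurable (lebesgue_on ?S)" by (rule measurable_restrict_mono[OF \<phi>m C(2)])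
      show "set_integrable lebesgue ?S (\<lambda>x. \<bar>\<phi> x\<bar> powr p)" using \<phi> C by (simp add: Lp_loc_def)
      show "set_integrable lebesgue ?S (\<lambda>x. \<bar>f k x\<bar> powr p)"
        using p by (intro set_integrable_continuous_powr C f) simp
    qed (use p S in auto)
    have "(\<lambda>k. LINT x:?S|lebesgue. norm (f k x - \<phi> x) powr p) \<longlonglongrightarrow> 0"
      by (rule Lp_norm_tendsto_0[OF conv[OF C(1,2)]]) (use p in simp)
    then have "(\<lambda>k. \<integral>x. norm (indicator ?S x *\<^sub>R \<bar>f k x - \<phi> x\<bar> powr p) \<partial>lebesgue) \<longlonglongrightarrow> 0"
      by (simp add: set_lebesgue_integral_def abs_mult)
    from tendsto_L1_AE_subseq[OF int[unfolded set_integrable_def] this]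
    obtain r :: "nat \<Rightarrow> nat" where r: "AE x in lebesgue. (\<lambda>k. indicator ?S x *\<^sub>R \<bar>f (r k) x - \<phi> x\<bar> powr p) \<longlonglongrightarrow> 0"
      by blast
    show ?thesis
    proof (rule nn_integral_le_of_AE_tendsto)
      show "(\<lambda>x. indicator ?S x * (w x * \<bar>f (r k) x\<bar> powr p)) \<in> borel_measurable lebesgue" for k by measurable
      show "(\<integral>\<^sup>+x. ennreal (indicator ?S x * (w x * \<bar>f (r k) x\<bar> powr p)) \<partial>lebesgue) \<le> B" for k
        by (rule order_trans[OF _ B[of "r k"]])
          (intro nn_integral_mono ennreal_leI, use w in \<open>auto split: split_indicator\<close>)
      show "AE x in lebesgue. (\<lambda>k. indicator ?S x * (w x * \<bar>f (r k) x\<bar> powr p)) \<longlonglongrightarrow>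
        indicator ?S x * (w x * \<bar>indicator \<Omega> x * \<phi> x\<bar> powr p)"
        using r
      proof eventually_elim
        case (elim x)
        show ?case
        proof (cases "x \<in> ?S")
          case True
          have "(\<lambda>k. (\<bar>f (r k) x - \<phi> x\<bar> powr p) powr (1 / p)) \<longlonglongrightarrow> 0"
            by (rule tendsto_zero_powrI[OF _ tendsto_const]) (use True elim p in auto)
          then have "(\<lambda>k. \<bar>f (r k) x - \<phi> x\<bar>) \<longlonglongrightarrow> 0" using p by (simp add: powr_powr)
          then have "(\<lambda>k. f (r k) x) \<longlonglongrightarrow> \<phi> x" by (simp add: tendsto_rabs_zero_iff LIM_zero_iff)
          then have "(\<lambda>k. \<bar>f (r k) x\<bar> powr p) \<longlonglongrightarrow> \<bar>\<phi> x\<bar> powr p"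
            using p by (intro tendsto_powr2 tendsto_intros) auto
          from tendsto_mult_left[OF this, of "w x"] show ?thesis
            using True C(2)[of n] by (simp add: subset_iff)
        qed simp
      qed
    qed
  qed
  have "(\<integral>\<^sup>+x. ennreal (w x * \<bar>indicator \<Omega> x * \<phi> x\<bar> powr p) \<partial>lebesgue) \<le> B"
  proof (rule nn_integral_le_of_AE_tendsto[OF _ _ CB])
    show "(\<lambda>x. indicator (C n) x * (w x * \<bar>indicator \<Omega> x * \<phi> x\<bar> powr p)) \<in> borel_measurable lebesgue" for n
    proof -
      have [measurable]: "C n \<in> sets lebesgue" using C(1) by (rule compact_sets_lebesgue)
      show ?thesis by measurable
    qed
    show "AE x in lebesgue. (\<lambda>n. indicator (C n) x * (w x * \<bar>indicator \<Omega> x * \<phi> x\<bar> powr p)) \<longlonglongrightarrow>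
      w x * \<bar>indicator \<Omega> x * \<phi> x\<bar> powr p"
    proof (intro always_eventually allI)
      fix x
      show "(\<lambda>n. indicator (C n) x * (w x * \<bar>indicator \<Omega> x * \<phi> x\<bar> powr p)) \<longlonglongrightarrow>
        w x * \<bar>indicator \<Omega> x * \<phi> x\<bar> powr p"
      proof (cases "x \<in> \<Omega>")
        case True
        then obtain N where "\<forall>n\<ge>N. x \<in> C n" using C(3) by blast
        then have "\<forall>\<^sub>F n in sequentially. indicator (C n) x * (w x * \<bar>indicator \<Omega> x * \<phi> x\<bar> powr p)
          = w x * \<bar>indicator \<Omega> x * \<phi> x\<bar> powr p"
          by (auto simp: eventually_sequentially intro!: exI[of _ N])
        then show ?thesis by (rule tendsto_eventually)
      qed (simp add: w)
    qed
  qed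
  then show ?thesis by (simp add: w\<phi>)
qed

section \<open>Integrability of the Hardy-weight against the ground state\<close>

theorem theorem3p1:
  fixes \<Omega> K \<K> :: "(real^'n) set"
    and A :: "real^'n \<Rightarrow> real^'n^'n"
    and V W \<phi> :: "real^'n \<Rightarrow> real"
    and p :: real
  assumes "CARD('n) \<ge> 2"
    and "open \<Omega>" and "connected \<Omega>" and "\<Omega> \<noteq> {}"
    and "1 < p"
    and "A \<in> borel_measurable (lebesgue_on \<Omega>)"
    and "\<forall>x\<in>\<Omega>. transpose (A x) = A x"
    and "locally_elliptic \<Omega> A"
    and "p \<ge> 2 \<Longrightarrow> V \<in> morrey_p_loc p \<Omega>"
    and "p < 2 \<Longrightarrow> \<exists>\<gamma>. 0 < \<gamma> \<and> \<gamma> \<le> 1 \<and> hoelder_loc \<gamma> \<Omega> A"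
    and "p < 2 \<Longrightarrow> \<exists>q. ereal (real CARD('n)) < q \<and> V \<in> morrey_loc q \<Omega>"
    and "critical A V p \<Omega>"
    and "compact K" and "K \<subseteq> \<Omega>" and "emeasure lebesgue K > 0" and "smooth_boundary K"
    and "ground_state A V p \<Omega> \<phi>" and "Lp_norm p K \<phi> = 1"
    and "nonneg_nonzero_on (\<Omega> - K) W"
    and "hardy_inequality A V p (\<Omega> - K) W"
    and "compact \<K>" and "\<K> \<subseteq> \<Omega>" and "K \<subseteq> interior \<K>"
  shows "set_integrable lebesgue (\<Omega> - \<K>) (\<lambda>x. W x * \<phi> x powr p)"
proof -
  note [simp] = \<open>open \<Omega>\<close>
  have p: "1 < p" by fact
  note V = potential_locally_integrable_and_form_bounded[OF assms(1) p assms(9) assms(11)]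
  interpret quasilinear_form \<Omega> A V p
    by unfold_locales (use assms V in auto)
  have K\<K>: "K \<subseteq> \<K>" using assms(23) interior_subset by blast
  have \<K>: "compact \<K>" "\<K> \<subseteq> \<Omega>" by fact+
  have sets: "\<Omega> - K \<in> sets lebesgue" "\<Omega> - \<K> \<in> sets lebesgue" "\<K> \<in> sets lebesgue"
    using assms(13) \<K> by (auto intro: compact_sets_lebesgue)
  \<comment> \<open>\<open>K\<close> has positive measure, so \<K> is more than one point, and the
    form boundedness of \<open>V\<close> on \<K> becomes available.\<close>
  have "diameter \<K> > 0"
  proof (rule ccontr)
    assume "\<not> diameter \<K> > 0"
    from nn_integral_diameter_0[OF compact_imp_bounded[OF \<K>(1)] this, of "\<lambda>_. 1"]
    have "emeasure lebesgue \<K> = 0" using sets(3) by (simp del: emeasure_completion)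
    then show False using emeasure_mono[OF K\<K> sets(3)] assms(15) by simp
  qed
  then have fb: "form_bounded p \<K> V" using V(3) \<K> by blast
  obtain \<zeta> \<eta> :: "real^'n \<Rightarrow> real" and N C0 where
    \<zeta>: "smooth_on UNIV \<zeta>" "\<And>x. 0 \<le> \<zeta> x" "\<And>x. \<zeta> x \<le> 1" and N: "open N" "K \<subseteq> N" "\<And>x. x \<in> N \<Longrightarrow> \<zeta> x = 1" and
    \<zeta>0: "\<And>x. x \<notin> \<K> \<Longrightarrow> \<zeta> x = 0" "\<And>x. x \<notin> \<K> \<Longrightarrow> grad \<zeta> x = 0" and
    C0: "C0 \<ge> 0" "\<And>x. norm (grad \<zeta> x) powr p \<le> C0 * \<zeta> x powr (p - 1)" and
    \<eta>: "\<And>x. \<eta> differentiable (at x)" "continuous_on UNIV (grad \<eta>)" "\<And>x. 0 \<le> \<eta> x"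
    "\<And>x. \<eta> x powr p = \<zeta> x" "\<And>x. x \<notin> \<K> \<Longrightarrow> grad \<eta> x = 0" "\<And>x. norm (grad \<eta> x) powr p \<le> C0"
    by (rule power_cutoff[OF p assms(13,23)]) blast
  obtain C where C: "C \<ge> 0" "\<forall>\<phi>\<in>test_fun \<Omega>. (\<forall>x. 0 \<le> \<phi> x) \<longrightarrow>
    (\<lambda>x. (1 - \<zeta> x) * \<phi> x) \<in> test_fun \<Omega> \<longrightarrow>
    Q_form A V p \<Omega> (\<lambda>x. (1 - \<zeta> x) * \<phi> x) \<le> Q_form A V p \<Omega> \<phi> + C * (LINT x:\<K>|lebesgue. \<phi> x powr p)"
    using energy_cutoff_estimate[OF \<K> fb \<zeta> \<zeta>0 C0 \<eta>] by blast
  obtain f where f: "null_sequence A V p \<Omega> f" and conv: "\<And>C. compact C \<Longrightarrow> C \<subseteq> \<Omega> \<Longrightarrow> (\<lambda>k. Lp_norm p C (\<lambda>x. f k x - \<phi> x)) \<longlonglongrightarrow> 0"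
    and \<phi>: "\<phi> \<in> Lp_loc p \<Omega>" "AE x in lebesgue_on \<Omega>. 0 < \<phi> x"
    using assms(17) unfolding ground_state_def W1p_loc_def by blast
  have ft: "f k \<in> test_fun \<Omega>" "0 \<le> f k x" for k x using f by (auto simp: null_sequence_def)
  have fc: "continuous_on UNIV (f k)" for k using ft(1)[of k] smooth_on_continuous by (auto simp: test_fun_def)
  have "Bseq (\<lambda>k. Q_form A V p \<Omega> (f k))"
    using f by (auto simp: null_sequence_def intro: convergent_imp_Bseq convergentI)
  then obtain B1 where B1: "\<And>k. Q_form A V p \<Omega> (f k) \<le> B1"
    unfolding Bseq_def by (metis abs_le_D1 real_norm_def)
  \<comment> \<open>The lower-order mass is bounded because \<open>f k\<close> converges to \<phi>
    in L^p on \<K>.\<close>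
  have "\<exists>B. \<forall>k. (LINT x:\<K>|lebesgue. f k x powr p) \<le> B"
  proof (rule Lp_norm_convergent_bounded[OF p \<K>(1) fc ft(2) _ _ conv[OF \<K>]])
    show "\<phi> \<in> borel_measurable (lebesgue_on \<K>)"
      by (rule measurable_restrict_mono[OF _ \<K>(2)]) (use \<phi> in \<open>simp add: Lp_loc_def\<close>)
    show "set_integrable lebesgue \<K> (\<lambda>x. \<bar>\<phi> x\<bar> powr p)" using \<phi>(1) \<K> by (simp add: Lp_loc_def)
  qed
  then obtain B2 where B2: "\<And>k. (LINT x:\<K>|lebesgue. f k x powr p) \<le> B2" by blast
  define B where "B = B1 + C * B2"
  define \<psi> where "\<psi> k x = (1 - \<zeta> x) * f k x" for k x
  have \<psi>: "\<psi> k \<in> test_fun (\<Omega> - K)" "\<psi> k \<in> test_fun \<Omega>" for k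
    unfolding \<psi>_def[abs_def]
    by (rule test_fun_mult[OF ft(1) smooth_on_diff[OF smooth_on_const \<zeta>(1)] N(1) _ N(2)]; simp add: N(3))+
  have QB: "Q_form A V p (\<Omega> - K) (\<psi> k) \<le> B" for k
  proof -
    have 0: "\<psi> k x = 0" "grad (\<psi> k) x = 0" if "x \<in> K" for x
    proof -
      have "closure {x. \<psi> k x \<noteq> 0} \<subseteq> \<Omega> - K" using \<psi>(1)[of k] by (simp add: test_fun_def compactly_contained_def)
      then have "x \<notin> closure {x. \<psi> k x \<noteq> 0}" using that by blast
      then show "\<psi> k x = 0" "grad (\<psi> k) x = 0"
        using grad_eq_0_outside_closure closure_subset[of "{x. \<psi> k x \<noteq> 0}"] by auto
    qed
    \<comment> \<open>The cutoff estimate lives on \<Omega> and the Hardy inequality on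
      \<open>\<Omega> - K\<close>; the two energies agree since \<open>\<psi> k\<close> and its
      gradient vanish on \<open>K\<close>.\<close>
    have "Q_form A V p (\<Omega> - K) (\<psi> k) = Q_form A V p \<Omega> (\<psi> k)"
      unfolding Q_form_def set_lebesgue_integral_def
      by (intro Bochner_Integration.integral_cong) (auto simp: 0 split: split_indicator)
    also have "\<dots> \<le> Q_form A V p \<Omega> (f k) + C * (LINT x:\<K>|lebesgue. f k x powr p)"
      using C(2)[rule_format, OF ft] \<psi>(2)[of k] by (simp add: \<psi>_def[abs_def])
    also have "\<dots> \<le> B" unfolding B_def by (intro add_mono B1 mult_left_mono B2 C)
    finally show ?thesis .
  qed
  have Wm: "W \<in> borel_measurable (lebesgue_on (\<Omega> - K))" and W0: "AE x in lebesgue. x \<in> \<Omega> - K \<longrightarrow> 0 \<le> W x"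
    using assms(19) sets(1) by (auto simp: nonneg_nonzero_on_def AE_restrict_space_iff)
  \<comment> \<open>\<open>W\<close> is nonnegative only almost everywhere; \<open>|W|\<close> is an
    equivalent weight that is nonnegative at every point, as the limit lemma asks.\<close>
  define w where "w x = indicator (\<Omega> - \<K>) x * \<bar>W x\<bar>" for x
  have Wm': "W \<in> borel_measurable (lebesgue_on (\<Omega> - \<K>))"
    by (rule measurable_restrict_mono[OF Wm]) (use K\<K> in auto)
  have wm: "w \<in> borel_measurable lebesgue"
  proof -
    note Wm'[measurable]
    have "(\<lambda>x. \<bar>W x\<bar>) \<in> borel_measurable (lebesgue_on (\<Omega> - \<K>))" by measurable
    then show ?thesis unfolding w_def[abs_def]
      using sets(2) by (subst (asm) borel_measurable_restrict_space_iff) auto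
  qed
  have "(\<integral>\<^sup>+x. ennreal (w x * \<bar>f k x\<bar> powr p) \<partial>lebesgue) \<le> ennreal B" for k
  proof -
    have h: "set_integrable lebesgue (\<Omega> - K) (\<lambda>x. W x * \<bar>\<psi> k x\<bar> powr p)"
      "(LINT x:(\<Omega> - K)|lebesgue. W x * \<bar>\<psi> k x\<bar> powr p) \<le> Q_form A V p (\<Omega> - K) (\<psi> k)"
      using assms(20) \<psi>(1)[of k] by (auto simp: hardy_inequality_def)
    have "(\<integral>\<^sup>+x. ennreal (w x * \<bar>f k x\<bar> powr p) \<partial>lebesgue)
      \<le> (\<integral>\<^sup>+x. ennreal (indicator (\<Omega> - K) x *\<^sub>R (W x * \<bar>\<psi> k x\<bar> powr p)) \<partial>lebesgue)"
      using W0
    proof (intro nn_integral_mono_AE, eventually_elim)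
      case (elim x)
      \<comment> \<open>Off \<K> the cutoff is 0, so \<open>\<psi> k x = f k x\<close>; on
        \<open>\<K> - K\<close> the left side is 0 and the right side is nonnegative.\<close>
      show ?case
        using elim K\<K> \<zeta>0(1)[of x] by (intro ennreal_leI) (auto simp: w_def \<psi>_def split: split_indicator)
    qed
    also have "\<dots> = ennreal (LINT x:(\<Omega> - K)|lebesgue. W x * \<bar>\<psi> k x\<bar> powr p)"
      unfolding set_lebesgue_integral_def
      by (rule nn_integral_eq_integral)
        (use h W0 in \<open>auto simp: set_integrable_def split: split_indicator elim!: eventually_mono\<close>)
    also have "\<dots> \<le> ennreal B" using h(2) QB[of k] by (intro ennreal_leI) simp
    finally show ?thesis .
  qed
  then have fin: "(\<integral>\<^sup>+x. ennreal (w x * \<bar>\<phi> x\<bar> powr p) \<partial>lebesgue) \<le> ennreal B"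
    by (intro weighted_Lp_loc_limit[OF assms(2) p wm _ _ fc \<phi>(1) conv]) (auto simp: w_def)
  show ?thesis
    unfolding set_integrable_def
  proof (rule integrableI_bounded)
    have [measurable]: "\<phi> \<in> borel_measurable (lebesgue_on (\<Omega> - \<K>))"
      by (rule measurable_restrict_mono[of _ _ \<Omega>]) (use \<phi> in \<open>auto simp: Lp_loc_def\<close>)
    note Wm'[measurable]
    have "(\<lambda>x. W x * \<phi> x powr p) \<in> borel_measurable (lebesgue_on (\<Omega> - \<K>))" by measurable
    then show "(\<lambda>x. indicator (\<Omega> - \<K>) x *\<^sub>R (W x * \<phi> x powr p)) \<in> borel_measurable lebesgue"
      using sets(2) by (subst (asm) borel_measurable_restrict_space_iff) auto
    \<comment> \<open>Positivity of the ground state identifies \<open>\<phi> x powr p\<close> with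
      \<open>|\<phi> x| powr p\<close> almost everywhere.\<close>
    have "AE x in lebesgue. x \<in> \<Omega> \<longrightarrow> 0 < \<phi> x"
      using \<phi>(2) by (simp add: AE_restrict_space_iff)
    then have "(\<integral>\<^sup>+x. ennreal (norm (indicator (\<Omega> - \<K>) x *\<^sub>R (W x * \<phi> x powr p))) \<partial>lebesgue)
      = (\<integral>\<^sup>+x. ennreal (w x * \<bar>\<phi> x\<bar> powr p) \<partial>lebesgue)"
      by (intro nn_integral_cong_AE, eventually_elim) (auto simp: w_def abs_mult split: split_indicator)
    also have "\<dots> < \<infinity>" using fin by (auto intro: order_le_less_trans)
    finally show "(\<integral>\<^sup>+x. ennreal (norm (indicator (\<Omega> - \<K>) x *\<^sub>R (W x * \<phi> x powr p))) \<partial>lebesgue) < \<infinity>" .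
  qed
qed

end
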